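(* Let $(d_n)$ be a sequence of positive integers with the property that the limit \[ c:= \lim_{n\to\infty} \frac{\sqrt{n}}{d_n} \] exists. Then there exists a function $\Omega^{\textrm{SW}}_c \colon \mathbb{R}_+ \to \mathbb{R}_+$ with the property that for each $\epsilon>0$ \[ \lim_{n\to\infty} \mathbb{P}^{\mathrm{SW}}_{n,d_n}\left\{ \xi\in \mathcal{SP}_n : \sup_{x\geq 0} \left| \omega_{\frac{1}{\sqrt{2n}} \xi}(x) - \Omega^{\textrm{SW}}_{c}(x) \right| > \epsilon \right\} = 0. \]
   Context: A strict partition $\xi=(\xi_1>\dots>\xi_\ell>0)$ of $n$ is a strictly decreasing sequence of positive integers summing to $n$; $\mathcal{SP}_n$ denotes the set of strict partitions of $n$ and $\ell(\xi)$ the number of nonzero parts. The shifted Young diagram of $\xi$ is the set of boxes $\{(x,y): x,y\in\mathbb{N},\ 1\le y<x\le y+\xi_y\}$. In the shifted Russian convention one uses coordinates $z=x-y-\tfrac12$, $t=x+y-\tfrac12$; the upper boundary of the diagram is then the graph of a function $\omega_\xi\colon\mathbb{R}_+\to\mathbb{R}_+$ (the profile). For $r>0$ the profile of the dilated diagram is defined by $\omega_{r\xi}(z)=r\,\omega_\xi(z/r)$. For positive integers $n,d$ consider the ordered alphabet $\mathbb{A}_d=\{1'<1<2'<2<\dots<d'<d\}$, where $k'$ denotes the "circled" version of the letter $k$. Let $\Omega_{n,d}$ be the set of words $\mathbf{w}=(w_1,\dots,w_n)$ with $w_i\in\mathbb{A}_d$, equipped with the uniform probability measure. Shifted RSK correspondence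 is a bijection between such words and pairs $(P,Q)$ of tableaux of a common shape $\xi\in\mathcal{SP}_n$, where $P$ is a generalized shifted tableau (filling of the shifted diagram with elements of $\mathbb{A}_d$, weakly increasing along rows and columns, each circled letter appearing at most once in each row, each non-circled letter at most once in each column) and $Q$ is a standard shifted filling with $1,\dots,n$ (increasing rows and columns) in which each off-diagonal entry may be circled or not. The shifted Schur--Weyl measure $\mathbb{P}^{\mathrm{SW}}_{n,d}$ is the distribution of the common shape $\xi(\mathbf{w})$, explicitly \[ \mathbb{P}^{\mathrm{SW}}_{n,d}(\xi)=\frac{\#\{\text{generalized shifted tableaux of shape }\xi\text{ with entries in }\mathbb{A}_d\}\cdot g^\xi}{2^{\ell(\xi)}\, d^n}, \] where $g^\xi$ is the number of standard shifted tableaux of shape $\xi$. *)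

theory Defs
  imports "HOL-Analysis.Analysis"
begin

definition strict_partitions :: "nat \<Rightarrow> nat list set" where
  "strict_partitions n = {\<xi>. sorted_wrt (>) \<xi> \<and> (\<forall>k\<in>set \<xi>. 0 < k) \<and> sum_list \<xi> = n}"

text \<open>The parts are numbered from 1 and the list is padded with zeros.\<close>

definition part :: "nat list \<Rightarrow> nat \<Rightarrow> nat" where
  "part \<xi> y = (if 1 \<le> y \<and> y \<le> length \<xi> then \<xi> ! (y - 1) else 0)"

definition shifted_diagram :: "nat list \<Rightarrow> (nat \<times> nat) set" where
  "shifted_diagram \<xi> = {(x, y). 1 \<le> y \<and> y < x \<and> x \<le> y + part \<xi> y}"

text \<open>
  The box \<open>(x, y)\<close> is the unit square \<open>[x - 1, x] \<times> [y - 1, y]\<close>, so that in the coordinates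
  \<open>z = a - b - 1/2\<close>, \<open>t = a + b - 1/2\<close> the first axis \<open>b = 0\<close> becomes the line \<open>t = z\<close>.
  The upper boundary includes the part of this axis that lies beyond the diagram, hence
  \<open>profile \<xi> z = z\<close> for large \<open>z\<close>. Only arguments \<open>z \<ge> 0\<close> are meaningful.
\<close>

definition profile :: "nat list \<Rightarrow> real \<Rightarrow> real" where
  "profile \<xi> z = Sup {t. \<exists>a b. z = a - b - 1/2 \<and> t = a + b - 1/2 \<and>
      ((\<exists>(x, y) \<in> shifted_diagram \<xi>. a \<in> {real x - 1..real x} \<and> b \<in> {real y - 1..real y})
        \<or> (0 \<le> a \<and> b = 0))}"

definition dilated_profile :: "real \<Rightarrow> nat list \<Rightarrow> real \<Rightarrow> real" where
  "dilated_profile r \<xi> z = r * profile \<xi> (z / r)"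

datatype letter = Circled nat | Plain nat

text \<open>The rank encodes the order \<open>1' < 1 < 2' < 2 < \<dots>\<close>, where \<open>k'\<close> is \<open>Circled k\<close>.\<close>

fun letter_rank :: "letter \<Rightarrow> nat" where
  "letter_rank (Circled k) = 2 * k"
| "letter_rank (Plain k) = 2 * k + 1"

definition alphabet :: "nat \<Rightarrow> letter set" where
  "alphabet d = Circled ` {1..d} \<union> Plain ` {1..d}"

text \<open>
  Fillings are extensional functions on the diagram, so that distinct functions are distinct
  fillings. Rows have constant \<open>y\<close>, columns constant \<open>x\<close>.
\<close>

definition generalized_shifted_tableaux :: "nat \<Rightarrow> nat list \<Rightarrow> (nat \<times> nat \<Rightarrow> letter) set" where
  "generalized_shifted_tableaux d \<xi> = {T \<in> shifted_diagram \<xi> \<rightarrow>\<^sub>E alphabet d.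
      (\<forall>x x' y. (x, y) \<in> shifted_diagram \<xi> \<and> (x', y) \<in> shifted_diagram \<xi> \<and> x < x' \<longrightarrow>
         letter_rank (T (x, y)) \<le> letter_rank (T (x', y)) \<and>
         (\<forall>k. \<not> (T (x, y) = Circled k \<and> T (x', y) = Circled k))) \<and>
      (\<forall>x y y'. (x, y) \<in> shifted_diagram \<xi> \<and> (x, y') \<in> shifted_diagram \<xi> \<and> y < y' \<longrightarrow>
         letter_rank (T (x, y)) \<le> letter_rank (T (x, y')) \<and>
         (\<forall>k. \<not> (T (x, y) = Plain k \<and> T (x, y') = Plain k)))}"

definition standard_shifted_tableaux :: "nat list \<Rightarrow> (nat \<times> nat \<Rightarrow> nat) set" where
  "standard_shifted_tableaux \<xi> = {T \<in> extensional (shifted_diagram \<xi>).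
      bij_betw T (shifted_diagram \<xi>) {1..sum_list \<xi>} \<and>
      (\<forall>x x' y. (x, y) \<in> shifted_diagram \<xi> \<and> (x', y) \<in> shifted_diagram \<xi> \<and> x < x' \<longrightarrow>
         T (x, y) < T (x', y)) \<and>
      (\<forall>x y y'. (x, y) \<in> shifted_diagram \<xi> \<and> (x, y') \<in> shifted_diagram \<xi> \<and> y < y' \<longrightarrow>
         T (x, y) < T (x, y'))}"

text \<open>
  The law of the common shape of the two tableaux associated by shifted RSK with a uniformly
  random word of length \<open>n\<close> over \<open>alphabet d\<close>: the \<open>(2 d) ^ n\<close> words correspond bijectively to
  pairs \<open>(P, Q)\<close>, and the \<open>n - length \<xi>\<close> off-diagonal entries of \<open>Q\<close> may be circled freely.
\<close>

definition shifted_schur_weyl_mass :: "nat \<Rightarrow> nat \<Rightarrow> nat list \<Rightarrow> real" where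
  "shifted_schur_weyl_mass n d \<xi> =
     real (card (generalized_shifted_tableaux d \<xi>)) * real (card (standard_shifted_tableaux \<xi>))
       / (2 ^ length \<xi> * real d ^ n)"

definition shifted_schur_weyl :: "nat \<Rightarrow> nat \<Rightarrow> nat list measure" where
  "shifted_schur_weyl n d =
     point_measure (strict_partitions n) (\<lambda>\<xi>. ennreal (shifted_schur_weyl_mass n d \<xi>))"

end

theory Submission imports Defs begin

text \<open>
  Strict partitions are treated as finite sets of positive integers, and a diagram is encoded by
  its diagonal heights \<open>N S j = card {k \<in> S. j \<le> k}\<close>. Both \<open>g\<close> and the number of generalized
  tableaux satisfy one-box recursions: the first by removing the largest entry, the second (after
  division by \<open>2 ^ length \<xi>\<close>) by commuting ``add a box'' with ``add the two letters \<open>k'\<close>, \<open>k\<close>''.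
  Hence the measures for fixed \<open>d\<close> are coherent under random box removal, whose transition
  probabilities are residues of \<open>\<Prod>j. (y - j (j + 1)) / (y - j (j - 1))\<close>.

  On polynomials in \<open>q r = \<Sum>j. (j (j + 1)) ^ r - (j (j - 1)) ^ r\<close> the generator of box removal is
  triangular, and it is a derivation up to terms of lower weight. So \<open>n \<mapsto> E f\<close> solves a first-order
  difference equation. Its homogeneous solution is fixed by the limit \<open>n \<rightarrow> \<infinity>\<close> with \<open>d\<close> fixed, where
  all \<open>d\<close> rows are asymptotically equal because a supermartingale bounds the largest part.
  Consequently \<open>E f\<close> is a polynomial in \<open>n\<close> and \<open>1 / d\<close> of controlled weight, while covariances have
  strictly smaller weight. When \<open>\<surd>n / d \<rightarrow> c\<close> the rescaled moments therefore converge in probability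
  to constants. As the rescaled parts are bounded with high probability, Weierstrass approximation
  gives convergence of \<open>N\<close>, and the profile is \<open>z + 2 N z\<close> up to a bounded error.
\<close>


section \<open>Order ideals of the shifted quadrant\<close>

text \<open>The obstacle is that the one-box recursion in n does not see d at all. For a monomial of
  degree k it leaves a free multiple of \<open>falling n k\<close>, and this constant is where the
  alphabet enters. In the regime of fixed d that determines it, no law of large numbers for words is
  needed: at most d rows occur, so a power mean inequality bounds every observable from below, and
  the bound on the largest part gives the matching upper bound. The resulting limits are
  multiplicative, so covariances have no homogeneous part and lose at least a factor of order sqrt
  n. Two gradings are kept because they do different work: the degree is the eigenvalue of the
  generator and drives the inductions, the weight is the order of growth once d is of order sqrt n.
  Odd power sums of the parts suffice for the shape because the masses k / n at the points k^2 / n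
  form a probability measure for every strict partition of n, and they are its moments. All limits
  are taken along one filter on pairs (n, d), so the limit function depends on c alone and can be
  chosen before the sequence.\<close>

definition tail_count :: "nat set \<Rightarrow> nat \<Rightarrow> nat" where
  "tail_count S j = card {k \<in> S. j \<le> k}"

definition diagram :: "nat set \<Rightarrow> (nat \<times> nat) set" where
  "diagram S = {(x, y). 1 \<le> y \<and> y < x \<and> y \<le> tail_count S (x - y)}"

definition strict_sets :: "nat \<Rightarrow> nat set set" where
  "strict_sets n = {S. finite S \<and> 0 \<notin> S \<and> \<Sum>S = n}"

lemma strict_setsD: "S \<in> strict_sets n \<Longrightarrow> finite S" "S \<in> strict_sets n \<Longrightarrow> 0 \<notin> S"
  "S \<in> strict_sets n \<Longrightarrow> \<Sum>S = n"
  by (auto simp: strict_sets_def)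

lemma strict_sets_le: "S \<in> strict_sets n \<Longrightarrow> k \<in> S \<Longrightarrow> k \<le> n"
  unfolding strict_sets_def using member_le_sum[of k S id] by auto

lemma finite_strict_sets: "finite (strict_sets n)"
  by (rule finite_subset[of _ "Pow {..n}"]) (auto dest: strict_sets_le)

lemma strict_sets_0: "strict_sets 0 = {{}}"
  by (auto simp: strict_sets_def)

lemma tail_count_step: "finite S \<Longrightarrow> tail_count S j = tail_count S (Suc j) + (if j \<in> S then 1 else 0)"
proof -
  assume f: "finite S"
  have "{k \<in> S. j \<le> k} = {k \<in> S. Suc j \<le> k} \<union> (if j \<in> S then {j} else {})"
    by (auto simp: Suc_le_eq order_le_less)
  moreover have "card ({k \<in> S. Suc j \<le> k} \<union> (if j \<in> S then {j} else {}))
      = card {k \<in> S. Suc j \<le> k} + card (if j \<in> S then {j} else {})"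
    by (rule card_Un_disjoint) (use f in auto)
  ultimately show ?thesis by (simp add: tail_count_def)
qed

lemma tail_count_antimono: "finite S \<Longrightarrow> i \<le> j \<Longrightarrow> tail_count S j \<le> tail_count S i"
  unfolding tail_count_def by (rule card_mono) auto

text \<open>Distinct parts let the height drop by at most one per diagonal. This bound gives closure
  along columns, as antitonicity gives closure along rows.\<close>

lemma tail_count_lipschitz: "finite S \<Longrightarrow> tail_count S j \<le> tail_count S (j + i) + i"
proof (induction i)
  case (Suc i)
  then show ?case using tail_count_step[of S "j + i"] by (auto split: if_splits)
qed auto

lemma tail_count_eq_0: "(\<And>k. k \<in> S \<Longrightarrow> k < j) \<Longrightarrow> tail_count S j = 0"
  unfolding tail_count_def by (metis (no_types, lifting) Collect_empty_eq card.empty not_less)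

lemma tail_count_1: "0 \<notin> S \<Longrightarrow> tail_count S 1 = card S"
  unfolding tail_count_def by (rule arg_cong[of _ _ card]) (auto simp: Suc_le_eq, metis neq0_conv)

lemma mem_iff_tail_count: "finite S \<Longrightarrow> k \<in> S \<longleftrightarrow> tail_count S (Suc k) < tail_count S k"
  using tail_count_step[of S k] by auto

lemma tail_count_inject:
  assumes "finite S" "finite S'" "0 \<notin> S" "0 \<notin> S'" "\<And>j. 1 \<le> j \<Longrightarrow> tail_count S j = tail_count S' j"
  shows "S = S'"
proof -
  have "k \<in> S \<longleftrightarrow> k \<in> S'" for k
    using assms mem_iff_tail_count[of S k] mem_iff_tail_count[of S' k] by (cases k) auto
  then show ?thesis by blast
qed

text \<open>Both sides count boxes, by rows on the left and by diagonals on the right.\<close>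

lemma sum_tail_count: "finite S \<Longrightarrow> (\<And>k. k \<in> S \<Longrightarrow> k \<le> B) \<Longrightarrow> \<Sum>S = (\<Sum>j=1..B. tail_count S j)"
proof (induction rule: finite_induct)
  case empty
  then show ?case by (simp add: tail_count_def)
next
  case (insert x F)
  have t: "tail_count (insert x F) j = tail_count F j + (if j \<le> x then 1 else 0)" for j
  proof -
    have "{k \<in> insert x F. j \<le> k} = (if j \<le> x then insert x {k \<in> F. j \<le> k} else {k \<in> F. j \<le> k})"
      by auto
    then show ?thesis using insert by (simp add: tail_count_def)
  qed
  have "(\<Sum>j=1..B. if j \<le> x then 1 else 0) = card {j\<in>{1..B}. j \<le> x}"
    by (simp add: sum.If_cases Int_def)
  also have "{j\<in>{1..B}. j \<le> x} = {1..x}" using insert.prems[of x] by auto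
  finally show ?case using insert by (simp add: t sum.distrib)
qed

definition ideal :: "(nat \<times> nat) set \<Rightarrow> bool" where
  "ideal D \<longleftrightarrow> finite D \<and> (\<forall>x y. (x, y) \<in> D \<longrightarrow> 1 \<le> y \<and> y < x) \<and>
     (\<forall>x y x' y'. (x, y) \<in> D \<longrightarrow> 1 \<le> y' \<longrightarrow> y' \<le> y \<longrightarrow> y' < x' \<longrightarrow> x' \<le> x \<longrightarrow> (x', y') \<in> D)"

lemma idealD:
  assumes "ideal D"
  shows "finite D" "(x, y) \<in> D \<Longrightarrow> 1 \<le> y" "(x, y) \<in> D \<Longrightarrow> y < x"
    "(x, y) \<in> D \<Longrightarrow> 1 \<le> y' \<Longrightarrow> y' \<le> y \<Longrightarrow> y' < x' \<Longrightarrow> x' \<le> x \<Longrightarrow> (x', y') \<in> D"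
  using assms unfolding ideal_def by blast+

lemma finite_diagram: assumes "finite S" shows "finite (diagram S)"
proof -
  obtain B where B: "\<And>k. k \<in> S \<Longrightarrow> k < B"
    using assms finite_nat_set_iff_bounded by auto
  have "diagram S \<subseteq> {..B + card S} \<times> {..card S}"
  proof clarify
    fix x y assume "(x, y) \<in> diagram S"
    then have *: "1 \<le> y" "y < x" "y \<le> tail_count S (x - y)" by (auto simp: diagram_def)
    have "x - y < B"
    proof (rule ccontr)
      assume "\<not> x - y < B"
      then have "tail_count S (x - y) = 0" by (intro tail_count_eq_0) (use B in fastforce)
      then show False using * by auto
    qed
    moreover have "tail_count S (x - y) \<le> card S" unfolding tail_count_def by (rule card_mono) (use assms in auto)
    ultimately show "x \<in> {..B + card S} \<and> y \<in> {..card S}" using * by auto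
  qed
  then show ?thesis by (rule finite_subset) auto
qed

lemma ideal_diagram: assumes "finite S" shows "ideal (diagram S)"
  unfolding ideal_def
proof (intro conjI allI impI)
  fix x y x' y' assume a: "(x, y) \<in> diagram S" "1 \<le> y'" "y' \<le> y" "y' < x'" "x' \<le> x"
  have y: "y \<le> tail_count S (x - y)" "y < x" using a by (auto simp: diagram_def)
  have "y' \<le> tail_count S (x' - y')"
  proof (cases "x' - y' \<le> x - y")
    case True
    then show ?thesis using tail_count_antimono[OF assms True] y a by linarith
  next
    case False
    then obtain i where i: "x' - y' = (x - y) + i" by (metis le_add_diff_inverse nat_le_linear)
    then have "y' + i \<le> y" using a y by arith
    then show ?thesis using tail_count_lipschitz[OF assms, of "x - y" i] y a unfolding i by linarith
  qed
  then show "(x', y') \<in> diagram S" using a by (simp add: diagram_def)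
qed (use finite_diagram[OF assms] in \<open>auto simp: diagram_def\<close>)

lemma diagram_subset_iff:
  assumes "finite S"
  shows "diagram S \<subseteq> diagram S' \<longleftrightarrow> (\<forall>j\<ge>1. tail_count S j \<le> tail_count S' j)"
proof
  assume sub: "diagram S \<subseteq> diagram S'"
  show "\<forall>j\<ge>1. tail_count S j \<le> tail_count S' j"
  proof (intro allI impI)
    fix j :: nat assume j: "j \<ge> 1"
    show "tail_count S j \<le> tail_count S' j"
    proof (cases "tail_count S j")
      case (Suc m)
      then have "(j + tail_count S j, tail_count S j) \<in> diagram S" using j by (auto simp: diagram_def)
      then have "(j + tail_count S j, tail_count S j) \<in> diagram S'" using sub by blast
      then show ?thesis by (auto simp: diagram_def)
    qed auto
  qed
next
  assume "\<forall>j\<ge>1. tail_count S j \<le> tail_count S' j"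
  then show "diagram S \<subseteq> diagram S'" unfolding diagram_def
    by clarify (metis One_nat_def Suc_leI le_trans zero_less_diff)
qed

lemma diagram_inject:
  assumes "finite S" "finite S'" "0 \<notin> S" "0 \<notin> S'" "diagram S = diagram S'"
  shows "S = S'"
  by (rule tail_count_inject) (use assms diagram_subset_iff[of S S'] diagram_subset_iff[of S' S] in \<open>auto intro: le_antisym\<close>)

text \<open>The set is recovered as the places where the diagonal height \<open>h\<close> drops.
  Each drop is 0 or 1: a box on diagonal j + 1 has its row neighbour on diagonal j
  (\<open>h1\<close>), and a box on diagonal j has its neighbour in the same column on diagonal j +
  1, one row down (\<open>h2\<close>).\<close>

lemma ideal_eq_diagram:
  assumes D: "ideal D"
  obtains S where "finite S" "0 \<notin> S" "D = diagram S"
proof -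
  define h where "h j = card {y. (j + y, y) \<in> D}" for j
  define S where "S = {j. 1 \<le> j \<and> h (Suc j) < h j}"
  have fin: "finite {y. (j + y, y) \<in> D}" for j
  proof (rule finite_subset[of _ "snd ` D"])
    have "y \<in> snd ` D" if "(j + y, y) \<in> D" for y
      using that by (rule rev_image_eqI) simp
    then show "{y. (j + y, y) \<in> D} \<subseteq> snd ` D" by blast
  qed (use idealD(1)[OF D] in simp)
  have hset: "{y. (j + y, y) \<in> D} = {1..h j}" if "1 \<le> j" for j
  proof -
    define Y where "Y = {y. (j + y, y) \<in> D}"
    have Yf: "finite Y" using fin Y_def by simp
    have dc: "y' \<in> Y" if "y \<in> Y" "1 \<le> y'" "y' \<le> y" for y y'
      using that idealD(4)[OF D, of "j + y" y y' "j + y'"] \<open>1 \<le> j\<close> unfolding Y_def by auto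
    have p: "1 \<le> y" if "y \<in> Y" for y using that idealD(2)[OF D, of "j + y" y] unfolding Y_def by simp
    have "Y = {1..card Y}"
    proof (cases "Y = {}")
      case False
      have "Y \<subseteq> {1..Max Y}" by (meson Max_ge Yf atLeastAtMost_iff p subsetI)
      moreover have "{1..Max Y} \<subseteq> Y"
        by (meson Max_in[OF Yf False] atLeastAtMost_iff dc subsetI)
      ultimately have "Y = {1..Max Y}" by (rule subset_antisym)
      then have "card Y = Max Y" by (metis card_atLeastAtMost diff_Suc_1)
      show ?thesis unfolding \<open>card Y = Max Y\<close> by fact
    qed auto
    then show ?thesis by (simp add: Y_def h_def)
  qed
  have mem: "(j + y, y) \<in> D \<longleftrightarrow> 1 \<le> y \<and> y \<le> h j" if "1 \<le> j" for j y
    using eqset_imp_iff[OF hset[OF that], of y] by simp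
  have h1: "h (Suc j) \<le> h j" if "1 \<le> j" for j
  proof (cases "h (Suc j)")
    case (Suc m)
    then have "(Suc j + h (Suc j), h (Suc j)) \<in> D" using mem[of "Suc j" "h (Suc j)"] by auto
    then have "(j + h (Suc j), h (Suc j)) \<in> D"
      by (rule idealD(4)[OF D]) (use that Suc in auto)
    then show ?thesis using mem[OF that] by auto
  qed auto
  have h2: "h j \<le> Suc (h (Suc j))" if "1 \<le> j" for j
  proof (cases "h j \<le> 1")
    case False
    then have "(j + h j, h j) \<in> D" using mem[OF that, of "h j"] by auto
    then have "(Suc j + (h j - 1), h j - 1) \<in> D"
      by (rule idealD(4)[OF D]) (use False in auto)
    then show ?thesis using mem[of "Suc j" "h j - 1"] by auto
  qed auto
  have "finite (fst ` D)" using idealD(1)[OF D] by simp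
  then obtain B where B': "\<forall>x\<in>fst ` D. x < B" using finite_nat_set_iff_bounded by blast
  then have B: "x < B" if "(x, y) \<in> D" for x y using that by (metis fst_conv image_eqI)
  have hB: "h j = 0" if "B \<le> j" for j
  proof -
    have "(j + y, y) \<notin> D" for y using B[of "j + y" y] that by auto
    then have "{y. (j + y, y) \<in> D} = {}" by simp
    then show ?thesis by (simp add: h_def)
  qed
  have SB: "k < B" if "k \<in> S" for k
    using that hB[of k] by (cases "k < B") (auto simp: S_def)
  have Sf: "finite S"
    by (rule finite_subset[of _ "{..<B}"]) (use SB in auto)
  have t: "tail_count S j = h j" if "1 \<le> j" for j
  proof (cases "j \<le> B")
    case True
    then show ?thesis using that
    proof (induction j rule: inc_induct)
      case base
      have "tail_count S B = 0" by (rule tail_count_eq_0) (use SB in auto)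
      then show ?case using hB by simp
    next
      case (step j)
      have "j \<in> S \<longleftrightarrow> h (Suc j) < h j" using step by (simp add: S_def)
      moreover have "tail_count S (Suc j) = h (Suc j)" using step by simp
      ultimately show ?case using tail_count_step[OF Sf, of j] h1[of j] h2[of j] step by (simp split: if_splits)
    qed
  next
    case False
    have "tail_count S j = 0" by (rule tail_count_eq_0) (use SB False in fastforce)
    then show ?thesis using hB False by simp
  qed
  have "D = diagram S"
  proof (rule set_eqI)
    fix p :: "nat \<times> nat"
    obtain x y where p: "p = (x, y)" by (cases p)
    show "p \<in> D \<longleftrightarrow> p \<in> diagram S"
    proof (cases "1 \<le> y \<and> y < x")
      case True
      then have "1 \<le> x - y" by linarith
      then show ?thesis using mem[of "x - y" y] t[of "x - y"] True by (simp add: diagram_def p)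
    next
      case False
      then show ?thesis using idealD(2,3)[OF D, of x y] by (auto simp: diagram_def p)
    qed
  qed
  moreover have "0 \<notin> S" by (simp add: S_def)
  ultimately show ?thesis using Sf that by blast
qed

lemma card_diagram_diff:
  assumes "finite L" "finite M"
     and "diagram M \<subseteq> diagram L"
  shows "card (diagram L - diagram M) = \<Sum>L - \<Sum>M"
proof -
  have cd: "card (diagram S) = \<Sum>S" if f: "finite S" for S
  proof -
    obtain B where B: "\<And>k. k \<in> S \<Longrightarrow> k \<le> B"
      using f finite_nat_set_iff_bounded_le by auto
    have "bij_betw (\<lambda>(j, y). (j + y, y)) (SIGMA j:{1..B}. {1..tail_count S j}) (diagram S)"
    proof (rule bij_betwI[where g="\<lambda>(x, y). (x - y, y)"])
      show "(\<lambda>(x, y). (x - y, y)) \<in> diagram S \<rightarrow> (SIGMA j:{1..B}. {1..tail_count S j})"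
      proof
        fix p assume "p \<in> diagram S"
        then obtain x y where p: "p = (x, y)" and *: "1 \<le> y" "y < x" "y \<le> tail_count S (x - y)"
          by (auto simp: diagram_def)
        from * have "tail_count S (x - y) \<noteq> 0" by auto
        then have "x - y \<le> B" using tail_count_eq_0[of S "x - y"] B by (metis leI le_less_trans)
        then show "(case p of (x, y) \<Rightarrow> (x - y, y)) \<in> (SIGMA j:{1..B}. {1..tail_count S j})"
          using * by (auto simp: p)
      qed
    qed (auto simp: diagram_def)
    then have "card (diagram S) = card (SIGMA j:{1..B}. {1..tail_count S j})" by (rule bij_betw_same_card[symmetric])
    also have "\<dots> = (\<Sum>j=1..B. tail_count S j)" by (subst card_SigmaI) auto
    also have "\<dots> = \<Sum>S" using sum_tail_count[OF f B] by simp
    finally show ?thesis .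
  qed
  show ?thesis using assms(3) by (subst card_Diff_subset) (auto simp: finite_diagram assms cd)
qed

section \<open>Fillings and their level sets\<close>

text \<open>Both kinds of tableaux become one notion: weakly monotone maps to levels with a
  condition on each level set, a single box in one case and the letter rules in the other. One
  recursion then serves both counts.\<close>

definition fillings :: "(nat \<Rightarrow> (nat \<times> nat) set \<Rightarrow> bool) \<Rightarrow> nat \<Rightarrow> (nat \<times> nat) set \<Rightarrow> (nat \<times> nat \<Rightarrow> nat) set" where
  "fillings C m D = {T \<in> D \<rightarrow>\<^sub>E {..<m}.
     (\<forall>x y x' y'. (x, y) \<in> D \<longrightarrow> (x', y') \<in> D \<longrightarrow> x \<le> x' \<longrightarrow> y \<le> y' \<longrightarrow> T (x, y) \<le> T (x', y')) \<and>
     (\<forall>i<m. C i {p \<in> D. T p = i})}"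

lemma fillI:
  assumes "T \<in> D \<rightarrow>\<^sub>E {..<m}"
    and "\<And>x y x' y'. (x, y) \<in> D \<Longrightarrow> (x', y') \<in> D \<Longrightarrow> x \<le> x' \<Longrightarrow> y \<le> y' \<Longrightarrow> T (x, y) \<le> T (x', y')"
    and "\<And>i. i < m \<Longrightarrow> C i {p \<in> D. T p = i}"
  shows "T \<in> fillings C m D"
  using assms by (simp add: fillings_def)

lemma fillD:
  assumes "T \<in> fillings C m D"
  shows "T \<in> D \<rightarrow>\<^sub>E {..<m}"
    "(x, y) \<in> D \<Longrightarrow> (x', y') \<in> D \<Longrightarrow> x \<le> x' \<Longrightarrow> y \<le> y' \<Longrightarrow> T (x, y) \<le> T (x', y')"
    "i < m \<Longrightarrow> C i {p \<in> D. T p = i}"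
  using assms by (simp_all add: fillings_def)

lemma finite_fillings: "finite D \<Longrightarrow> finite (fillings C m D)"
  by (rule finite_subset[of _ "D \<rightarrow>\<^sub>E {..<m}"]) (auto simp: fillings_def intro: finite_PiE)

lemma fillings_0: "fillings C 0 D = (if D = {} then {\<lambda>_. undefined} else {})"
  by (auto simp: fillings_def)

lemma finite_subideals: "finite D \<Longrightarrow> finite {K. ideal K \<and> K \<subseteq> D \<and> P K}"
  by (rule finite_subset[of _ "Pow D"]) auto

text \<open>Cutting off the top level: a filling amounts to the ideal \<open>K\<close> of boxes
  below level m together with its restriction to \<open>K\<close>, and the top level fills
  \<open>D - K\<close>.\<close>

lemma card_fillings_Suc:
  assumes D: "ideal D"
  shows "card (fillings C (Suc m) D) =
    (\<Sum>K | ideal K \<and> K \<subseteq> D \<and> C m (D - K). card (fillings C m K))"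
proof -
  define I where "I = {K. ideal K \<and> K \<subseteq> D \<and> C m (D - K)}"
  define f where "f T = ({p \<in> D. T p < m}, restrict T {p \<in> D. T p < m})" for T :: "nat \<times> nat \<Rightarrow> nat"
  define g where "g = (\<lambda>(K :: (nat \<times> nat) set, T). (\<lambda>p. if p \<in> K then T p else if p \<in> D then m else undefined))"
  have finD: "finite D" using D by (rule idealD)
  have "bij_betw f (fillings C (Suc m) D) (SIGMA K:I. fillings C m K)"
  proof (rule bij_betwI[where g=g])
    show "f \<in> fillings C (Suc m) D \<rightarrow> (SIGMA K:I. fillings C m K)"
    proof
      fix T assume T: "T \<in> fillings C (Suc m) D"
      define K where "K = {p \<in> D. T p < m}"
      have TD: "T p < Suc m" if "p \<in> D" for p using fillD(1)[OF T] that by auto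
      have DK: "D - K = {p \<in> D. T p = m}"
        using TD by (fastforce simp: K_def)
      have "ideal K"
        unfolding ideal_def
      proof (intro conjI allI impI)
        show "finite K" using finD by (simp add: K_def)
        show "1 \<le> y" "y < x" if "(x, y) \<in> K" for x y
          using that idealD(2,3)[OF D, of x y] by (auto simp: K_def)
        fix x y x' y' assume a: "(x, y) \<in> K" "1 \<le> y'" "y' \<le> y" "y' < x'" "x' \<le> x"
        have xy: "(x, y) \<in> D" "T (x, y) < m" using a(1) by (simp_all add: K_def)
        have "(x', y') \<in> D" by (rule idealD(4)[OF D xy(1) a(2-5)])
        moreover have "T (x', y') \<le> T (x, y)" by (rule fillD(2)[OF T]) (use a xy calculation in auto)
        ultimately show "(x', y') \<in> K" using xy by (simp add: K_def)
      qed
      moreover have "C m (D - K)" unfolding DK by (rule fillD(3)[OF T]) simp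
      ultimately have KI: "K \<in> I" by (simp add: I_def K_def)
      have "restrict T K \<in> fillings C m K"
      proof (rule fillI)
        show "restrict T K \<in> K \<rightarrow>\<^sub>E {..<m}" by (auto simp: K_def)
        show "restrict T K (x, y) \<le> restrict T K (x', y')"
          if "(x, y) \<in> K" "(x', y') \<in> K" "x \<le> x'" "y \<le> y'" for x y x' y'
          using that fillD(2)[OF T, of x y x' y'] by (simp add: K_def)
        show "C i {p \<in> K. restrict T K p = i}" if "i < m" for i
        proof -
          have "{p \<in> K. restrict T K p = i} = {p \<in> D. T p = i}" using that by (auto simp: K_def)
          then show ?thesis using fillD(3)[OF T, of i] that by simp
        qed
      qed
      then show "f T \<in> (SIGMA K:I. fillings C m K)" using KI unfolding f_def K_def by blast
    qed
    show "g \<in> (SIGMA K:I. fillings C m K) \<rightarrow> fillings C (Suc m) D"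
    proof
      fix z assume "z \<in> (SIGMA K:I. fillings C m K)"
      then obtain K T where z: "z = (K, T)" and KI: "K \<in> I" and T: "T \<in> fillings C m K" by blast
      have K: "ideal K" "K \<subseteq> D" "C m (D - K)" using KI by (simp_all add: I_def)
      have cotrans_moment: "T p < m" if "p \<in> K" for p using fillD(1)[OF T] that by auto
      show "g z \<in> fillings C (Suc m) D"
      proof (rule fillI)
        show "g z \<in> D \<rightarrow>\<^sub>E {..<Suc m}"
          using cotrans_moment K(2) by (auto simp: g_def z less_Suc_eq)
        show "g z (x, y) \<le> g z (x', y')"
          if a: "(x, y) \<in> D" "(x', y') \<in> D" "x \<le> x'" "y \<le> y'" for x y x' y'
        proof (cases "(x', y') \<in> K")
          case True
          have "(x, y) \<in> K" by (rule idealD(4)[OF K(1) True]) (use a idealD(2,3)[OF D] in auto)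
          then show ?thesis using True fillD(2)[OF T, of x y x' y'] a by (simp add: g_def z)
        next
          case False
          then show ?thesis using a cotrans_moment[of "(x, y)"] by (auto simp: g_def z)
        qed
        show "C i {p \<in> D. g z p = i}" if "i < Suc m" for i
        proof (cases "i = m")
          case True
          have "{p \<in> D. g z p = i} = D - K" using True cotrans_moment by (fastforce simp: g_def z)
          then show ?thesis using K True by simp
        next
          case False
          have "{p \<in> D. g z p = i} = {p \<in> K. T p = i}" using False K by (auto simp: g_def z)
          then show ?thesis using fillD(3)[OF T, of i] that False by simp
        qed
      qed
    qed
    show "g (f T) = T" if "T \<in> fillings C (Suc m) D" for T
    proof
      fix p
      have "T p < Suc m" if "p \<in> D" using fillD(1)[OF \<open>T \<in> _\<close>] that by auto
      moreover have "T p = undefined" if "p \<notin> D" using PiE_arb[OF fillD(1)[OF \<open>T \<in> _\<close>] that] .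
      ultimately show "g (f T) p = T p" by (auto simp: g_def f_def)
    qed
    show "f (g z) = z" if zS: "z \<in> (SIGMA K:I. fillings C m K)" for z
    proof -
      obtain K T where z: "z = (K, T)" and KI: "K \<in> I" and T: "T \<in> fillings C m K" using zS by blast
      have K: "ideal K" "K \<subseteq> D" using KI by (simp_all add: I_def)
      have cotrans_moment: "T p < m" if "p \<in> K" for p using fillD(1)[OF T] that by auto
      have Tu: "T p = undefined" if "p \<notin> K" for p using PiE_arb[OF fillD(1)[OF T] that] .
      have 1: "{p \<in> D. g z p < m} = K"
        using K(2) cotrans_moment by (auto simp: g_def z)
      have "restrict (g z) K = T" using Tu by (auto simp: g_def z restrict_def)
      then show ?thesis unfolding f_def 1 by (simp add: z)
    qed
  qed
  then have "card (fillings C (Suc m) D) = card (SIGMA K:I. fillings C m K)" by (rule bij_betw_same_card)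
  also have "\<dots> = (\<Sum>K\<in>I. card (fillings C m K))"
    by (rule card_SigmaI) (use finD finite_subideals[of D] finite_fillings idealD(1) in \<open>auto simp: I_def\<close>)
  finally show ?thesis by (simp add: I_def)
qed

lemma sum_subideals:
  fixes F :: "(nat \<times> nat) set \<Rightarrow> 'b::comm_monoid_add"
  assumes "finite L"
  shows "(\<Sum>K | ideal K \<and> K \<subseteq> diagram L \<and> P K. F K)
    = (\<Sum>M | finite M \<and> 0 \<notin> M \<and> diagram M \<subseteq> diagram L \<and> P (diagram M). F (diagram M))"
proof (rule sum.reindex_bij_betw[symmetric])
  show "bij_betw diagram {M. finite M \<and> 0 \<notin> M \<and> diagram M \<subseteq> diagram L \<and> P (diagram M)}
     {K. ideal K \<and> K \<subseteq> diagram L \<and> P K}"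
    unfolding bij_betw_def
  proof
    show "inj_on diagram {M. finite M \<and> 0 \<notin> M \<and> diagram M \<subseteq> diagram L \<and> P (diagram M)}"
      by (rule inj_onI) (use diagram_inject in blast)
    show "diagram ` {M. finite M \<and> 0 \<notin> M \<and> diagram M \<subseteq> diagram L \<and> P (diagram M)}
        = {K. ideal K \<and> K \<subseteq> diagram L \<and> P K}"
    proof (intro subset_antisym subsetI)
      fix K assume "K \<in> {K. ideal K \<and> K \<subseteq> diagram L \<and> P K}"
      then have K: "ideal K" "K \<subseteq> diagram L" "P K" by auto
      obtain M where "finite M" "0 \<notin> M" "K = diagram M" using ideal_eq_diagram[OF K(1)] .
      then show "K \<in> diagram ` {M. finite M \<and> 0 \<notin> M \<and> diagram M \<subseteq> diagram L \<and> P (diagram M)}" using K by blast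
    qed (use ideal_diagram in auto)
  qed
qed

section \<open>Adding and removing boxes\<close>

text \<open>A part 1 that loses its box becomes 0 and must disappear, hence the removal of
  0.\<close>

definition lower :: "nat \<Rightarrow> nat set \<Rightarrow> nat set" where
  "lower k S = insert (k - 1) (S - {k}) - {0}"

definition upper :: "nat \<Rightarrow> nat set \<Rightarrow> nat set" where
  "upper k S = insert (Suc k) (S - {k})"

definition lowerable :: "nat set \<Rightarrow> nat set" where
  "lowerable S = {k \<in> S. k - 1 \<notin> S}"

text \<open>The element 0 stands for an empty row, from which a new part 1 can start.\<close>

definition raisable :: "nat set \<Rightarrow> nat set" where
  "raisable S = {k \<in> insert 0 S. Suc k \<notin> S}"

lemma finite_lowerable: "finite S \<Longrightarrow> finite (lowerable S)"
  by (simp add: lowerable_def)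

lemma finite_raisable: "finite S \<Longrightarrow> finite (raisable S)"
  by (simp add: raisable_def)

lemma tail_count_lower:
  assumes S: "finite S" "0 \<notin> S" and k: "k \<in> lowerable S" and j: "1 \<le> j"
  shows "tail_count S j = tail_count (lower k S) j + (if j = k then 1 else 0)"
proof -
  have k': "k \<in> S" "k - 1 \<notin> S" "1 \<le> k" using k S by (auto simp: lowerable_def Suc_le_eq intro: gr0I)
  have e: "{i \<in> lower k S. j \<le> i} = {i \<in> insert (k - 1) (S - {k}). j \<le> i}"
    using j by (auto simp: lower_def)
  consider "j < k" | "j = k" | "k < j" by linarith
  then show ?thesis
  proof cases
    case 1
    have "{i \<in> insert (k - 1) (S - {k}). j \<le> i} = insert (k - 1) ({i \<in> S. j \<le> i} - {k})" using 1 by auto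
    moreover have "card \<dots> = Suc (card ({i \<in> S. j \<le> i} - {k}))"
      by (rule card_insert_disjoint) (use S k' in auto)
    moreover have "Suc (card ({i \<in> S. j \<le> i} - {k})) = card {i \<in> S. j \<le> i}"
      by (rule card_Suc_Diff1) (use S k' 1 in auto)
    ultimately show ?thesis using 1 by (simp add: tail_count_def e)
  next
    case 2
    have "{i \<in> insert (k - 1) (S - {k}). j \<le> i} = {i \<in> S. j \<le> i} - {k}" using 2 k' by auto
    moreover have "Suc (card ({i \<in> S. j \<le> i} - {k})) = card {i \<in> S. j \<le> i}"
      by (rule card_Suc_Diff1) (use S k' 2 in auto)
    ultimately show ?thesis using 2 e by (simp add: tail_count_def)
  next
    case 3
    have "{i \<in> insert (k - 1) (S - {k}). j \<le> i} = {i \<in> S. j \<le> i}" using 3 by auto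
    then show ?thesis using 3 by (simp add: tail_count_def e)
  qed
qed

lemma lower_props: "finite S \<Longrightarrow> finite (lower k S)" "0 \<notin> lower k S"
  by (simp_all add: lower_def)

lemma sum_lower:
  assumes S: "finite S" "0 \<notin> S" and k: "k \<in> lowerable S"
  shows "\<Sum>S = Suc (\<Sum>(lower k S))"
proof -
  have k': "k \<in> S" "k - 1 \<notin> S" "1 \<le> k" using k S by (auto simp: lowerable_def Suc_le_eq intro: gr0I)
  have "\<Sum>(lower k S) = \<Sum>(insert (k - 1) (S - {k}))"
    unfolding lower_def by (rule sum.mono_neutral_left) (use S in auto)
  also have "\<dots> = (k - 1) + \<Sum>(S - {k})" by (subst sum.insert) (use S k' in auto)
  also have "Suc \<dots> = k + \<Sum>(S - {k})" using k' by simp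
  also have "\<dots> = \<Sum>S" using sum.remove[OF S(1) k'(1), of id] by simp
  finally show ?thesis by simp
qed

lemma lower_strict_sets: "S \<in> strict_sets (Suc n) \<Longrightarrow> k \<in> lowerable S \<Longrightarrow> lower k S \<in> strict_sets n"
  using sum_lower[of S k] lower_props by (simp add: strict_sets_def)

lemma lowerable_upper: "0 \<notin> S \<Longrightarrow> k \<in> raisable S \<Longrightarrow> Suc k \<in> lowerable (upper k S)"
  by (auto simp: lowerable_def raisable_def upper_def)

lemma raisable_lower: "0 \<notin> S \<Longrightarrow> k \<in> lowerable S \<Longrightarrow> k - 1 \<in> raisable (lower k S)"
  by (cases k) (auto simp: lowerable_def raisable_def lower_def)

lemma lower_upper: "0 \<notin> S \<Longrightarrow> k \<in> raisable S \<Longrightarrow> lower (Suc k) (upper k S) = S"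
  by (auto simp: raisable_def upper_def lower_def)

lemma upper_lower: "0 \<notin> S \<Longrightarrow> k \<in> lowerable S \<Longrightarrow> upper (k - 1) (lower k S) = S"
  by (cases k) (auto simp: lowerable_def upper_def lower_def)

lemma upper_props: "finite S \<Longrightarrow> finite (upper k S)" "0 \<notin> S \<Longrightarrow> 0 \<notin> upper k S"
  by (simp_all add: upper_def)

lemma upper_strict_sets: "S \<in> strict_sets n \<Longrightarrow> k \<in> raisable S \<Longrightarrow> upper k S \<in> strict_sets (Suc n)"
  using sum_lower[of "upper k S" "Suc k"] lowerable_upper[of S k] lower_upper[of S k] upper_props
  by (simp add: strict_sets_def)

lemma tail_count_upper:
  assumes S: "finite S" "0 \<notin> S" and k: "k \<in> raisable S" and j: "1 \<le> j"
  shows "tail_count (upper k S) j = tail_count S j + (if j = Suc k then 1 else 0)"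
  using tail_count_lower[of "upper k S" "Suc k" j] assms lowerable_upper[OF S(2) k] lower_upper[OF S(2) k] upper_props
  by simp

text \<open>Both sums run over the edges between consecutive levels of the graph of strict
  partitions, grouped by the larger end on the left and by the smaller end on the right.\<close>

lemma exchange_lower_upper:
  fixes F :: "nat set \<Rightarrow> nat set \<Rightarrow> 'b::comm_monoid_add"
  shows "(\<Sum>L\<in>strict_sets (Suc n). \<Sum>k\<in>lowerable L. F L (lower k L))
    = (\<Sum>M\<in>strict_sets n. \<Sum>k\<in>raisable M. F (upper k M) M)"
proof -
  have "(\<Sum>L\<in>strict_sets (Suc n). \<Sum>k\<in>lowerable L. F L (lower k L))
      = (\<Sum>(L, k)\<in>Sigma (strict_sets (Suc n)) lowerable. F L (lower k L))"
    by (rule sum.Sigma[OF finite_strict_sets]) (use finite_lowerable strict_setsD in blast)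
  also have "\<dots> = (\<Sum>(M, k)\<in>Sigma (strict_sets n) raisable. F (upper k M) M)"
  proof (rule sum.reindex_bij_witness[where i="\<lambda>(M, k). (upper k M, Suc k)" and j="\<lambda>(L, k). (lower k L, k - 1)"])
    fix p assume "p \<in> Sigma (strict_sets (Suc n)) lowerable"
    then obtain L k where p: "p = (L, k)" and a: "L \<in> strict_sets (Suc n)" "k \<in> lowerable L" by blast
    have z: "0 \<notin> L" using a by (simp add: strict_sets_def)
    have k: "Suc (k - 1) = k" using a z by (cases k) (auto simp: lowerable_def)
    show "(\<lambda>(M, k). (upper k M, Suc k)) ((\<lambda>(L, k). (lower k L, k - 1)) p) = p"
      using upper_lower[OF z a(2)] k by (simp add: p)
    show "(\<lambda>(L, k). (lower k L, k - 1)) p \<in> Sigma (strict_sets n) raisable"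
      using lower_strict_sets[OF a] raisable_lower[OF z a(2)] by (simp add: p)
    show "(\<lambda>(M, k). F (upper k M) M) ((\<lambda>(L, k). (lower k L, k - 1)) p) = (\<lambda>(L, k). F L (lower k L)) p"
      using upper_lower[OF z a(2)] by (simp add: p)
  next
    fix p assume "p \<in> Sigma (strict_sets n) raisable"
    then obtain M k where p: "p = (M, k)" and a: "M \<in> strict_sets n" "k \<in> raisable M" by blast
    have z: "0 \<notin> M" using a by (simp add: strict_sets_def)
    show "(\<lambda>(L, k). (lower k L, k - 1)) ((\<lambda>(M, k). (upper k M, Suc k)) p) = p"
      using lower_upper[OF z a(2)] by (simp add: p)
    show "(\<lambda>(M, k). (upper k M, Suc k)) p \<in> Sigma (strict_sets (Suc n)) lowerable"
      using upper_strict_sets[OF a] lowerable_upper[OF z a(2)] by (simp add: p)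
  qed
  also have "\<dots> = (\<Sum>M\<in>strict_sets n. \<Sum>k\<in>raisable M. F (upper k M) M)"
    by (rule sum.Sigma[symmetric, OF finite_strict_sets]) (use finite_raisable strict_setsD in blast)
  finally show ?thesis .
qed

lemma inj_on_lower: assumes "finite S" "0 \<notin> S" shows "inj_on (\<lambda>k. lower k S) (lowerable S)"
proof (rule inj_onI)
  fix k l assume a: "k \<in> lowerable S" "l \<in> lowerable S" "lower k S = lower l S"
  have "1 \<le> k" using a assms by (cases k) (auto simp: lowerable_def)
  then have "tail_count S k = tail_count (lower k S) k + 1" using tail_count_lower[OF assms a(1), of k] by simp
  moreover have "tail_count S k = tail_count (lower k S) k + (if k = l then 1 else 0)"
    unfolding a(3) using tail_count_lower[OF assms a(2) \<open>1 \<le> k\<close>] by simp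
  ultimately show "k = l" by (simp split: if_splits)
qed

text \<open>Nonnegative height differences with total 1 are concentrated on a single diagonal k; the
  possible height steps at k - 1 and k then force \<open>k \<in> L\<close> and
  \<open>k - 1 \<notin> L\<close>.\<close>

lemma covered_eq_lower:
  assumes L: "finite L" "0 \<notin> L"
  shows "{M. finite M \<and> 0 \<notin> M \<and> diagram M \<subseteq> diagram L \<and> card (diagram L - diagram M) = 1}
    = (\<lambda>k. lower k L) ` lowerable L"
proof (intro subset_antisym subsetI)
  fix M assume "M \<in> {M. finite M \<and> 0 \<notin> M \<and> diagram M \<subseteq> diagram L \<and> card (diagram L - diagram M) = 1}"
  then have M: "finite M" "0 \<notin> M" "diagram M \<subseteq> diagram L" "card (diagram L - diagram M) = 1" by auto
  have le: "tail_count M j \<le> tail_count L j" if "1 \<le> j" for j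
    using M(3) diagram_subset_iff[OF M(1)] that by auto
  have "finite (L \<union> M)" using L M by simp
  then obtain B where B: "\<forall>k\<in>L \<union> M. k \<le> B"
    using finite_nat_set_iff_bounded_le by blast
  have 1: "(\<Sum>j=1..B. tail_count L j - tail_count M j) = 1"
  proof -
    have "(\<Sum>j=1..B. tail_count L j - tail_count M j) = (\<Sum>j=1..B. tail_count L j) - (\<Sum>j=1..B. tail_count M j)"
      by (rule sum_subtractf_nat) (use le in auto)
    also have "\<dots> = \<Sum>L - \<Sum>M" using sum_tail_count[OF L(1), of B] sum_tail_count[OF M(1), of B] B by auto
    also have "\<dots> = 1" using card_diagram_diff[OF L(1) M(1) M(3)] M(4) by simp
    finally show ?thesis .
  qed
  then have "\<exists>k\<in>{1..B}. tail_count L k - tail_count M k = 1 \<and> (\<forall>j\<in>{1..B}. k \<noteq> j \<longrightarrow> tail_count L j - tail_count M j = 0)"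
    using sum_eq_1_iff[of "{1..B}" "\<lambda>j. tail_count L j - tail_count M j"] by simp
  then obtain k where k: "k \<in> {1..B}" "tail_count L k - tail_count M k = 1"
      "\<And>j. j \<in> {1..B} \<Longrightarrow> j \<noteq> k \<Longrightarrow> tail_count L j - tail_count M j = 0"
    by metis
  have big: "tail_count L j = 0 \<and> tail_count M j = 0" if "B < j" for j
    using B that by (auto intro!: tail_count_eq_0 dest: bspec)
  have t: "tail_count L j = tail_count M j + (if j = k then 1 else 0)" if "1 \<le> j" for j
    using k(2) k(3)[of j] le[OF that] big[of j] that by (cases "j \<le> B") auto
  have "k \<in> L" using t[of k] t[of "Suc k"] k(1) tail_count_antimono[OF M(1), of k "Suc k"] mem_iff_tail_count[OF L(1), of k] by auto
  moreover have "k - 1 \<notin> L"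
  proof (cases "k = 1")
    case False
    then have "tail_count L (k - 1) = tail_count M (k - 1)" "tail_count M (k - 1) \<le> tail_count M k + 1" "tail_count L k = tail_count M k + 1"
      using t[of "k - 1"] t[of k] k(1) tail_count_lipschitz[OF M(1), of "k - 1" 1] by auto
    then show ?thesis using mem_iff_tail_count[OF L(1), of "k - 1"] k(1) False by auto
  qed (use L in auto)
  ultimately have kl: "k \<in> lowerable L" by (simp add: lowerable_def)
  have "M = lower k L"
  proof (rule tail_count_inject[OF M(1) lower_props(1)[OF L(1)] M(2) lower_props(2)])
    fix j :: nat assume "1 \<le> j"
    then show "tail_count M j = tail_count (lower k L) j" using t[of j] tail_count_lower[OF L kl, of j] by simp
  qed
  then show "M \<in> (\<lambda>k. lower k L) ` lowerable L" using kl by blast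
next
  fix M assume "M \<in> (\<lambda>k. lower k L) ` lowerable L"
  then obtain k where k: "k \<in> lowerable L" "M = lower k L" by blast
  have sub: "diagram M \<subseteq> diagram L"
    unfolding k(2) diagram_subset_iff[OF lower_props(1)[OF L(1)]] using tail_count_lower[OF L k(1)] by simp
  have M: "finite M" "0 \<notin> M" unfolding k(2) by (rule lower_props(1)[OF L(1)], rule lower_props(2))
  have "card (diagram L - diagram M) = 1"
    using card_diagram_diff[OF L(1) M(1) sub] sum_lower[OF L k(1)] unfolding k(2) by linarith
  with M sub show "M \<in> {M. finite M \<and> 0 \<notin> M \<and> diagram M \<subseteq> diagram L \<and> card (diagram L - diagram M) = 1}"
    unfolding mem_Collect_eq by (intro conjI)
qed

definition std_count :: "nat set \<Rightarrow> nat" where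
  "std_count S = card (fillings (\<lambda>_ A. card A = 1) (\<Sum>S) (diagram S))"

lemma std_count_empty: "std_count {} = 1"
proof -
  have "diagram {} = {}" by (auto simp: diagram_def tail_count_def)
  then show ?thesis by (simp add: std_count_def fillings_0)
qed

text \<open>The largest entry occupies a removable box, and what remains is a standard filling of
  the smaller shape.\<close>

lemma std_count_rec:
  assumes "S \<in> strict_sets (Suc n)"
  shows "std_count S = (\<Sum>k\<in>lowerable S. std_count (lower k S))"
proof -
  have S: "finite S" "0 \<notin> S" "\<Sum>S = Suc n" using assms by (auto simp: strict_sets_def)
  have "std_count S = (\<Sum>K | ideal K \<and> K \<subseteq> diagram S \<and> card (diagram S - K) = 1. card (fillings (\<lambda>_ A. card A = 1) n K))"
    unfolding std_count_def S(3) by (rule card_fillings_Suc[OF ideal_diagram[OF S(1)]])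
  also have "\<dots> = (\<Sum>M | finite M \<and> 0 \<notin> M \<and> diagram M \<subseteq> diagram S \<and> card (diagram S - diagram M) = 1.
      card (fillings (\<lambda>_ A. card A = 1) n (diagram M)))"
    by (rule sum_subideals[OF S(1)])
  also have "\<dots> = (\<Sum>k\<in>lowerable S. card (fillings (\<lambda>_ A. card A = 1) n (diagram (lower k S))))"
    unfolding covered_eq_lower[OF S(1,2)] by (subst sum.reindex[OF inj_on_lower[OF S(1,2)]]) simp
  also have "\<dots> = (\<Sum>k\<in>lowerable S. std_count (lower k S))"
    by (rule sum.cong) (use sum_lower[OF S(1,2)] S(3) in \<open>auto simp: std_count_def\<close>)
  finally show ?thesis .
qed

section \<open>Interlacing and the Pieri rule\<close>

text \<open>In terms of parts this reads \<open>L_1 \<ge> M_1 \<ge> L_2 \<ge> M_2 \<ge> ...\<close>: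
  the skew shape from \<open>M\<close> to \<open>L\<close> meets each diagonal in at most one
  box.\<close>

definition interlaced :: "nat set \<Rightarrow> nat set \<Rightarrow> bool" where
  "interlaced M L \<longleftrightarrow> (\<forall>j\<ge>1. tail_count M j \<le> tail_count L j \<and> tail_count L j \<le> tail_count M j + 1)"

text \<open>The pair of letters \<open>k'\<close>, \<open>k\<close> fills the skew shape from \<open>M\<close> to \<open>L\<close> in
  \<open>2 ^ (card (M - L) + card L - card M)\<close> ways, one factor 2 per connected component; the factor
  \<open>2 ^ (card L - card M)\<close> is absorbed in the normalization of \<open>P\<close>.\<close>

definition strip_weight :: "nat set \<Rightarrow> nat set \<Rightarrow> real" where
  "strip_weight M L = (if interlaced M L then 2 ^ card (M - L) else 0)"

text \<open>Bookkeeping for the exponent in \<open>strip_weight\<close> when a box is added. Stated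
  with summands on both sides to avoid subtraction of naturals; \<open>C\<close> is the part
  untouched by the move.\<close>

lemma card_diff_upper:
  assumes "finite M" "0 \<notin> M" "finite X" "k \<in> raisable X"
  shows "card (M - upper k X) + of_bool (Suc k \<in> M) = card (M - X) + of_bool (k \<in> M)"
proof -
  define C where "C = M - X - {k, Suc k}"
  have k: "k \<in> X \<or> k = 0" "Suc k \<notin> X" using assms by (auto simp: raisable_def)
  have C: "finite C" "k \<notin> C" "Suc k \<notin> C" using assms by (auto simp: C_def)
  have "M - upper k X = (if k \<in> M then insert k C else C)"
    using k assms(2) by (auto simp: upper_def C_def)
  moreover have "M - X = (if Suc k \<in> M then insert (Suc k) C else C)"
    using k assms(2) by (auto simp: C_def)
  ultimately show ?thesis using C by simp
qed

lemma card_diff_lower: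
  assumes "finite M" "0 \<notin> M" "finite X" "Suc k \<in> lowerable M"
  shows "card (lower (Suc k) M - X) + of_bool (Suc k \<notin> X) = card (M - X) + of_bool (k \<notin> X \<and> k \<noteq> 0)"
proof -
  define C where "C = M - X - {k, Suc k}"
  have k: "Suc k \<in> M" "k \<notin> M" using assms by (auto simp: lowerable_def)
  have C: "finite C" "k \<notin> C" "Suc k \<notin> C" using assms by (auto simp: C_def)
  have "lower (Suc k) M - X = (if k \<notin> X \<and> k \<noteq> 0 then insert k C else C)"
    using k assms(2) by (auto simp: lower_def C_def)
  moreover have "M - X = (if Suc k \<notin> X then insert (Suc k) C else C)"
    using k assms(2) by (auto simp: C_def)
  ultimately show ?thesis using C by simp
qed

lemma interlaced_upper_iff:
  assumes "finite X" "0 \<notin> X" "k \<in> raisable X"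
  shows "interlaced M (upper k X) \<longleftrightarrow>
    (\<forall>j\<ge>1. tail_count M j \<le> tail_count X j + of_bool (j = Suc k) \<and> tail_count X j + of_bool (j = Suc k) \<le> tail_count M j + 1)"
  unfolding interlaced_def using tail_count_upper[OF assms] by (simp add: of_bool_def)

lemma interlaced_lower_iff:
  assumes "finite M" "0 \<notin> M" "Suc k \<in> lowerable M"
  shows "interlaced (lower (Suc k) M) X \<longleftrightarrow>
    (\<forall>j\<ge>1. tail_count M j \<le> tail_count X j + of_bool (j = Suc k) \<and> tail_count X j + of_bool (j = Suc k) \<le> tail_count M j + 1)"
proof -
  have "(tail_count (lower (Suc k) M) j \<le> tail_count X j \<and> tail_count X j \<le> tail_count (lower (Suc k) M) j + 1) \<longleftrightarrow>
     (tail_count M j \<le> tail_count X j + of_bool (j = Suc k) \<and> tail_count X j + of_bool (j = Suc k) \<le> tail_count M j + 1)"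
    if "1 \<le> j" for j using tail_count_lower[OF assms that] by auto
  then show ?thesis unfolding interlaced_def by blast
qed

text \<open>The value 1 at 0 is a convention rather than a height difference. It lets the creation
  of a new part obey the general formula and makes \<open>potential M X 0\<close> equal to
  1.\<close>

definition gap :: "nat set \<Rightarrow> nat set \<Rightarrow> nat \<Rightarrow> real" where
  "gap M X j = (if j = 0 then 1 else real (tail_count X j) - real (tail_count M j))"

text \<open>Up to the weight of \<open>(M, X)\<close>, the contributions of the diagonal \<open>k\<close> to the two sides of the
  commutation relation differ by \<open>potential M X k - potential M X (Suc k)\<close>, so the sum over \<open>k\<close> telescopes.\<close>

definition potential :: "nat set \<Rightarrow> nat set \<Rightarrow> nat \<Rightarrow> real" where
  "potential M X k = gap M X k + gap M X (Suc k) - gap M X k * gap M X (Suc k)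
     + 2 * of_bool (k \<in> X \<and> k \<in> M) * (1 - gap M X k)"

context
  fixes M X :: "nat set" and up down :: "nat \<Rightarrow> real"
  assumes M: "finite M" "0 \<notin> M" and X: "finite X" "0 \<notin> X"
  defines "up \<equiv> \<lambda>k. if k \<in> raisable X then strip_weight M (upper k X) else 0"
    and "down \<equiv> \<lambda>k. if Suc k \<in> lowerable M then strip_weight (lower (Suc k) M) X else 0"
begin

text \<open>Both modified pairs are interlaced under one and the same condition \<open>I\<close>. If
  it holds although the pair itself is not interlaced, then \<open>M\<close> exceeds
  \<open>X\<close> by one on diagonal k + 1. This fixes both sets near k, so both moves exist and
  carry equal weights.\<close>

lemma up_eq_down_not_interlaced:
  assumes ni: "\<not> interlaced M X"
  shows "up k = down k"
proof -
  define I where "I \<longleftrightarrow> (\<forall>j\<ge>1. tail_count M j \<le> tail_count X j + of_bool (j = Suc k) \<and> tail_count X j + of_bool (j = Suc k) \<le> tail_count M j + 1)"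
  have uI: "interlaced M (upper k X) \<longleftrightarrow> I" if "k \<in> raisable X"
    unfolding I_def by (rule interlaced_upper_iff[OF X that])
  have lI: "interlaced (lower (Suc k) M) X \<longleftrightarrow> I" if "Suc k \<in> lowerable M"
    unfolding I_def by (rule interlaced_lower_iff[OF M that])
  show ?thesis
  proof (cases I)
    case False
    then show ?thesis using uI lI by (simp add: up_def down_def strip_weight_def)
  next
    case True
    have Ij: "tail_count M j \<le> tail_count X j + of_bool (j = Suc k) \<and> tail_count X j + of_bool (j = Suc k) \<le> tail_count M j + 1"
      if "1 \<le> j" for j using True that unfolding I_def by blast
    \<comment> \<open>On all diagonals other than k + 1 the condition \<open>I\<close> is plain
      interlacing, so the failure has to happen there.\<close>
    have 1: "tail_count M (Suc k) = tail_count X (Suc k) + 1"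
    proof (rule ccontr)
      assume "tail_count M (Suc k) \<noteq> tail_count X (Suc k) + 1"
      then have "tail_count M j \<le> tail_count X j \<and> tail_count X j \<le> tail_count M j + 1" if "1 \<le> j" for j
        using Ij[OF that] by (cases "j = Suc k") auto
      then show False using ni unfolding interlaced_def by blast
    qed
    have 2: "Suc k \<in> M" "Suc k \<notin> X"
      using Ij[of "Suc (Suc k)"] 1 tail_count_step[OF M(1), of "Suc k"] tail_count_step[OF X(1), of "Suc k"]
      by (simp_all split: if_splits)
    have 3: "k \<notin> M" "k \<in> X \<or> k = 0"
      using Ij[of k] 1 tail_count_step[OF M(1), of k] tail_count_step[OF X(1), of k] M X
      by (cases k; simp split: if_splits)+
    have ru: "k \<in> raisable X" "Suc k \<in> lowerable M" using 2 3 by (auto simp: raisable_def lowerable_def)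
    have "card (M - upper k X) = card (lower (Suc k) M - X)"
      using card_diff_upper[OF M X(1) ru(1)] card_diff_lower[OF M X(1) ru(2)] 2 3 by auto
    then show ?thesis using ru True uI lI by (simp add: up_def down_def strip_weight_def)
  qed
qed

text \<open>Here all gaps are 0 or 1 and neighbouring gaps are linked by membership in
  \<open>X\<close> and \<open>M\<close>, so the identity becomes a finite check over membership of k
  and k + 1.\<close>

lemma up_down_interlaced:
  assumes il: "interlaced M X"
  shows "up k - down k = strip_weight M X * (potential M X k - potential M X (Suc k))"
proof -
  have g01: "gap M X j = 0 \<or> gap M X j = 1" for j
  proof (cases "j = 0")
    case False
    then have "tail_count M j \<le> tail_count X j \<and> tail_count X j \<le> tail_count M j + 1" using il unfolding interlaced_def by (metis One_nat_def Suc_leI neq0_conv)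
    then show ?thesis using False unfolding gap_def by auto
  qed (simp add: gap_def)
  have gs: "gap M X j = gap M X (Suc j) + of_bool (j \<in> X) - of_bool (j \<in> M)" if "j \<noteq> 0" for j
    using tail_count_step[OF M(1), of j] tail_count_step[OF X(1), of j] that by (simp add: gap_def)
  have le: "tail_count M j \<le> tail_count X j \<and> tail_count X j \<le> tail_count M j + 1" if "1 \<le> j" for j
    using il that unfolding interlaced_def by blast
  have le_iff: "(\<forall>j\<ge>1. tail_count M j \<le> tail_count X j + of_bool (j = Suc k) \<and> tail_count X j + of_bool (j = Suc k) \<le> tail_count M j + 1)
      \<longleftrightarrow> tail_count X (Suc k) = tail_count M (Suc k)" (is "?l = ?r")
  proof
    assume ?l
    then have "tail_count X (Suc k) + of_bool (Suc k = Suc k) \<le> tail_count M (Suc k) + 1" by (metis le_add1 plus_1_eq_Suc)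
    then show ?r using le[of "Suc k"] by simp
  next
    assume ?r
    show ?l
    proof (intro allI impI)
      fix j :: nat assume "1 \<le> j"
      then show "tail_count M j \<le> tail_count X j + of_bool (j = Suc k) \<and> tail_count X j + of_bool (j = Suc k) \<le> tail_count M j + 1"
        using le[of j] \<open>?r\<close> by (cases "j = Suc k") auto
    qed
  qed
  have ilu: "interlaced M (upper k X) \<longleftrightarrow> gap M X (Suc k) = 0" if "k \<in> raisable X"
    unfolding interlaced_upper_iff[OF X that] le_iff by (simp add: gap_def)
  have ill: "interlaced (lower (Suc k) M) X \<longleftrightarrow> gap M X (Suc k) = 0" if "Suc k \<in> lowerable M"
    unfolding interlaced_lower_iff[OF M that] le_iff by (simp add: gap_def)
  define P where "P = strip_weight M X"
  have P: "P = 2 ^ card (M - X)" using il by (simp add: P_def strip_weight_def)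
  \<comment> \<open>A move changes the exponent only through membership of k and k + 1, which gives
    the quotient of factors 1 and 2.\<close>
  have up: "up k = (if k \<in> raisable X \<and> gap M X (Suc k) = 0
      then P * (if k \<in> M then 2 else 1) / (if Suc k \<in> M then 2 else 1) else 0)"
  proof (cases "k \<in> raisable X \<and> gap M X (Suc k) = 0")
    case True
    have "(2::real) ^ (card (M - upper k X) + of_bool (Suc k \<in> M)) = 2 ^ (card (M - X) + of_bool (k \<in> M))"
      using card_diff_upper[OF M X(1), of k] True by simp
    then show ?thesis using True ilu by (simp add: up_def strip_weight_def P power_add of_bool_def split: if_splits)
  next
    case False
    then show ?thesis using ilu by (auto simp: up_def strip_weight_def)
  qed
  have down: "down k = (if Suc k \<in> lowerable M \<and> gap M X (Suc k) = 0
      then P * (if k \<notin> X \<and> k \<noteq> 0 then 2 else 1) / (if Suc k \<notin> X then 2 else 1) else 0)"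
  proof (cases "Suc k \<in> lowerable M \<and> gap M X (Suc k) = 0")
    case True
    have "(2::real) ^ (card (lower (Suc k) M - X) + of_bool (Suc k \<notin> X)) = 2 ^ (card (M - X) + of_bool (k \<notin> X \<and> k \<noteq> 0))"
      using card_diff_lower[OF M X(1), of k] True by simp
    then show ?thesis using True ill
      by (cases "k = 0"; cases "k \<in> X"; cases "Suc k \<in> X"; simp add: down_def strip_weight_def P power_add)
  next
    case False
    then show ?thesis using ill by (auto simp: down_def strip_weight_def)
  qed
  have r: "k \<in> raisable X \<longleftrightarrow> (k \<in> X \<or> k = 0) \<and> Suc k \<notin> X" by (auto simp: raisable_def)
  have l: "Suc k \<in> lowerable M \<longleftrightarrow> Suc k \<in> M \<and> k \<notin> M" by (auto simp: lowerable_def)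
  have pot: "potential M X k - potential M X (Suc k) = gap M X k - gap M X k * gap M X (Suc k) + 2 * of_bool (k \<in> X \<and> k \<in> M) * (1 - gap M X k)
     - (gap M X (Suc (Suc k)) - gap M X (Suc k) * gap M X (Suc (Suc k)) + 2 * of_bool (Suc k \<in> X \<and> Suc k \<in> M) * (1 - gap M X (Suc k)))"
    by (simp add: potential_def)
  show ?thesis
  proof (cases "k = 0")
    case True
    have "gap M X 0 = 1" by (simp add: gap_def)
    then show ?thesis
      unfolding up down r l pot P_def[symmetric] using True g01[of "Suc k"] g01[of "Suc (Suc k)"] gs[of "Suc k"] M X
      by (cases "Suc k \<in> X"; cases "Suc k \<in> M") auto
  next
    case False
    then show ?thesis
      unfolding up down r l pot P_def[symmetric]
      using g01[of k] g01[of "Suc k"] g01[of "Suc (Suc k)"] gs[of "Suc k"] gs[OF False]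
      by (cases "Suc k \<in> X"; cases "Suc k \<in> M"; cases "k \<in> X"; cases "k \<in> M") auto
  qed
qed

end

text \<open>After summation over k only the boundary values of \<open>potential\<close> survive: 0
  beyond all parts and 1 at k = 0. The latter is the extra term
  \<open>strip_weight M X\<close>.\<close>

lemma strip_weight_commute:
  assumes M: "finite M" "0 \<notin> M" and X: "finite X" "0 \<notin> X"
  shows "(\<Sum>k\<in>raisable X. strip_weight M (upper k X)) = strip_weight M X + (\<Sum>k\<in>lowerable M. strip_weight (lower k M) X)"
proof -
  define up where "up k = (if k \<in> raisable X then strip_weight M (upper k X) else 0)" for k
  define down where "down k = (if Suc k \<in> lowerable M then strip_weight (lower (Suc k) M) X else 0)" for k
  have "finite (X \<union> M)" using M X by simp
  then obtain B where B: "\<forall>k\<in>X \<union> M. k < B" using finite_nat_set_iff_bounded by blast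
  have BX: "k < Suc B" if "k \<in> X" for k using B that by (metis UnCI less_SucI)
  have BM: "k < B" if "Suc k \<in> M" for k using B that by (metis UnCI Suc_lessD)
  have ud: "up k - down k = strip_weight M X * (potential M X k - potential M X (Suc k))" for k
  proof (cases "interlaced M X")
    case True
    then show ?thesis using up_down_interlaced[OF M X True] by (simp add: up_def down_def)
  next
    case False
    then show ?thesis using up_eq_down_not_interlaced[OF M X False] by (simp add: up_def down_def strip_weight_def)
  qed
  have "(\<Sum>k<Suc B. up k) - (\<Sum>k<Suc B. down k) = strip_weight M X * (\<Sum>k<Suc B. potential M X k - potential M X (Suc k))"
    unfolding sum_subtractf[symmetric] ud by (rule sum_distrib_left[symmetric])
  also have "(\<Sum>k<Suc B. potential M X k - potential M X (Suc k)) = potential M X 0 - potential M X (Suc B)"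
    by (rule sum_lessThan_telescope')
  also have "potential M X 0 = 1" using M X by (simp add: potential_def gap_def)
  also have "potential M X (Suc B) = 0"
  proof -
    have t: "tail_count X j = 0" "tail_count M j = 0" if "B \<le> j" for j
      using tail_count_eq_0[of X j] tail_count_eq_0[of M j] B that by (meson UnCI order_less_le_trans)+
    have "Suc B \<notin> X" using B by (metis UnI1 not_less_eq less_asym' lessI)
    then show ?thesis by (simp add: potential_def gap_def t)
  qed
  finally have 1: "(\<Sum>k<Suc B. up k) = strip_weight M X + (\<Sum>k<Suc B. down k)" by simp
  have "(\<Sum>k<Suc B. up k) = (\<Sum>k\<in>raisable X. strip_weight M (upper k X))"
  proof -
    have "(\<Sum>k\<in>raisable X. strip_weight M (upper k X)) = (\<Sum>k\<in>raisable X. up k)" by (simp add: up_def)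
    also have "\<dots> = (\<Sum>k<Suc B. up k)"
      by (rule sum.mono_neutral_left) (use BX in \<open>auto simp: raisable_def up_def\<close>)
    finally show ?thesis by simp
  qed
  moreover have kpos: "Suc (k - 1) = k" if "k \<in> M" for k using M that by (cases k) auto
  have "(\<Sum>k<Suc B. down k) = (\<Sum>k\<in>lowerable M. strip_weight (lower k M) X)"
  proof -
    have "(\<Sum>k\<in>lowerable M. strip_weight (lower k M) X) = (\<Sum>k\<in>{k. Suc k \<in> lowerable M}. down k)"
      by (rule sum.reindex_bij_witness[where i=Suc and j="\<lambda>k. k - 1"])
         (use kpos in \<open>auto simp: down_def lowerable_def\<close>)
    also have "\<dots> = (\<Sum>k<Suc B. down k)"
      by (rule sum.mono_neutral_left) (use BM in \<open>auto simp: lowerable_def down_def less_Suc_eq\<close>)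
    finally show ?thesis by simp
  qed
  ultimately show ?thesis using 1 by simp
qed

text \<open>\<open>schurP d L\<close> is the Schur \<open>P\<close>-function of \<open>L\<close> at \<open>d\<close> variables equal to 1.\<close>

fun schurP :: "nat \<Rightarrow> nat set \<Rightarrow> real" where
  "schurP 0 L = of_bool (L = {})"
| "schurP (Suc d) L = (\<Sum>n\<le>\<Sum>L. \<Sum>M\<in>strict_sets n. strip_weight M L * schurP d M)"

lemma strip_weight_eq_0:
  assumes "finite L" "finite M" "\<Sum>L < \<Sum>M"
  shows "strip_weight M L = 0"
proof (rule ccontr)
  assume "strip_weight M L \<noteq> 0"
  then have il: "interlaced M L" by (auto simp: strip_weight_def split: if_splits)
  have "finite (L \<union> M)" using assms by simp
  then obtain B where B: "\<forall>k\<in>L \<union> M. k \<le> B" using finite_nat_set_iff_bounded_le by blast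
  have "(\<Sum>j=1..B. tail_count M j) \<le> (\<Sum>j=1..B. tail_count L j)"
    by (rule sum_mono) (use il in \<open>auto simp: interlaced_def\<close>)
  then show False using sum_tail_count[OF assms(1), of B] sum_tail_count[OF assms(2), of B] B assms(3) by simp
qed

text \<open>A common summation range for a set and all its enlargements, as needed to exchange sums
  in the Pieri rule.\<close>

lemma schurP_Suc_bound:
  assumes "finite L" "\<Sum>L \<le> N"
  shows "schurP (Suc d) L = (\<Sum>n\<le>N. \<Sum>M\<in>strict_sets n. strip_weight M L * schurP d M)"
  unfolding schurP.simps
proof (rule sum.mono_neutral_left)
  show "\<forall>n\<in>{..N} - {..\<Sum>L}. (\<Sum>M\<in>strict_sets n. strip_weight M L * schurP d M) = 0"
  proof
    fix n assume "n \<in> {..N} - {..\<Sum>L}"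
    then have "strip_weight M L = 0" if "M \<in> strict_sets n" for M
      by (intro strip_weight_eq_0) (use assms that in \<open>auto simp: strict_sets_def\<close>)
    then show "(\<Sum>M\<in>strict_sets n. strip_weight M L * schurP d M) = 0" by simp
  qed
qed (use assms in auto)

text \<open>The Pieri rule for multiplication by the first power sum, whose value at d ones is d.
  Each letter pair contributes one copy of the left factor through
  \<open>strip_weight_commute\<close>.\<close>

lemma schurP_pieri:
  assumes "S \<in> strict_sets n"
  shows "(\<Sum>k\<in>raisable S. schurP d (upper k S)) = real d * schurP d S"
  using assms
proof (induction d arbitrary: S n)
  case 0
  then show ?case by (simp add: upper_def)
next
  case (Suc d)
  note S = strict_setsD[OF Suc.prems]
  have u: "upper k S \<in> strict_sets (Suc n)" if "k \<in> raisable S" for k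
    using upper_strict_sets[OF Suc.prems that] .
  have "(\<Sum>k\<in>raisable S. schurP (Suc d) (upper k S))
      = (\<Sum>k\<in>raisable S. \<Sum>m\<le>Suc n. \<Sum>M\<in>strict_sets m. strip_weight M (upper k S) * schurP d M)"
    by (rule sum.cong[OF refl], rule schurP_Suc_bound) (use u in \<open>auto simp: strict_sets_def\<close>)
  also have "\<dots> = (\<Sum>m\<le>Suc n. \<Sum>M\<in>strict_sets m. \<Sum>k\<in>raisable S. strip_weight M (upper k S) * schurP d M)"
    by (subst sum.swap) (simp add: sum.swap[of _ "raisable S"])
  also have "\<dots> = (\<Sum>m\<le>Suc n. \<Sum>M\<in>strict_sets m. strip_weight M S * schurP d M + (\<Sum>k\<in>lowerable M. strip_weight (lower k M) S * schurP d M))"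
  proof (intro sum.cong refl)
    fix m M assume "M \<in> strict_sets m"
    then have M: "finite M" "0 \<notin> M" by (auto simp: strict_sets_def)
    show "(\<Sum>k\<in>raisable S. strip_weight M (upper k S) * schurP d M)
        = strip_weight M S * schurP d M + (\<Sum>k\<in>lowerable M. strip_weight (lower k M) S * schurP d M)"
      unfolding sum_distrib_right[symmetric] strip_weight_commute[OF M S(1,2)] by (rule distrib_right)
  qed
  also have "\<dots> = (\<Sum>m\<le>Suc n. \<Sum>M\<in>strict_sets m. strip_weight M S * schurP d M)
      + (\<Sum>m\<le>Suc n. \<Sum>M\<in>strict_sets m. \<Sum>k\<in>lowerable M. strip_weight (lower k M) S * schurP d M)"
    by (simp only: sum.distrib)
  also have "(\<Sum>m\<le>Suc n. \<Sum>M\<in>strict_sets m. strip_weight M S * schurP d M) = schurP (Suc d) S"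
    by (rule schurP_Suc_bound[symmetric]) (use S in auto)
  also have "(\<Sum>m\<le>Suc n. \<Sum>M\<in>strict_sets m. \<Sum>k\<in>lowerable M. strip_weight (lower k M) S * schurP d M)
      = (\<Sum>m\<le>n. \<Sum>M\<in>strict_sets (Suc m). \<Sum>k\<in>lowerable M. strip_weight (lower k M) S * schurP d M)"
    by (subst sum.atMost_Suc_shift) (simp add: strict_sets_0 lowerable_def)
  also have "\<dots> = (\<Sum>m\<le>n. \<Sum>N\<in>strict_sets m. \<Sum>k\<in>raisable N. strip_weight N S * schurP d (upper k N))"
    by (rule sum.cong[OF refl]) (rule exchange_lower_upper[where F="\<lambda>L M. strip_weight M S * schurP d L"])
  also have "\<dots> = (\<Sum>m\<le>n. \<Sum>N\<in>strict_sets m. real d * (strip_weight N S * schurP d N))"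
    by (intro sum.cong refl) (simp add: sum_distrib_left[symmetric] Suc.IH)
  also have "\<dots> = real d * schurP (Suc d) S"
    unfolding sum_distrib_left[symmetric] by (subst schurP_Suc_bound[where N=n]) (use S in auto)
  finally show ?case by (simp add: algebra_simps)
qed

lemma strip_weight_nonneg: "0 \<le> strip_weight M L"
  by (simp add: strip_weight_def)

lemma schurP_nonneg: "0 \<le> schurP d L"
  by (induction d arbitrary: L) (auto intro!: sum_nonneg mult_nonneg_nonneg strip_weight_nonneg)

text \<open>Interlacing lets a letter pair add at most one new row, so d pairs produce at most d
  rows.\<close>

lemma schurP_eq_0:
  assumes "finite L" "0 \<notin> L" "d < card L"
  shows "schurP d L = 0"
  using assms
proof (induction d arbitrary: L)
  case (Suc d)
  have "strip_weight M L * schurP d M = 0" if "M \<in> strict_sets n" for M n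
  proof (cases "interlaced M L")
    case True
    then have "tail_count L 1 \<le> tail_count M 1 + 1" unfolding interlaced_def by simp
    then have "d < card M" using Suc.prems tail_count_1[of L] tail_count_1[of M] strict_setsD(2)[OF that] by simp
    then show ?thesis using Suc.IH[of M] strict_setsD[OF that] by simp
  qed (simp add: strip_weight_def)
  then show ?case unfolding schurP.simps by (intro sum.neutral ballI) blast
qed auto

section \<open>Counting generalized shifted tableaux\<close>

text \<open>Levels are letter ranks: the even rank \<open>2 * k\<close> is \<open>k'\<close>, the odd rank \<open>2 * k + 1\<close> is \<open>k\<close>, and
  the ranks 0 and 1 do not occur.\<close>

definition letter_cond :: "nat \<Rightarrow> (nat \<times> nat) set \<Rightarrow> bool" where
  "letter_cond i A = (if i < 2 then A = {} else if even i then inj_on snd A else inj_on fst A)"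

text \<open>\<open>J\<close> is the ideal reached after placing the letter k'. The two injectivity
  conditions say that k' occurs at most once in a row and k at most once in a column.\<close>

definition bicolorings :: "nat set \<Rightarrow> nat set \<Rightarrow> (nat \<times> nat) set set" where
  "bicolorings M L = {J. ideal J \<and> diagram M \<subseteq> J \<and> J \<subseteq> diagram L \<and> inj_on snd (J - diagram M) \<and> inj_on fst (diagram L - J)}"

text \<open>If diagonal j had two boxes in the skew shape, the box (j + y + 1, y) would share a row
  with one and a column with the other. Carrying k' it would repeat k' in the row, carrying k it
  would repeat k in the column.\<close>

lemma bicolorings_interlaced:
  assumes M: "finite M" and L: "finite L" and sub: "diagram M \<subseteq> diagram L" and J: "J \<in> bicolorings M L"
  shows "interlaced M L"
  unfolding interlaced_def
proof (intro allI impI conjI)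
  fix j :: nat assume j: "1 \<le> j"
  show "tail_count M j \<le> tail_count L j" using sub diagram_subset_iff[OF M] j by blast
  have J': "ideal J" "diagram M \<subseteq> J" "J \<subseteq> diagram L" "inj_on snd (J - diagram M)" "inj_on fst (diagram L - J)"
    using J unfolding bicolorings_def by auto
  show "tail_count L j \<le> tail_count M j + 1"
  proof (rule ccontr)
    define y where "y = tail_count M j + 1"
    assume "\<not> tail_count L j \<le> tail_count M j + 1"
    then have q: "(j + y + 1, y + 1) \<in> diagram L" using j by (simp add: diagram_def y_def)
    have r: "(j + y + 1, y) \<in> diagram L" by (rule idealD(4)[OF ideal_diagram[OF L] q]) (use j in \<open>auto simp: y_def\<close>)
    have pM: "(j + y, y) \<notin> diagram M" by (simp add: diagram_def y_def)
    have le1: "tail_count M (Suc j) \<le> tail_count M j" by (rule tail_count_antimono[OF M]) simp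
    have rM: "(j + y + 1, y) \<notin> diagram M" using le1 by (auto simp: diagram_def y_def)
    show False
    proof (cases "(j + y + 1, y) \<in> J")
      case True
      have "(j + y, y) \<in> J" by (rule idealD(4)[OF J'(1) True]) (use j in \<open>auto simp: y_def\<close>)
      then have "(j + y + 1, y) = (j + y, y)"
        using inj_onD[OF J'(4), of "(j + y + 1, y)" "(j + y, y)"] True pM rM by simp
      then show False by simp
    next
      case False
      have "(j + y + 1, y + 1) \<notin> J"
      proof
        assume "(j + y + 1, y + 1) \<in> J"
        then have "(j + y + 1, y) \<in> J" by (rule idealD(4)[OF J'(1)]) (use j in \<open>auto simp: y_def\<close>)
        then show False using False by simp
      qed
      then have "(j + y + 1, y + 1) = (j + y + 1, y)"
        using inj_onD[OF J'(5), of "(j + y + 1, y + 1)" "(j + y + 1, y)"] False q r by simp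
      then show False by simp
    qed
  qed
qed

context
  fixes M L :: "nat set"
  assumes M: "finite M" "0 \<notin> M" and L: "finite L" "0 \<notin> L" and il: "interlaced M L"
begin

text \<open>\<open>U\<close> lists the diagonals that meet the skew shape and \<open>cell j\<close>
  is the only box there. Boxes on consecutive diagonals of \<open>U\<close> are adjacent:
  \<open>forced\<close> collects those sharing a column with the preceding box, which must carry k',
  and \<open>free\<close> the first box of each connected component.\<close>

definition U :: "nat set" where "U = {j. 1 \<le> j \<and> tail_count M j < tail_count L j}"
definition cell :: "nat \<Rightarrow> nat \<times> nat" where "cell j = (j + tail_count L j, tail_count L j)"
definition forced :: "nat set" where "forced = {j \<in> U. j - 1 \<in> U \<and> j - 1 \<in> L}"
definition free :: "nat set" where "free = {j \<in> U. j - 1 \<notin> U}"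

lemma U_D: "j \<in> U \<Longrightarrow> 1 \<le> j" "j \<in> U \<Longrightarrow> tail_count L j = Suc (tail_count M j)"
  using il by (auto simp: U_def interlaced_def le_Suc_eq)

lemma diagram_sub: "diagram M \<subseteq> diagram L"
  using il diagram_subset_iff[OF M(1)] by (auto simp: interlaced_def)

lemma cell_inj: "cell i = cell j \<Longrightarrow> i = j"
  by (auto simp: cell_def)

lemma cell_diff: "diagram L - diagram M = cell ` U"
proof (intro subset_antisym subsetI)
  fix p assume p: "p \<in> diagram L - diagram M"
  obtain x y where xy: "p = (x, y)" by (cases p)
  have a: "1 \<le> y" "y < x" "y \<le> tail_count L (x - y)" "tail_count M (x - y) < y"
    using p by (auto simp: xy diagram_def)
  have "tail_count L (x - y) \<le> tail_count M (x - y) + 1" using il a unfolding interlaced_def by simp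
  then have "y = tail_count L (x - y)" "x - y \<in> U" using a by (auto simp: U_def)
  then have "p = cell (x - y)" using a by (simp add: xy cell_def)
  then show "p \<in> cell ` U" using \<open>x - y \<in> U\<close> by blast
next
  fix p assume "p \<in> cell ` U"
  then obtain j where "j \<in> U" "p = cell j" by blast
  then show "p \<in> diagram L - diagram M" using U_D[of j] by (auto simp: cell_def diagram_def)
qed

text \<open>The heights of \<open>L\<close> are antitone, hence constant from i to j, and the box on
  diagonal j - 1 lies in the same row.\<close>

lemma same_row:
  assumes "i \<in> U" "j \<in> U" "i < j" "tail_count L i = tail_count L j"
  shows "j - 1 \<in> U" "j - 1 \<notin> L"
proof -
  have "tail_count L (j - 1) \<le> tail_count L i" "tail_count L j \<le> tail_count L (j - 1)"
    by (rule tail_count_antimono[OF L(1)], use assms in simp)+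
  then have e: "tail_count L (j - 1) = tail_count L j" using assms by simp
  moreover have "Suc (j - 1) = j" using assms by simp
  ultimately show "j - 1 \<notin> L" using mem_iff_tail_count[OF L(1), of "j - 1"] by simp
  have "tail_count M (j - 1) \<le> tail_count M i" by (rule tail_count_antimono[OF M(1)]) (use assms in simp)
  then show "j - 1 \<in> U" using e assms U_D[OF assms(1)] by (simp add: U_def)
qed

text \<open>A common column is the equality case of \<open>tail_count_lipschitz\<close>, so the
  heights of \<open>L\<close> drop at every step from i to j.\<close>

lemma same_column:
  assumes "i \<in> U" "j \<in> U" "i < j" "i + tail_count L i = j + tail_count L j"
  shows "j - 1 \<in> U" "j - 1 \<in> L"
proof -
  have s: "Suc (j - 1) = j" using assms by simp
  have "tail_count L i \<le> tail_count L (i + (j - 1 - i)) + (j - 1 - i)" by (rule tail_count_lipschitz[OF L(1)])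
  then have t: "Suc (tail_count L j) \<le> tail_count L (j - 1)" using assms by simp
  then show "j - 1 \<in> L" using mem_iff_tail_count[OF L(1), of "j - 1"] s by simp
  have "tail_count M (j - 1) \<le> tail_count M j + 1"
    using tail_count_lipschitz[OF M(1), of "j - 1" 1] s by simp
  then show "j - 1 \<in> U" using t U_D[OF assms(2)] U_D(1)[OF assms(1)] assms by (simp add: U_def)
qed

text \<open>The preceding box is a neighbour in the row if \<open>j - 1 \<notin> L\<close> and in
  the column otherwise. In the row, k' on the later box would give k' on both; in the column, k on
  the later box would give k on both.\<close>

lemma bicoloring_forced:
  assumes J: "J \<in> bicolorings M L" and j: "j \<in> U" "j - 1 \<in> U"
  shows "cell j \<in> J \<longleftrightarrow> j - 1 \<in> L"
proof -
  have J': "ideal J" "diagram M \<subseteq> J" "J \<subseteq> diagram L" "inj_on snd (J - diagram M)" "inj_on fst (diagram L - J)"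
    using J unfolding bicolorings_def by auto
  have s: "Suc (j - 1) = j" "1 \<le> j - 1" using U_D(1)[OF j(1)] U_D(1)[OF j(2)] by simp_all
  have cU: "cell i \<in> diagram L" "cell i \<notin> diagram M" if "i \<in> U" for i using cell_diff that by blast+
  have ne: "cell j \<noteq> cell (j - 1)" using cell_inj[of j "j - 1"] s by auto
  have tstep: "tail_count L (j - 1) = tail_count L j + (if j - 1 \<in> L then 1 else 0)"
    using tail_count_step[OF L(1), of "j - 1"] s by simp
  show ?thesis
  proof
    assume c: "cell j \<in> J"
    show "j - 1 \<in> L"
    proof (rule ccontr)
      assume n: "j - 1 \<notin> L"
      have "cell (j - 1) \<in> J"
        unfolding cell_def by (rule idealD(4)[OF J'(1) c[unfolded cell_def]]) (use n tstep s U_D(2)[OF j(1)] in auto)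
      moreover have "snd (cell j) = snd (cell (j - 1))" using n tstep by (simp add: cell_def)
      ultimately have "cell j = cell (j - 1)"
        using inj_onD[OF J'(4), of "cell j" "cell (j - 1)"] c cU j by simp
      then show False using ne by simp
    qed
  next
    assume n: "j - 1 \<in> L"
    show "cell j \<in> J"
    proof (rule ccontr)
      assume c: "cell j \<notin> J"
      have "cell (j - 1) \<notin> J"
      proof
        assume d: "cell (j - 1) \<in> J"
        have "cell j \<in> J"
          unfolding cell_def by (rule idealD(4)[OF J'(1) d[unfolded cell_def]]) (use n tstep s U_D(2)[OF j(1)] in auto)
        then show False using c by simp
      qed
      moreover have "fst (cell j) = fst (cell (j - 1))" using n tstep s by (simp add: cell_def)
      ultimately have "cell j = cell (j - 1)"
        using inj_onD[OF J'(5), of "cell j" "cell (j - 1)"] c cU j by simp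
      then show False using ne by simp
    qed
  qed
qed

text \<open>Any choice on the first boxes of the components extends by the forced boxes. Two boxes
  in one row or column are compared through the diagonal just before the later one.\<close>

lemma bicoloring_of_subset:
  assumes A: "A \<subseteq> free"
  shows "diagram M \<union> cell ` (A \<union> forced) \<in> bicolorings M L" (is "?J \<in> _")
proof -
  define B where "B = A \<union> forced"
  have BU: "B \<subseteq> U" using A by (auto simp: B_def free_def forced_def)
  have Brow: False if "j \<in> B" "j - 1 \<in> U" "j - 1 \<notin> L" for j
    using that A by (auto simp: B_def free_def forced_def)
  have Bcol: "j \<in> B" if "j \<in> U" "j - 1 \<in> U" "j - 1 \<in> L" for j
    using that by (auto simp: B_def forced_def)
  have JL: "?J \<subseteq> diagram L" using diagram_sub cell_diff BU unfolding B_def by blast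
  have "ideal ?J"
    unfolding ideal_def
  proof (intro conjI allI impI)
    show "finite ?J" by (rule finite_subset[OF JL finite_diagram[OF L(1)]])
    show "1 \<le> y" "y < x" if "(x, y) \<in> ?J" for x y
      using idealD(2,3)[OF ideal_diagram[OF L(1)], of x y] that JL by auto
    fix x y x' y' assume a: "(x, y) \<in> ?J" "1 \<le> y'" "y' \<le> y" "y' < x'" "x' \<le> x"
    have inL: "(x', y') \<in> diagram L" using idealD(4)[OF ideal_diagram[OF L(1)], of x y y' x'] a JL by blast
    show "(x', y') \<in> ?J"
    proof (cases "(x', y') \<in> diagram M")
      case False
      then obtain i where i: "i \<in> U" "(x', y') = cell i" using inL cell_diff by blast
      have "(x, y) \<notin> diagram M" using idealD(4)[OF ideal_diagram[OF M(1)], of x y y' x'] a False by blast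
      then obtain j where j: "j \<in> B" "(x, y) = cell j" using a(1) unfolding B_def by blast
      have jU: "j \<in> U" using j BU by blast
      have le: "tail_count L i \<le> tail_count L j" "i + tail_count L i \<le> j + tail_count L j"
        using i j a by (auto simp: cell_def)
      consider "i = j" | "i < j" | "j < i" by linarith
      then have "i \<in> B"
      proof cases
        case 2
        then have "tail_count L j \<le> tail_count L i" by (intro tail_count_antimono[OF L(1)]) simp
        then have "tail_count L i = tail_count L j" using le by simp
        then show ?thesis using same_row[OF i(1) jU 2] Brow[OF j(1)] by blast
      next
        case 3
        have "tail_count L j \<le> tail_count L (j + (i - j)) + (i - j)" by (rule tail_count_lipschitz[OF L(1)])
        then have "j + tail_count L j = i + tail_count L i" using le 3 by simp
        then show ?thesis using same_column[OF jU i(1) 3] Bcol[OF i(1)] by blast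
      qed (use j in simp)
      then show ?thesis using i unfolding B_def by blast
    qed simp
  qed
  moreover have "inj_on snd (?J - diagram M)"
  proof (rule inj_onI)
    have row: False if "i \<in> B" "j \<in> B" "i < j" "tail_count L i = tail_count L j" for i j
      using same_row[of i j] that BU Brow[of j] by blast
    fix p q assume pq: "p \<in> ?J - diagram M" "q \<in> ?J - diagram M" "snd p = snd q"
    then obtain i j where ij: "i \<in> B" "j \<in> B" "p = cell i" "q = cell j" unfolding B_def by blast
    then have "tail_count L i = tail_count L j" using pq by (simp add: cell_def)
    then have "i = j" using row[of i j] row[of j i] ij by (metis linorder_neqE_nat)
    then show "p = q" using ij by simp
  qed
  moreover have "inj_on fst (diagram L - ?J)"
  proof (rule inj_onI)
    have col: False if "i \<in> U - B" "j \<in> U - B" "i < j" "i + tail_count L i = j + tail_count L j" for i j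
      using same_column[of i j] that Bcol[of j] by blast
    fix p q assume pq: "p \<in> diagram L - ?J" "q \<in> diagram L - ?J" "fst p = fst q"
    have "p \<in> cell ` U" "q \<in> cell ` U" using pq cell_diff by auto
    then obtain i j where ij: "i \<in> U" "j \<in> U" "p = cell i" "q = cell j" by blast
    then have "i \<in> U - B" "j \<in> U - B" using pq unfolding B_def by blast+
    moreover have "i + tail_count L i = j + tail_count L j" using ij pq by (simp add: cell_def)
    ultimately have "i = j" using col[of i j] col[of j i] by (metis linorder_neqE_nat)
    then show "p = q" using ij by simp
  qed
  ultimately show ?thesis using JL unfolding bicolorings_def by blast
qed

lemma finite_U: "finite U"
proof -
  have "finite (cell ` U)" using finite_diagram[OF L(1)] cell_diff by (metis finite_Diff)
  then show ?thesis by (rule finite_imageD) (use cell_inj in \<open>auto intro: inj_onI\<close>)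
qed

text \<open>A component starts at diagonal i + 1 with i \<ge> 1 exactly if i lies in
  \<open>M - L\<close>; one more starts at diagonal 1 exactly if \<open>L\<close> has one part more
  than \<open>M\<close>.\<close>

lemma card_free: "card free + card M = card (M - L) + card L"
proof -
  have U1: "1 \<in> U \<longleftrightarrow> card M < card L" using tail_count_1[OF M(2)] tail_count_1[OF L(2)] by (simp add: U_def)
  have c1: "card M \<le> card L" "card L \<le> card M + 1"
    using il tail_count_1[OF M(2)] tail_count_1[OF L(2)] unfolding interlaced_def by (metis le_refl)+
  have "free = Suc ` (M - L) \<union> (if 1 \<in> U then {1} else {})"
  proof (intro set_eqI)
    fix j
    show "j \<in> free \<longleftrightarrow> j \<in> Suc ` (M - L) \<union> (if 1 \<in> U then {1} else {})"
    proof (cases j)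
      case 0
      then show ?thesis using U_D(1)[of 0] by (auto simp: free_def)
    next
      case (Suc i)
      show ?thesis
      proof (cases "i = 0")
        case True
        then show ?thesis using Suc M U_D(1)[of 0] by (auto simp: free_def)
      next
        case False
        have b: "tail_count M i \<le> tail_count L i" "tail_count L i \<le> tail_count M i + 1"
            "tail_count M (Suc i) \<le> tail_count L (Suc i)" "tail_count L (Suc i) \<le> tail_count M (Suc i) + 1"
          using il False unfolding interlaced_def by simp_all
        have "Suc i \<in> free \<longleftrightarrow> tail_count M (Suc i) < tail_count L (Suc i) \<and> \<not> tail_count M i < tail_count L i"
          using False by (auto simp: free_def U_def)
        also have "\<dots> \<longleftrightarrow> i \<in> M \<and> i \<notin> L"
          using b tail_count_step[OF M(1), of i] tail_count_step[OF L(1), of i] by (simp split: if_splits)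
        finally show ?thesis using Suc False by auto
      qed
    qed
  qed
  moreover have "1 \<notin> Suc ` (M - L)" using M by auto
  moreover have "finite (M - L)" using M by simp
  ultimately have "card free = card (M - L) + (if 1 \<in> U then 1 else 0)"
    by (simp add: card_image)
  then show ?thesis using U1 c1 by simp
qed

lemma card_bicolorings: "card (bicolorings M L) = 2 ^ card free"
proof -
  have "bij_betw (\<lambda>J. {j \<in> free. cell j \<in> J}) (bicolorings M L) (Pow free)"
  proof (rule bij_betwI[where g="\<lambda>A. diagram M \<union> cell ` (A \<union> forced)"])
    show "(\<lambda>A. diagram M \<union> cell ` (A \<union> forced)) \<in> Pow free \<rightarrow> bicolorings M L"
      using bicoloring_of_subset by blast
    show "diagram M \<union> cell ` ({j \<in> free. cell j \<in> J} \<union> forced) = J" if J: "J \<in> bicolorings M L" for J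
    proof -
      have J': "diagram M \<subseteq> J" "J \<subseteq> diagram L" using J unfolding bicolorings_def by auto
      have 1: "cell j \<in> J \<longleftrightarrow> j \<in> {j \<in> free. cell j \<in> J} \<union> forced" if "j \<in> U" for j
        using bicoloring_forced[OF J that] that by (cases "j - 1 \<in> U") (auto simp: free_def forced_def)
      have "J - diagram M = (diagram L - diagram M) \<inter> J" using J' by blast
      also have "\<dots> = cell ` {j \<in> U. cell j \<in> J}" unfolding cell_diff by blast
      also have "{j \<in> U. cell j \<in> J} = {j \<in> free. cell j \<in> J} \<union> forced"
        using 1 by (auto simp: free_def forced_def)
      finally show ?thesis using J' by blast
    qed
    show "{j \<in> free. cell j \<in> diagram M \<union> cell ` (A \<union> forced)} = A" if A: "A \<in> Pow free" for A
    proof -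
      have "cell j \<in> diagram M \<union> cell ` (A \<union> forced) \<longleftrightarrow> j \<in> A" if j: "j \<in> free" for j
      proof -
        have "j \<in> U" "j \<notin> forced" using j by (auto simp: free_def forced_def)
        moreover have "cell j \<notin> diagram M" using \<open>j \<in> U\<close> cell_diff by blast
        moreover have "cell j \<in> cell ` (A \<union> forced) \<longleftrightarrow> j \<in> A \<union> forced" using cell_inj by blast
        ultimately show ?thesis by blast
      qed
      then show ?thesis using A by blast
    qed
  qed auto
  then have "card (bicolorings M L) = card (Pow free)" by (rule bij_betw_same_card)
  also have "\<dots> = 2 ^ card free" by (rule card_Pow) (use finite_U in \<open>simp add: free_def\<close>)
  finally show ?thesis .
qed

lemma card_bicolorings_eq: "real (card (bicolorings M L)) * 2 ^ card M = 2 ^ card (M - L) * 2 ^ card L"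
  unfolding card_bicolorings of_nat_power of_nat_numeral power_add[symmetric] card_free ..

end

lemma card_bicolorings_strip_weight:
  assumes M: "finite M" "0 \<notin> M" and L: "finite L" "0 \<notin> L" and sub: "diagram M \<subseteq> diagram L"
  shows "real (card (bicolorings M L)) = strip_weight M L * 2 ^ card L / 2 ^ card M"
proof (cases "interlaced M L")
  case True
  then show ?thesis using card_bicolorings_eq[OF M L True] by (simp add: strip_weight_def field_simps)
next
  case False
  then have "bicolorings M L = {}" using bicolorings_interlaced[OF M(1) L(1) sub] by blast
  then show ?thesis using False by (simp add: strip_weight_def)
qed

text \<open>The 2 d letters have ranks from 2 to 2 d + 1, so 2 d + 2 levels are needed; the first
  two stay empty.\<close>

definition gst_count :: "nat \<Rightarrow> nat set \<Rightarrow> nat" where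
  "gst_count d S = card (fillings letter_cond (2 * d + 2) (diagram S))"

lemma diagram_empty_iff: assumes "finite S" "0 \<notin> S" shows "diagram S = {} \<longleftrightarrow> S = {}"
proof -
  have "diagram {} = {}" by (auto simp: diagram_def tail_count_def)
  then show ?thesis using diagram_inject[OF assms(1) finite.emptyI assms(2)] by auto
qed

lemma gst_count_0:
  assumes "finite S" "0 \<notin> S"
  shows "gst_count 0 S = of_bool (S = {})"
proof (cases "S = {}")
  case True
  then have "diagram S = {}" using diagram_empty_iff[OF assms] by simp
  then have "fillings letter_cond (2 * 0 + 2) (diagram S) = {\<lambda>_. undefined}"
    by (auto simp: fillings_def letter_cond_def)
  then show ?thesis using True by (simp add: gst_count_def)
next
  case False
  then obtain p where p: "p \<in> diagram S" using diagram_empty_iff[OF assms] by auto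
  have "T \<notin> fillings letter_cond 2 (diagram S)" for T
  proof
    assume T: "T \<in> fillings letter_cond 2 (diagram S)"
    then have "T p < 2" using fillD(1)[OF T] p by auto
    then have "{q \<in> diagram S. T q = T p} = {}" using fillD(3)[OF T, of "T p"] by (simp add: letter_cond_def)
    then show False using p by blast
  qed
  then have "fillings letter_cond (2 * 0 + 2) (diagram S) = {}" unfolding mult_0_right add_0 by blast
  then show ?thesis using False by (simp add: gst_count_def)
qed

text \<open>Peeling off the last plain and the last circled letter gives a double sum over ideals;
  exchanging it isolates the number of intermediate ideals \<open>J\<close>.\<close>

lemma gst_count_Suc:
  assumes L: "finite L" "0 \<notin> L"
  shows "gst_count (Suc d) L =
    (\<Sum>M | finite M \<and> 0 \<notin> M \<and> diagram M \<subseteq> diagram L. card (bicolorings M L) * gst_count d M)"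
proof -
  let ?m = "2 * d + 2"
  let ?g = "\<lambda>K. card (fillings letter_cond ?m K)"
  have fs: "finite {K. ideal K \<and> K \<subseteq> diagram L \<and> P K}" for P
    by (rule finite_subideals[OF finite_diagram[OF L(1)]])
  have "gst_count (Suc d) L = card (fillings letter_cond (Suc (Suc ?m)) (diagram L))"
    by (simp add: gst_count_def)
  also have "\<dots> = (\<Sum>J | ideal J \<and> J \<subseteq> diagram L \<and> letter_cond (Suc ?m) (diagram L - J). card (fillings letter_cond (Suc ?m) J))"
    by (rule card_fillings_Suc[OF ideal_diagram[OF L(1)]])
  also have "\<dots> = (\<Sum>J | ideal J \<and> J \<subseteq> diagram L \<and> inj_on fst (diagram L - J).
      \<Sum>K | ideal K \<and> K \<subseteq> J \<and> inj_on snd (J - K). ?g K)"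
    by (rule sum.cong) (auto simp: letter_cond_def card_fillings_Suc)
  also have "\<dots> = (\<Sum>J | ideal J \<and> J \<subseteq> diagram L \<and> inj_on fst (diagram L - J).
      \<Sum>K\<in>{K. ideal K \<and> K \<subseteq> diagram L \<and> True}. if K \<subseteq> J \<and> inj_on snd (J - K) then ?g K else 0)"
  proof (rule sum.cong[OF refl])
    fix J assume "J \<in> {J. ideal J \<and> J \<subseteq> diagram L \<and> inj_on fst (diagram L - J)}"
    then have "{K. ideal K \<and> K \<subseteq> J \<and> inj_on snd (J - K)}
        = {K. ideal K \<and> K \<subseteq> diagram L \<and> True} \<inter> {K. K \<subseteq> J \<and> inj_on snd (J - K)}" by auto
    then show "(\<Sum>K | ideal K \<and> K \<subseteq> J \<and> inj_on snd (J - K). ?g K)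
        = (\<Sum>K\<in>{K. ideal K \<and> K \<subseteq> diagram L \<and> True}. if K \<subseteq> J \<and> inj_on snd (J - K) then ?g K else 0)"
      using sum.inter_restrict[OF fs[of "\<lambda>_. True"], of ?g "{K. K \<subseteq> J \<and> inj_on snd (J - K)}"] by simp
  qed
  also have "\<dots> = (\<Sum>K\<in>{K. ideal K \<and> K \<subseteq> diagram L \<and> True}. \<Sum>J | ideal J \<and> J \<subseteq> diagram L \<and> inj_on fst (diagram L - J).
      if K \<subseteq> J \<and> inj_on snd (J - K) then ?g K else 0)"
    by (rule sum.swap)
  also have "\<dots> = (\<Sum>K\<in>{K. ideal K \<and> K \<subseteq> diagram L \<and> True}.
      card {J. ideal J \<and> K \<subseteq> J \<and> J \<subseteq> diagram L \<and> inj_on snd (J - K) \<and> inj_on fst (diagram L - J)} * ?g K)"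
  proof (rule sum.cong[OF refl])
    fix K
    let ?A = "{J. ideal J \<and> J \<subseteq> diagram L \<and> inj_on fst (diagram L - J)}"
    have "(\<Sum>J\<in>?A. if K \<subseteq> J \<and> inj_on snd (J - K) then ?g K else 0)
        = (\<Sum>J\<in>?A \<inter> {J. K \<subseteq> J \<and> inj_on snd (J - K)}. ?g K)"
      using sum.inter_restrict[OF fs[of "\<lambda>J. inj_on fst (diagram L - J)"], of "\<lambda>_. ?g K" "{J. K \<subseteq> J \<and> inj_on snd (J - K)}"] by simp
    also have "\<dots> = card (?A \<inter> {J. K \<subseteq> J \<and> inj_on snd (J - K)}) * ?g K" by simp
    also have "?A \<inter> {J. K \<subseteq> J \<and> inj_on snd (J - K)}
        = {J. ideal J \<and> K \<subseteq> J \<and> J \<subseteq> diagram L \<and> inj_on snd (J - K) \<and> inj_on fst (diagram L - J)}" by auto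
    finally show "(\<Sum>J\<in>?A. if K \<subseteq> J \<and> inj_on snd (J - K) then ?g K else 0)
      = card {J. ideal J \<and> K \<subseteq> J \<and> J \<subseteq> diagram L \<and> inj_on snd (J - K) \<and> inj_on fst (diagram L - J)} * ?g K" .
  qed
  also have "\<dots> = (\<Sum>M | finite M \<and> 0 \<notin> M \<and> diagram M \<subseteq> diagram L \<and> True. card (bicolorings M L) * gst_count d M)"
    unfolding gst_count_def bicolorings_def by (rule sum_subideals[OF L(1)])
  finally show ?thesis by simp
qed

text \<open>Each letter pair contributes \<open>strip_weight\<close> times a quotient of powers of
  two. The quotients telescope to \<open>2 ^ card L\<close>, exactly the factor that the Schur-Weyl
  mass divides out.\<close>

lemma gst_count_eq_schurP:
  assumes "finite L" "0 \<notin> L"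
  shows "real (gst_count d L) = schurP d L * 2 ^ card L"
  using assms
proof (induction d arbitrary: L)
  case 0
  then show ?case by (simp add: gst_count_0)
next
  case (Suc d)
  let ?A = "{M. finite M \<and> 0 \<notin> M \<and> diagram M \<subseteq> diagram L}"
  have le: "\<Sum>M \<le> \<Sum>L" if "finite M" "diagram M \<subseteq> diagram L" for M
  proof -
    have "finite (L \<union> M)" using Suc.prems that by simp
    then obtain B where B: "\<forall>k\<in>L \<union> M. k \<le> B" using finite_nat_set_iff_bounded_le by blast
    have "(\<Sum>j=1..B. tail_count M j) \<le> (\<Sum>j=1..B. tail_count L j)"
      by (rule sum_mono) (use diagram_subset_iff[OF that(1)] that in auto)
    then show ?thesis using sum_tail_count[OF Suc.prems(1), of B] sum_tail_count[OF that(1), of B] B by simp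
  qed
  have "real (gst_count (Suc d) L) = (\<Sum>M\<in>?A. real (card (bicolorings M L)) * real (gst_count d M))"
    unfolding gst_count_Suc[OF Suc.prems] by simp
  also have "\<dots> = (\<Sum>M\<in>?A. strip_weight M L * schurP d M * 2 ^ card L)"
  proof (rule sum.cong[OF refl])
    fix M assume "M \<in> ?A"
    then have M: "finite M" "0 \<notin> M" "diagram M \<subseteq> diagram L" by auto
    show "real (card (bicolorings M L)) * real (gst_count d M) = strip_weight M L * schurP d M * 2 ^ card L"
      unfolding card_bicolorings_strip_weight[OF M(1,2) Suc.prems M(3)] Suc.IH[OF M(1,2)] by (simp add: field_simps)
  qed
  also have "\<dots> = (\<Sum>M\<in>?A. strip_weight M L * schurP d M) * 2 ^ card L" by (simp add: sum_distrib_right)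
  also have "(\<Sum>M\<in>?A. strip_weight M L * schurP d M) = (\<Sum>M\<in>(\<Union>n\<in>{..\<Sum>L}. strict_sets n). strip_weight M L * schurP d M)"
  proof (rule sum.mono_neutral_left)
    show "?A \<subseteq> (\<Union>n\<in>{..\<Sum>L}. strict_sets n)" using le by (auto simp: strict_sets_def)
    show "\<forall>M\<in>(\<Union>n\<in>{..\<Sum>L}. strict_sets n) - ?A. strip_weight M L * schurP d M = 0"
    proof
      fix M assume M: "M \<in> (\<Union>n\<in>{..\<Sum>L}. strict_sets n) - ?A"
      then have "finite M" "\<not> diagram M \<subseteq> diagram L" by (auto simp: strict_sets_def)
      then have "\<not> interlaced M L" using diagram_subset_iff unfolding interlaced_def by blast
      then show "strip_weight M L * schurP d M = 0" by (simp add: strip_weight_def)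
    qed
  qed (use finite_strict_sets in blast)
  also have "\<dots> = schurP (Suc d) L"
    unfolding schurP.simps by (rule sum.UNION_disjoint) (use finite_strict_sets in \<open>auto simp: strict_sets_def\<close>)
  finally show ?case .
qed

section \<open>Lists versus sets of parts\<close>

text \<open>Conjugation: both sides say that at least y parts are at least j.\<close>

lemma le_part_iff:
  assumes "sorted_wrt (>) \<xi>" "1 \<le> j" "1 \<le> y"
  shows "j \<le> part \<xi> y \<longleftrightarrow> y \<le> tail_count (set \<xi>) j"
  using assms
proof (induction \<xi> arbitrary: y)
  case Nil
  then show ?case by (simp add: part_def tail_count_def)
next
  case (Cons a \<xi>)
  have a: "k < a" if "k \<in> set \<xi>" for k using Cons.prems that by simp
  show ?case
  proof (cases "j \<le> a")
    case True
    have "a \<notin> set \<xi>" using a by blast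
    moreover have "{k \<in> set (a # \<xi>). j \<le> k} = insert a {k \<in> set \<xi>. j \<le> k}" using True by auto
    ultimately have t: "tail_count (set (a # \<xi>)) j = Suc (tail_count (set \<xi>) j)" by (simp add: tail_count_def)
    show ?thesis
    proof (cases "y = 1")
      case True
      then show ?thesis using \<open>j \<le> a\<close> unfolding t by (simp add: part_def)
    next
      case False
      then obtain z where z: "y = Suc z" "1 \<le> z" using Cons.prems by (cases y) auto
      have "part (a # \<xi>) y = part \<xi> z" using z by (cases z) (auto simp: part_def)
      then show ?thesis using Cons.IH[of z] Cons.prems z unfolding t by simp
    qed
  next
    case False
    have "tail_count (set (a # \<xi>)) j = 0" by (rule tail_count_eq_0) (use False a in force)
    moreover have "part (a # \<xi>) y < j"
    proof (cases "1 \<le> y \<and> y \<le> length (a # \<xi>)")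
      case True
      then have "part (a # \<xi>) y \<in> set (a # \<xi>)" unfolding part_def by (metis One_nat_def Suc_le_lessD Suc_pred nth_mem)
      then show ?thesis using False a by force
    next
      case False
      then have "part (a # \<xi>) y = 0" unfolding part_def by (rule if_not_P)
      then show ?thesis using Cons.prems by simp
    qed
    ultimately show ?thesis using Cons.prems by simp
  qed
qed

lemma shifted_diagram_eq_diagram:
  assumes "sorted_wrt (>) \<xi>"
  shows "shifted_diagram \<xi> = diagram (set \<xi>)"
proof -
  have "(1 \<le> y \<and> y < x \<and> x \<le> y + part \<xi> y) \<longleftrightarrow> (1 \<le> y \<and> y < x \<and> y \<le> tail_count (set \<xi>) (x - y))" for x y
  proof (cases "1 \<le> y \<and> y < x")
    case True
    then have "x \<le> y + part \<xi> y \<longleftrightarrow> x - y \<le> part \<xi> y" "1 \<le> x - y" by linarith+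
    then show ?thesis using le_part_iff[OF assms, of "x - y" y] True by simp
  qed auto
  then show ?thesis unfolding shifted_diagram_def diagram_def by simp
qed

lemma strict_partitionsD:
  assumes "\<xi> \<in> strict_partitions n"
  shows "sorted_wrt (>) \<xi>" "0 \<notin> set \<xi>" "distinct \<xi>" "sum_list \<xi> = n" "\<Sum>(set \<xi>) = n" "length \<xi> = card (set \<xi>)"
proof -
  show s: "sorted_wrt (>) \<xi>" "0 \<notin> set \<xi>" "sum_list \<xi> = n"
    using assms unfolding strict_partitions_def by auto
  show d: "distinct \<xi>" using s(1) by (induction \<xi>) auto
  show "\<Sum>(set \<xi>) = n" using distinct_sum_list_conv_Sum[OF d] s(3) by simp
  show "length \<xi> = card (set \<xi>)" using distinct_card[OF d] by simp
qed

lemma bij_betw_strict_partitions: "bij_betw set (strict_partitions n) (strict_sets n)"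
  unfolding bij_betw_def
proof
  show "inj_on set (strict_partitions n)"
  proof (rule inj_onI)
    fix \<xi> \<eta> assume a: "\<xi> \<in> strict_partitions n" "\<eta> \<in> strict_partitions n" "set \<xi> = set \<eta>"
    have "sorted_wrt (<) (rev \<xi>)" "sorted_wrt (<) (rev \<eta>)"
      using strict_partitionsD(1)[OF a(1)] strict_partitionsD(1)[OF a(2)] by (simp_all add: sorted_wrt_rev)
    then have "rev \<xi> = rev \<eta>" using strict_sorted_equal[of "rev \<xi>" "rev \<eta>"] a(3) by simp
    then show "\<xi> = \<eta>" by simp
  qed
  show "set ` strict_partitions n = strict_sets n"
  proof (intro subset_antisym subsetI)
    fix S assume "S \<in> set ` strict_partitions n"
    then obtain \<xi> where "\<xi> \<in> strict_partitions n" "S = set \<xi>" by blast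
    then show "S \<in> strict_sets n" using strict_partitionsD[of \<xi> n] by (simp add: strict_sets_def)
  next
    fix S assume S: "S \<in> strict_sets n"
    define \<xi> where "\<xi> = rev (sorted_list_of_set S)"
    have set: "set \<xi> = S" using strict_setsD(1)[OF S] by (simp add: \<xi>_def)
    have sw: "sorted_wrt (>) \<xi>" by (simp add: \<xi>_def sorted_wrt_rev)
    have d: "distinct \<xi>" by (simp add: \<xi>_def)
    have "sum_list \<xi> = n" using distinct_sum_list_conv_Sum[OF d] set strict_setsD(3)[OF S] by simp
    then have "\<xi> \<in> strict_partitions n"
      using set sw strict_setsD(2)[OF S] by (auto simp: strict_partitions_def intro: gr0I)
    then show "S \<in> set ` strict_partitions n" using set by blast
  qed
qed

lemma finite_strict_partitions: "finite (strict_partitions n)"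
  using bij_betw_strict_partitions finite_strict_sets bij_betw_finite by blast

text \<open>The corner (x', y) belongs to the ideal, so one row step and one column step connect the
  two boxes.\<close>

lemma ideal_monotone:
  fixes f :: "nat \<times> nat \<Rightarrow> nat"
  assumes D: "ideal D"
    and row: "\<And>x x' y. (x, y) \<in> D \<Longrightarrow> (x', y) \<in> D \<Longrightarrow> x < x' \<Longrightarrow> f (x, y) \<le> f (x', y)"
    and col: "\<And>x y y'. (x, y) \<in> D \<Longrightarrow> (x, y') \<in> D \<Longrightarrow> y < y' \<Longrightarrow> f (x, y) \<le> f (x, y')"
    and "(x, y) \<in> D" "(x', y') \<in> D" "x \<le> x'" "y \<le> y'"
  shows "f (x, y) \<le> f (x', y')"
proof -
  have c: "(x', y) \<in> D"
    by (rule idealD(4)[OF D assms(5)]) (use assms idealD(2,3)[OF D assms(4)] in auto)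
  have "f (x, y) \<le> f (x', y)" using row[OF assms(4) c] assms(6) by (cases "x = x'") auto
  also have "\<dots> \<le> f (x', y')" using col[OF c assms(5)] assms(7) by (cases "y = y'") auto
  finally show ?thesis .
qed

text \<open>Entries start at 1 and levels at 0, hence the shifts. In the other direction, one box
  per level makes the filling injective, which turns weak into strict monotonicity.\<close>

lemma card_standard_shifted_tableaux:
  assumes "\<xi> \<in> strict_partitions n"
  shows "card (standard_shifted_tableaux \<xi>) = std_count (set \<xi>)"
proof -
  note xi = strict_partitionsD[OF assms]
  define D where "D = diagram (set \<xi>)"
  have D: "ideal D" unfolding D_def by (rule ideal_diagram) simp
  have sd: "shifted_diagram \<xi> = D" unfolding D_def by (rule shifted_diagram_eq_diagram[OF xi(1)])
  have cD: "card D = n"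
    using card_diagram_diff[of "set \<xi>" "{}"] xi(5) diagram_empty_iff[of "{}"] by (simp add: D_def)
  let ?F = "fillings (\<lambda>_ A. card A = 1) n D"
  have "bij_betw (\<lambda>T. restrict (\<lambda>p. T p - 1) D) (standard_shifted_tableaux \<xi>) ?F"
  proof (rule bij_betwI[where g="\<lambda>T. restrict (\<lambda>p. T p + 1) D"])
    show "(\<lambda>T. restrict (\<lambda>p. T p - 1) D) \<in> standard_shifted_tableaux \<xi> \<rightarrow> ?F"
    proof
      fix T assume "T \<in> standard_shifted_tableaux \<xi>"
      then have T: "bij_betw T D {1..n}"
          "\<And>x x' y. (x, y) \<in> D \<Longrightarrow> (x', y) \<in> D \<Longrightarrow> x < x' \<Longrightarrow> T (x, y) < T (x', y)"
          "\<And>x y y'. (x, y) \<in> D \<Longrightarrow> (x, y') \<in> D \<Longrightarrow> y < y' \<Longrightarrow> T (x, y) < T (x, y')"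
        unfolding standard_shifted_tableaux_def sd xi(4) by blast+
      have Tr: "1 \<le> T p \<and> T p \<le> n" if "p \<in> D" for p using bij_betwE[OF T(1)] that by auto
      show "restrict (\<lambda>p. T p - 1) D \<in> ?F"
      proof (rule fillI)
        show "restrict (\<lambda>p. T p - 1) D \<in> D \<rightarrow>\<^sub>E {..<n}" using Tr by fastforce
        fix x y x' y' assume a: "(x, y) \<in> D" "(x', y') \<in> D" "x \<le> x'" "y \<le> y'"
        have "T (x, y) \<le> T (x', y')"
          by (rule ideal_monotone[OF D _ _ a]) (use T(2,3) in \<open>auto intro: less_imp_le\<close>)
        then show "restrict (\<lambda>p. T p - 1) D (x, y) \<le> restrict (\<lambda>p. T p - 1) D (x', y')" using a by simp
      next
        fix i assume i: "i < n"
        then have "Suc i \<in> T ` D" using bij_betw_imp_surj_on[OF T(1)] by auto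
        then obtain p where p: "p \<in> D" "T p = Suc i" by auto
        have "{q \<in> D. restrict (\<lambda>p. T p - 1) D q = i} = {p}"
        proof (intro subset_antisym subsetI)
          fix q assume "q \<in> {q \<in> D. restrict (\<lambda>p. T p - 1) D q = i}"
          then have "q \<in> D" "T q = Suc i" using Tr[of q] by auto
          then show "q \<in> {p}" using p bij_betw_imp_inj_on[OF T(1)] by (simp add: inj_on_def)
        qed (use p in auto)
        then show "card {q \<in> D. restrict (\<lambda>p. T p - 1) D q = i} = 1" by simp
      qed
    qed
    show "(\<lambda>T. restrict (\<lambda>p. T p + 1) D) \<in> ?F \<rightarrow> standard_shifted_tableaux \<xi>"
    proof
      fix T assume T: "T \<in> ?F"
      let ?T = "restrict (\<lambda>p. T p + 1) D"
      have Tr: "T p < n" if "p \<in> D" for p using fillD(1)[OF T] that by auto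
      have inj: "p = q" if "p \<in> D" "q \<in> D" "T p = T q" for p q
      proof -
        have "card {r \<in> D. T r = T p} = 1" using fillD(3)[OF T Tr[OF that(1)]] .
        then obtain z where "{r \<in> D. T r = T p} = {z}" by (rule card_1_singletonE)
        then show ?thesis using that by (metis (mono_tags, lifting) mem_Collect_eq singletonD)
      qed
      have injD: "inj_on T D" using inj by (rule inj_onI)
      have "T ` D \<subseteq> {..<n}" using Tr by auto
      moreover have "card (T ` D) = n" using card_image[OF injD] cD by simp
      ultimately have im: "T ` D = {..<n}" by (simp add: card_subset_eq)
      have "?T ` D = Suc ` (T ` D)" by (simp add: image_image)
      also have "\<dots> = {1..n}" unfolding im by (simp add: image_Suc_lessThan)
      finally have bij: "bij_betw ?T D {1..n}"
        unfolding bij_betw_def using injD by (auto simp: inj_on_def)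
      have mono: "?T (x, y) < ?T (x', y')" if "(x, y) \<in> D" "(x', y') \<in> D" "x \<le> x'" "y \<le> y'" "(x, y) \<noteq> (x', y')" for x y x' y'
        using fillD(2)[OF T that(1-4)] inj[OF that(1,2)] that by (auto simp: le_less)
      show "?T \<in> standard_shifted_tableaux \<xi>"
        unfolding standard_shifted_tableaux_def sd xi(4) using bij mono by (simp add: le_less)
    qed
    show "restrict (\<lambda>p. restrict (\<lambda>p. T p - 1) D p + 1) D = T" if "T \<in> standard_shifted_tableaux \<xi>" for T
    proof
      fix p
      have T: "T \<in> extensional D" "bij_betw T D {1..n}"
        using that unfolding standard_shifted_tableaux_def sd xi(4) by blast+
      show "restrict (\<lambda>p. restrict (\<lambda>p. T p - 1) D p + 1) D p = T p"
      proof (cases "p \<in> D")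
        case True
        then have "1 \<le> T p" using bij_betwE[OF T(2)] by auto
        then show ?thesis using True by simp
      next
        case False
        then show ?thesis using extensional_arb[OF T(1)] by simp
      qed
    qed
    show "restrict (\<lambda>p. restrict (\<lambda>p. T p + 1) D p - 1) D = T" if T: "T \<in> ?F" for T
    proof
      fix p show "restrict (\<lambda>p. restrict (\<lambda>p. T p + 1) D p - 1) D p = T p"
        using PiE_arb[OF fillD(1)[OF T], of p] by (cases "p \<in> D") auto
    qed
  qed
  then have "card (standard_shifted_tableaux \<xi>) = card ?F" by (rule bij_betw_same_card)
  then show ?thesis unfolding std_count_def xi(5) D_def .
qed

definition letter_of :: "nat \<Rightarrow> letter" where
  "letter_of i = (if even i then Circled (i div 2) else Plain (i div 2))"

lemma letter_of_rank: "letter_of (letter_rank l) = l"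
  by (cases l) (auto simp: letter_of_def)

lemma rank_letter_of: "letter_rank (letter_of i) = i"
  by (auto simp: letter_of_def)

lemma rank_alphabet: "l \<in> alphabet d \<longleftrightarrow> 2 \<le> letter_rank l \<and> letter_rank l < 2 * d + 2"
  by (cases l) (auto simp: alphabet_def)

lemma card_generalized_shifted_tableaux:
  assumes "\<xi> \<in> strict_partitions n"
  shows "card (generalized_shifted_tableaux d \<xi>) = gst_count d (set \<xi>)"
proof -
  note xi = strict_partitionsD[OF assms]
  define D where "D = diagram (set \<xi>)"
  have D: "ideal D" unfolding D_def by (rule ideal_diagram) simp
  have sd: "shifted_diagram \<xi> = D" unfolding D_def by (rule shifted_diagram_eq_diagram[OF xi(1)])
  let ?F = "fillings letter_cond (2 * d + 2) D"
  have "bij_betw (\<lambda>T. restrict (\<lambda>p. letter_rank (T p)) D) (generalized_shifted_tableaux d \<xi>) ?F"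
  proof (rule bij_betwI[where g="\<lambda>T. restrict (\<lambda>p. letter_of (T p)) D"])
    show "(\<lambda>T. restrict (\<lambda>p. letter_rank (T p)) D) \<in> generalized_shifted_tableaux d \<xi> \<rightarrow> ?F"
    proof
      fix T assume "T \<in> generalized_shifted_tableaux d \<xi>"
      then have T: "T \<in> D \<rightarrow>\<^sub>E alphabet d"
          "\<And>x x' y. (x, y) \<in> D \<Longrightarrow> (x', y) \<in> D \<Longrightarrow> x < x' \<Longrightarrow> letter_rank (T (x, y)) \<le> letter_rank (T (x', y))"
          "\<And>x x' y k. (x, y) \<in> D \<Longrightarrow> (x', y) \<in> D \<Longrightarrow> x < x' \<Longrightarrow> \<not> (T (x, y) = Circled k \<and> T (x', y) = Circled k)"
          "\<And>x y y'. (x, y) \<in> D \<Longrightarrow> (x, y') \<in> D \<Longrightarrow> y < y' \<Longrightarrow> letter_rank (T (x, y)) \<le> letter_rank (T (x, y'))"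
          "\<And>x y y' k. (x, y) \<in> D \<Longrightarrow> (x, y') \<in> D \<Longrightarrow> y < y' \<Longrightarrow> \<not> (T (x, y) = Plain k \<and> T (x, y') = Plain k)"
        unfolding generalized_shifted_tableaux_def sd by blast+
      let ?T = "restrict (\<lambda>p. letter_rank (T p)) D"
      have Tr: "2 \<le> letter_rank (T p)" "letter_rank (T p) < 2 * d + 2" if "p \<in> D" for p
        using T(1) that rank_alphabet by blast+
      show "?T \<in> ?F"
      proof (rule fillI)
        show "?T \<in> D \<rightarrow>\<^sub>E {..<2 * d + 2}" using Tr(2) by auto
        fix x y x' y' assume a: "(x, y) \<in> D" "(x', y') \<in> D" "x \<le> x'" "y \<le> y'"
        have "letter_rank (T (x, y)) \<le> letter_rank (T (x', y'))"
          by (rule ideal_monotone[OF D _ _ a, of "\<lambda>p. letter_rank (T p)"]) (use T(2,4) in auto)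
        then show "?T (x, y) \<le> ?T (x', y')" using a by simp
      next
        fix i
        have mem: "p \<in> D" "T p = letter_of i" if "p \<in> {p \<in> D. ?T p = i}" for p
          using that letter_of_rank[of "T p"] by auto
        have "inj_on snd {p \<in> D. ?T p = i}" if "even i"
        proof (rule inj_onI)
          fix p q assume a: "p \<in> {p \<in> D. ?T p = i}" "q \<in> {p \<in> D. ?T p = i}" "snd p = snd q"
          obtain x x' y where pq: "p = (x, y)" "q = (x', y)" using a(3) by (cases p; cases q) auto
          show "p = q"
            using T(3)[of x y x' "i div 2"] T(3)[of x' y x "i div 2"] mem[OF a(1)] mem[OF a(2)] that pq
            by (cases x x' rule: linorder_cases) (auto simp: letter_of_def)
        qed
        moreover have "inj_on fst {p \<in> D. ?T p = i}" if "odd i"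
        proof (rule inj_onI)
          fix p q assume a: "p \<in> {p \<in> D. ?T p = i}" "q \<in> {p \<in> D. ?T p = i}" "fst p = fst q"
          obtain x y y' where pq: "p = (x, y)" "q = (x, y')" using a(3) by (cases p; cases q) auto
          show "p = q"
            using T(5)[of x y y' "i div 2"] T(5)[of x y' y "i div 2"] mem[OF a(1)] mem[OF a(2)] that pq
            by (cases y y' rule: linorder_cases) (auto simp: letter_of_def)
        qed
        moreover have "{p \<in> D. ?T p = i} = {}" if "i < 2" using Tr(1) that by fastforce
        ultimately show "letter_cond i {p \<in> D. ?T p = i}" by (simp add: letter_cond_def)
      qed
    qed
    show "(\<lambda>T. restrict (\<lambda>p. letter_of (T p)) D) \<in> ?F \<rightarrow> generalized_shifted_tableaux d \<xi>"
    proof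
      fix T assume T: "T \<in> ?F"
      let ?T = "restrict (\<lambda>p. letter_of (T p)) D"
      have Tr: "T p < 2 * d + 2" if "p \<in> D" for p using fillD(1)[OF T] that by auto
      have Tr2: "2 \<le> T p" if "p \<in> D" for p
      proof (rule ccontr)
        assume "\<not> 2 \<le> T p"
        then have "{q \<in> D. T q = T p} = {}" using fillD(3)[OF T Tr[OF that]] by (simp add: letter_cond_def)
        then show False using that by blast
      qed
      have row: False if a: "(x, y) \<in> D" "(x', y) \<in> D" "x < x'" "T (x, y) = T (x', y)" "even (T (x, y))" for x x' y
      proof -
        have "inj_on snd {q \<in> D. T q = T (x, y)}"
          using fillD(3)[OF T Tr[OF a(1)]] Tr2[OF a(1)] a(5) by (simp add: letter_cond_def)
        then have "(x, y) = (x', y)" by (rule inj_onD) (use a in auto)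
        then show False using a(3) by simp
      qed
      have col: False if a: "(x, y) \<in> D" "(x, y') \<in> D" "y < y'" "T (x, y) = T (x, y')" "odd (T (x, y))" for x y y'
      proof -
        have "inj_on fst {q \<in> D. T q = T (x, y)}"
          using fillD(3)[OF T Tr[OF a(1)]] Tr2[OF a(1)] a(5) by (simp add: letter_cond_def)
        then have "(x, y) = (x, y')" by (rule inj_onD) (use a in auto)
        then show False using a(3) by simp
      qed
      have row': "\<not> (?T (x, y) = Circled k \<and> ?T (x', y) = Circled k)"
        if a: "(x, y) \<in> D" "(x', y) \<in> D" "x < x'" for x x' y k
      proof
        assume "?T (x, y) = Circled k \<and> ?T (x', y) = Circled k"
        then have "T (x, y) = 2 * k" "T (x', y) = 2 * k"
          using a rank_letter_of[of "T (x, y)"] rank_letter_of[of "T (x', y)"] by auto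
        then show False using row[OF a] by simp
      qed
      have col': "\<not> (?T (x, y) = Plain k \<and> ?T (x, y') = Plain k)"
        if a: "(x, y) \<in> D" "(x, y') \<in> D" "y < y'" for x y y' k
      proof
        assume "?T (x, y) = Plain k \<and> ?T (x, y') = Plain k"
        then have "T (x, y) = 2 * k + 1" "T (x, y') = 2 * k + 1"
          using a rank_letter_of[of "T (x, y)"] rank_letter_of[of "T (x, y')"] by auto
        then show False using col[OF a] by simp
      qed
      have "?T \<in> D \<rightarrow>\<^sub>E alphabet d" using Tr Tr2 by (auto simp: rank_alphabet rank_letter_of)
      moreover have "letter_rank (?T (x, y)) \<le> letter_rank (?T (x', y'))"
        if "(x, y) \<in> D" "(x', y') \<in> D" "x \<le> x'" "y \<le> y'" for x y x' y'
        using fillD(2)[OF T that] that by (simp add: rank_letter_of)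
      ultimately show "?T \<in> generalized_shifted_tableaux d \<xi>"
        unfolding generalized_shifted_tableaux_def sd using row' col' by (simp only: mem_Collect_eq) (meson less_imp_le order_refl)
    qed
    show "restrict (\<lambda>p. letter_of (restrict (\<lambda>p. letter_rank (T p)) D p)) D = T"
      if "T \<in> generalized_shifted_tableaux d \<xi>" for T
    proof
      fix p
      have T: "T \<in> D \<rightarrow>\<^sub>E alphabet d" using that unfolding generalized_shifted_tableaux_def sd by blast
      show "restrict (\<lambda>p. letter_of (restrict (\<lambda>p. letter_rank (T p)) D p)) D p = T p"
        using PiE_arb[OF T, of p] by (cases "p \<in> D") (auto simp: letter_of_rank)
    qed
    show "restrict (\<lambda>p. letter_rank (restrict (\<lambda>p. letter_of (T p)) D p)) D = T" if T: "T \<in> ?F" for T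
    proof
      fix p show "restrict (\<lambda>p. letter_rank (restrict (\<lambda>p. letter_of (T p)) D p)) D p = T p"
        using PiE_arb[OF fillD(1)[OF T], of p] by (cases "p \<in> D") (auto simp: rank_letter_of)
    qed
  qed
  then have "card (generalized_shifted_tableaux d \<xi>) = card ?F" by (rule bij_betw_same_card)
  then show ?thesis unfolding gst_count_def D_def .
qed

definition weight :: "nat \<Rightarrow> nat \<Rightarrow> nat set \<Rightarrow> real" where
  "weight n d S = schurP d S * real (std_count S) / real d ^ n"

lemma shifted_schur_weyl_mass_eq:
  assumes "\<xi> \<in> strict_partitions n"
  shows "shifted_schur_weyl_mass n d \<xi> = weight n d (set \<xi>)"
proof -
  note xi = strict_partitionsD[OF assms]
  show ?thesis
    unfolding shifted_schur_weyl_mass_def card_standard_shifted_tableaux[OF assms]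
      card_generalized_shifted_tableaux[OF assms] weight_def gst_count_eq_schurP[OF finite_set xi(2)] xi(6)
    by simp
qed

section \<open>Partial fractions\<close>

text \<open>\<open>c S k\<close> is the residue at \<open>b k\<close> of the product of
  \<open>(y - a j) / (y - b j)\<close>; a new index multiplies every old residue by a single
  factor.\<close>

lemma partial_fraction_step:
  fixes a b :: "'i \<Rightarrow> real"
  defines "c \<equiv> \<lambda>S k. (b k - a k) * (\<Prod>j\<in>S - {k}. (b k - a j) / (b k - b j))"
  assumes "finite S" "l \<notin> S"
  shows "k \<in> S \<Longrightarrow> c (insert l S) k = c S k * ((b k - a l) / (b k - b l))"
    "c (insert l S) l = (b l - a l) * (\<Prod>j\<in>S. (b l - a j) / (b l - b j))"
proof -
  assume k: "k \<in> S"
  then have "insert l S - {k} = insert l (S - {k})" using assms(3) by auto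
  then show "c (insert l S) k = c S k * ((b k - a l) / (b k - b l))"
    using assms(2,3) by (simp add: c_def)
next
  have "insert l S - {l} = S" using assms(3) by auto
  then show "c (insert l S) l = (b l - a l) * (\<Prod>j\<in>S. (b l - a j) / (b l - b j))" by (simp add: c_def)
qed

text \<open>Evaluated at the new pole \<open>b l\<close> it supplies the residue created by
  inserting l, both in this induction and in the power series version.\<close>

lemma partial_fractions_real:
  fixes a b :: "'i \<Rightarrow> real"
  assumes "finite S" "inj_on b S" "y \<notin> b ` S"
  shows "(\<Prod>j\<in>S. (y - a j) / (y - b j))
    = 1 + (\<Sum>k\<in>S. (b k - a k) * (\<Prod>j\<in>S - {k}. (b k - a j) / (b k - b j)) / (y - b k))"
  using assms
proof (induction S arbitrary: y rule: finite_induct)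
  case (insert l S)
  define c where "c S k = (b k - a k) * (\<Prod>j\<in>S - {k}. (b k - a j) / (b k - b j))" for S k
  note step = partial_fraction_step[OF insert.hyps, where a=a and b=b, folded c_def]
  have nl: "b k \<noteq> b l" if "k \<in> S" for k using insert that by (auto simp: inj_on_def)
  have y: "y \<noteq> b l" "y \<notin> b ` S" "\<And>k. k \<in> S \<Longrightarrow> y \<noteq> b k" using insert.prems by auto
  have inj: "inj_on b S" using insert.prems by (simp add: inj_on_insert)
  have IHl: "(\<Prod>j\<in>S. (b l - a j) / (b l - b j)) = 1 + (\<Sum>k\<in>S. c S k / (b l - b k))"
    unfolding c_def by (rule insert.IH[OF inj]) (use nl in fastforce)
  have "(\<Prod>j\<in>insert l S. (y - a j) / (y - b j)) = (y - a l) / (y - b l) * (1 + (\<Sum>k\<in>S. c S k / (y - b k)))"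
    using insert.hyps insert.IH[OF inj y(2)] by (simp add: c_def)
  also have "(y - a l) / (y - b l) = 1 + (b l - a l) / (y - b l)" using y by (simp add: field_simps)
  also have "(1 + (b l - a l) / (y - b l)) * (1 + (\<Sum>k\<in>S. c S k / (y - b k)))
      = 1 + (b l - a l) / (y - b l) + (\<Sum>k\<in>S. (1 + (b l - a l) / (y - b l)) * (c S k / (y - b k)))"
    by (simp only: distrib_left sum_distrib_left mult_1_right)
  also have "(\<Sum>k\<in>S. (1 + (b l - a l) / (y - b l)) * (c S k / (y - b k)))
      = (\<Sum>k\<in>S. c (insert l S) k / (y - b k) + (b l - a l) / (y - b l) * (c S k / (b l - b k)))"
  proof (rule sum.cong[OF refl])
    fix k assume k: "k \<in> S"
    have ne: "y - b l \<noteq> 0" "y - b k \<noteq> 0" "b k - b l \<noteq> 0" "b l - b k \<noteq> 0" using y k nl[OF k] by auto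
    show "(1 + (b l - a l) / (y - b l)) * (c S k / (y - b k))
      = c (insert l S) k / (y - b k) + (b l - a l) / (y - b l) * (c S k / (b l - b k))"
      unfolding step(1)[OF k] using ne by (simp add: divide_simps) (simp add: algebra_simps)
  qed
  also have "\<dots> = (\<Sum>k\<in>S. c (insert l S) k / (y - b k)) + (b l - a l) / (y - b l) * (\<Sum>k\<in>S. c S k / (b l - b k))"
    by (simp only: sum.distrib sum_distrib_left)
  finally have "(\<Prod>j\<in>insert l S. (y - a j) / (y - b j)) = 1 + (\<Sum>k\<in>S. c (insert l S) k / (y - b k))
      + (b l - a l) * (1 + (\<Sum>k\<in>S. c S k / (b l - b k))) / (y - b l)"
    by (simp only: distrib_left mult_1_right add_divide_distrib times_divide_eq_left add_ac)
  then show ?case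
    unfolding IHl[symmetric] step(2)[symmetric] using insert.hyps by (simp add: c_def)
qed simp

text \<open>The series of 1 / (1 - b X). With X in the role of 1 / y the factor (y - a) / (y - b)
  becomes (1 - a X) \<open>geo b\<close>, so moments of the residues can be read off as
  coefficients.\<close>

definition geo :: "real \<Rightarrow> real fps" where
  "geo b = Abs_fps (\<lambda>n. b ^ n)"

lemma geo_eq: "(1 - fps_const b * fps_X) * geo b = 1"
proof (rule fps_ext)
  fix n show "fps_nth ((1 - fps_const b * fps_X) * geo b) n = fps_nth 1 n"
    by (cases n) (simp_all add: geo_def left_diff_distrib mult.assoc)
qed

lemma geo_shift: "fps_const b * fps_X * geo b = geo b - 1"
  using geo_eq[of b] by (simp add: left_diff_distrib algebra_simps)

lemma geo_mult: "fps_X * (geo b * geo c) * fps_const (b - c) = geo b - geo c"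
proof -
  have "fps_X * (geo b * geo c) * fps_const (b - c)
      = (fps_const b * fps_X * geo b) * geo c - geo b * (fps_const c * fps_X * geo c)"
    by (simp only: fps_const_sub[symmetric] algebra_simps)
  also have "\<dots> = geo b - geo c" unfolding geo_shift by (simp add: algebra_simps)
  finally show ?thesis .
qed

lemma geo_deriv: "fps_X * fps_deriv (geo b) = geo b * (geo b - 1)"
proof -
  have "fps_deriv ((1 - fps_const b * fps_X) * geo b) = 0" unfolding geo_eq by simp
  then have "(1 - fps_const b * fps_X) * fps_deriv (geo b) = fps_const b * geo b"
    by (simp add: algebra_simps)
  then have "geo b * ((1 - fps_const b * fps_X) * fps_deriv (geo b)) * fps_X = geo b * (fps_const b * geo b) * fps_X"
    by simp
  then have "((1 - fps_const b * fps_X) * geo b) * (fps_X * fps_deriv (geo b)) = geo b * (fps_const b * fps_X * geo b)"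
    by (simp only: mult_ac)
  then show ?thesis unfolding geo_eq geo_shift by simp
qed

lemma sum_fps_const: "(\<Sum>k\<in>S. fps_const (f k)) = fps_const (\<Sum>k\<in>S. f k)"
  by (induction S rule: infinite_finite_induct) simp_all

lemma partial_fractions_fps:
  fixes a b :: "'i \<Rightarrow> real"
  assumes "finite S" "inj_on b S"
  shows "(\<Prod>j\<in>S. (1 - fps_const (a j) * fps_X) * geo (b j))
    = 1 + fps_X * (\<Sum>k\<in>S. fps_const ((b k - a k) * (\<Prod>j\<in>S - {k}. (b k - a j) / (b k - b j))) * geo (b k))"
  using assms
proof (induction S rule: finite_induct)
  case (insert l S)
  define c where "c S k = (b k - a k) * (\<Prod>j\<in>S - {k}. (b k - a j) / (b k - b j))" for S k
  note step = partial_fraction_step[OF insert.hyps, where a=a and b=b, folded c_def]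
  have nl: "b k \<noteq> b l" if "k \<in> S" for k using insert that by (auto simp: inj_on_def)
  have inj: "inj_on b S" using insert.prems by (simp add: inj_on_insert)
  have bl: "(\<Prod>j\<in>S. (b l - a j) / (b l - b j)) = 1 + (\<Sum>k\<in>S. c S k / (b l - b k))"
    unfolding c_def by (rule partial_fractions_real[OF insert.hyps(1) inj]) (use nl in fastforce)
  let ?d = "fps_const (b l - a l)"
  have f: "(1 - fps_const (a l) * fps_X) * geo (b l) = 1 + fps_X * (?d * geo (b l))"
  proof -
    have "(1 - fps_const (a l) * fps_X) * geo (b l)
        = (1 - fps_const (b l) * fps_X) * geo (b l) + fps_X * (?d * geo (b l))"
      by (simp only: fps_const_sub[symmetric] algebra_simps)
    then show ?thesis unfolding geo_eq .
  qed
  have trm: "fps_const (c S k) * geo (b k) + fps_X * (?d * geo (b l)) * (fps_const (c S k) * geo (b k))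
      = fps_const (c (insert l S) k) * geo (b k) + ?d * geo (b l) * fps_const (c S k / (b l - b k))" if k: "k \<in> S" for k
  proof -
    have ne: "b k - b l \<noteq> 0" "b l - b k \<noteq> 0" using nl[OF k] by auto
    define e where "e = 1 / (b k - b l)"
    have "fps_const (b k - b l) * fps_const e = (1 :: real fps)" using ne by (simp add: e_def)
    then have g: "fps_X * (geo (b k) * geo (b l)) = (geo (b k) - geo (b l)) * fps_const e"
      unfolding geo_mult[symmetric] by (simp add: mult.assoc)
    have 1: "fps_const (c (insert l S) k) = fps_const (c S k) + ?d * fps_const (c S k) * fps_const e"
      unfolding step(1)[OF k] fps_const_mult fps_const_add e_def using ne by (simp add: field_simps)
    have 2: "fps_const (c S k / (b l - b k)) = - (fps_const (c S k) * fps_const e)"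
      unfolding fps_const_mult fps_const_neg e_def using ne by (simp add: field_simps)
    have 3: "fps_X * (?d * geo (b l)) * (fps_const (c S k) * geo (b k))
        = ?d * fps_const (c S k) * (fps_X * (geo (b k) * geo (b l)))"
      by (simp only: mult_ac)
    show ?thesis unfolding 3 g 1 2 by (simp only: algebra_simps mult_minus_right diff_conv_add_uminus)
  qed
  have "(\<Prod>j\<in>insert l S. (1 - fps_const (a j) * fps_X) * geo (b j))
      = (1 + fps_X * (?d * geo (b l))) * (1 + fps_X * (\<Sum>k\<in>S. fps_const (c S k) * geo (b k)))"
    using insert.hyps insert.IH[OF inj] by (simp add: f c_def)
  also have "\<dots> = 1 + fps_X * (?d * geo (b l)) + fps_X * (\<Sum>k\<in>S. fps_const (c S k) * geo (b k)
      + fps_X * (?d * geo (b l)) * (fps_const (c S k) * geo (b k)))"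
  proof -
    let ?S = "\<Sum>k\<in>S. fps_const (c S k) * geo (b k)"
    have "(1 + fps_X * (?d * geo (b l))) * (1 + fps_X * ?S)
        = 1 + fps_X * (?d * geo (b l)) + fps_X * (?S + fps_X * (?d * geo (b l)) * ?S)"
      by (simp only: distrib_left distrib_right mult_1_left mult_1_right mult_ac add_ac)
    then show ?thesis by (simp only: sum.distrib sum_distrib_left)
  qed
  also have "(\<Sum>k\<in>S. fps_const (c S k) * geo (b k)
      + fps_X * (?d * geo (b l)) * (fps_const (c S k) * geo (b k)))
      = (\<Sum>k\<in>S. fps_const (c (insert l S) k) * geo (b k)) + ?d * geo (b l) * fps_const (\<Sum>k\<in>S. c S k / (b l - b k))"
    by (simp only: trm sum.distrib sum_distrib_left[symmetric] sum_fps_const cong: sum.cong)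
  also have "1 + fps_X * (?d * geo (b l)) + fps_X * \<dots>
     = 1 + fps_X * ((\<Sum>k\<in>S. fps_const (c (insert l S) k) * geo (b k)) +
         ?d * (1 + fps_const (\<Sum>k\<in>S. c S k / (b l - b k))) * geo (b l))"
    by (simp only: distrib_left distrib_right mult_1_left mult_1_right mult_ac add_ac)
  also have "?d * (1 + fps_const (\<Sum>k\<in>S. c S k / (b l - b k))) = fps_const (c (insert l S) l)"
    unfolding step(2) bl by (simp only: fps_const_1_eq_1[symmetric] fps_const_add fps_const_mult)
  finally show ?case using insert.hyps by (simp add: c_def add.commute)
qed simp

text \<open>The logarithmic derivative of the product. The sum on the right generates the power sums
  of the \<open>a j\<close> minus those of the \<open>b j\<close>, as in Newton's
  identities.\<close>

lemma log_deriv_fps: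
  fixes a b :: "'i \<Rightarrow> real"
  assumes "finite S"
  shows "fps_X * fps_deriv (\<Prod>j\<in>S. (1 - fps_const (a j) * fps_X) * geo (b j))
    = - (\<Prod>j\<in>S. (1 - fps_const (a j) * fps_X) * geo (b j)) * (\<Sum>j\<in>S. geo (a j) - geo (b j))"
  using assms
proof (induction S rule: finite_induct)
  case (insert l S)
  let ?f = "(1 - fps_const (a l) * fps_X) * geo (b l)"
  let ?P = "\<Prod>j\<in>S. (1 - fps_const (a j) * fps_X) * geo (b j)"
  let ?Q = "\<Sum>j\<in>S. geo (a j) - geo (b j)"
  have fa: "?f * geo (a l) = geo (b l)"
    using geo_eq[of "a l"] by (metis mult.assoc mult.commute mult.left_neutral)
  have "fps_X * fps_deriv ?f = - (fps_const (a l) * fps_X * geo (b l)) + (1 - fps_const (a l) * fps_X) * (fps_X * fps_deriv (geo (b l)))"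
    by (simp add: algebra_simps)
  also have "\<dots> = ?f * geo (b l) - geo (b l)"
    unfolding geo_deriv by (simp add: algebra_simps)
  also have "\<dots> = - ?f * (geo (a l) - geo (b l))"
    using fa by (simp add: algebra_simps)
  finally have df: "fps_X * fps_deriv ?f = - ?f * (geo (a l) - geo (b l))" .
  have "fps_X * fps_deriv (?f * ?P) = (fps_X * fps_deriv ?f) * ?P + ?f * (fps_X * fps_deriv ?P)"
    by (simp add: algebra_simps)
  also have "\<dots> = - (?f * ?P) * ((geo (a l) - geo (b l)) + ?Q)"
    unfolding df insert.IH by (simp add: algebra_simps)
  finally show ?case using insert.hyps by simp
qed simp

section \<open>Cotransition probabilities and coherence\<close>

text \<open>Since \<open>ybox (j + 1) = j (j + 1)\<close>, the zero attached to a part j is the pole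
  attached to a part j + 1.\<close>

definition ybox :: "nat \<Rightarrow> real" where
  "ybox k = real k * (real k - 1)"

text \<open>Minus one half of the residue at \<open>ybox k\<close>. For S of size n,
  \<open>cotrans S k / n\<close> turns out to be the fraction of standard tableaux whose last entry
  ends the row of length k (\<open>hook_weight_lower\<close> and
  \<open>std_count_eq\<close>).\<close>

definition cotrans :: "nat set \<Rightarrow> nat \<Rightarrow> real" where
  "cotrans S k = real k * (\<Prod>j\<in>S - {k}. (ybox k - real j * (real j + 1)) / (ybox k - ybox j))"

text \<open>Power sums of the zeros minus power sums of the poles. The terms of exponent 2 r cancel,
  so the leading part is \<open>2 r\<close> times the sum of the powers of exponent 2 r - 1.\<close>

definition qsum :: "nat \<Rightarrow> nat set \<Rightarrow> real" where
  "qsum r S = (\<Sum>j\<in>S. (real j * (real j + 1)) ^ r - ybox j ^ r)"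

definition cotrans_moment :: "nat \<Rightarrow> nat set \<Rightarrow> real" where
  "cotrans_moment m S = (\<Sum>k\<in>S. cotrans S k * ybox k ^ m)"

lemma ybox_diff: "ybox k - ybox j = (real k - real j) * (real k + real j - 1)"
  by (simp add: ybox_def algebra_simps)

lemma ybox_diff2: "ybox k - real j * (real j + 1) = (real k - 1 - real j) * (real k + real j)"
  by (simp add: ybox_def algebra_simps)

lemma ybox_inj: assumes "1 \<le> j" "1 \<le> k" "ybox j = ybox k" shows "j = k"
proof -
  have "(real j - real k) * (real j + real k - 1) = 0" using ybox_diff[of j k] assms(3) by simp
  then show ?thesis using assms by auto
qed

text \<open>Compares coefficients of order m + 1 in \<open>log_deriv_fps\<close>; by partial
  fractions the coefficients of the rational function are 1 and then
  \<open>- 2 * cotrans_moment i S\<close>.\<close>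

lemma cotrans_moment_rec:
  assumes S: "finite S" "0 \<notin> S"
  shows "2 * (real m + 1) * cotrans_moment m S = qsum (Suc m) S - 2 * (\<Sum>i<m. cotrans_moment i S * qsum (m - i) S)"
proof -
  let ?a = "\<lambda>j. real j * (real j + 1)"
  define R where "R = (\<Prod>j\<in>S. (1 - fps_const (?a j) * fps_X) * geo (ybox j))"
  define Q where "Q = (\<Sum>j\<in>S. geo (?a j) - geo (ybox j))"
  have inj: "inj_on ybox S"
  proof (rule inj_onI)
    fix j k assume "j \<in> S" "k \<in> S" "ybox j = ybox k"
    then show "j = k" using S by (intro ybox_inj) (metis One_nat_def Suc_leI neq0_conv)+
  qed
  have c: "(ybox k - ?a k) * (\<Prod>j\<in>S - {k}. (ybox k - ?a j) / (ybox k - ybox j)) = - 2 * cotrans S k" for k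
    by (simp add: cotrans_def) (simp add: ybox_def algebra_simps)
  have Re: "R = 1 + fps_X * (\<Sum>k\<in>S. fps_const (- 2 * cotrans S k) * geo (ybox k))"
    unfolding R_def using partial_fractions_fps[OF S(1) inj, of ?a] unfolding c .
  have R0: "fps_nth R 0 = 1" by (simp add: Re)
  have RS: "fps_nth R (Suc i) = - 2 * cotrans_moment i S" for i
    by (simp add: Re fps_sum_nth geo_def cotrans_moment_def sum_distrib_left mult.assoc)
  have Qn: "fps_nth Q i = qsum i S" for i
    by (simp add: Q_def fps_sum_nth geo_def qsum_def)
  have "fps_X * fps_deriv R = - R * Q"
    unfolding R_def Q_def by (rule log_deriv_fps[OF S(1)])
  then have "fps_nth (fps_X * fps_deriv R) (Suc m) = fps_nth (- (R * Q)) (Suc m)" by simp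
  moreover have "fps_nth (fps_X * fps_deriv R) (Suc m) = (real m + 1) * fps_nth R (Suc m)"
    by (simp add: fps_X_mult_nth add.commute)
  moreover have "fps_nth (- (R * Q)) (Suc m) = - (\<Sum>i=0..Suc m. fps_nth R i * fps_nth Q (Suc m - i))"
    unfolding fps_neg_nth fps_mult_nth ..
  ultimately have "(real m + 1) * fps_nth R (Suc m) = - (\<Sum>i=0..Suc m. fps_nth R i * fps_nth Q (Suc m - i))"
    by simp
  also have "(\<Sum>i=0..Suc m. fps_nth R i * fps_nth Q (Suc m - i))
      = fps_nth R 0 * fps_nth Q (Suc m) + (\<Sum>i=0..m. fps_nth R (Suc i) * fps_nth Q (m - i))"
    by (subst sum.atLeast0_atMost_Suc_shift) simp
  also have "\<dots> = qsum (Suc m) S - 2 * (\<Sum>i=0..m. cotrans_moment i S * qsum (m - i) S)"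
    by (simp add: R0 RS Qn sum_distrib_left sum_negf mult.assoc)
  \<comment> \<open>The summand i = m drops out because zeros and poles are equally many, that is
    \<open>qsum 0 S = 0\<close>.\<close>
  also have "(\<Sum>i=0..m. cotrans_moment i S * qsum (m - i) S) = (\<Sum>i<m. cotrans_moment i S * qsum (m - i) S)"
  proof -
    have "qsum 0 S = 0" by (simp add: qsum_def)
    then show ?thesis by (simp add: atLeast0AtMost lessThan_Suc_atMost[symmetric])
  qed
  finally show ?thesis by (simp add: RS algebra_simps)
qed

lemma sum_cotrans:
  assumes "finite S" "0 \<notin> S"
  shows "(\<Sum>k\<in>S. cotrans S k) = real (\<Sum>S)"
proof -
  have "2 * cotrans_moment 0 S = qsum 1 S" using cotrans_moment_rec[OF assms, of 0] by simp
  also have "qsum 1 S = 2 * real (\<Sum>S)"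
    by (simp add: qsum_def ybox_def algebra_simps sum_distrib_right[symmetric])
  finally show ?thesis by (simp add: cotrans_moment_def)
qed

text \<open>If k - 1 is also a part, its zero (k - 1) k cancels the pole \<open>ybox k\<close>. Sums
  over all parts therefore agree with sums over removable boxes.\<close>

lemma cotrans_eq_0:
  assumes "finite S" "0 \<notin> S" "k \<in> S" "k \<notin> lowerable S"
  shows "cotrans S k = 0"
proof -
  have k: "k - 1 \<in> S" "k \<ge> 1" using assms by (auto simp: lowerable_def intro: gr0I Suc_leI)
  have "k - 1 \<in> S - {k}" using k by auto
  moreover have "(ybox k - real (k - 1) * (real (k - 1) + 1)) / (ybox k - ybox (k - 1)) = 0"
    using k by (simp add: ybox_def of_nat_diff)
  ultimately have "(\<Prod>j\<in>S - {k}. (ybox k - real j * (real j + 1)) / (ybox k - ybox j)) = 0"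
    using assms(1) by (metis (no_types, lifting) finite_Diff prod_zero)
  then show ?thesis by (simp add: cotrans_def)
qed

lemma sum_cotrans_lowerable:
  assumes "finite S" "0 \<notin> S"
  shows "(\<Sum>k\<in>S. cotrans S k * f k) = (\<Sum>k\<in>lowerable S. cotrans S k * f k)"
  by (rule sum.mono_neutral_right) (use assms cotrans_eq_0 in \<open>auto simp: lowerable_def\<close>)

text \<open>Schur's product formula for the number of standard shifted tableaux, up to the factor
  n!.\<close>

definition hook_weight :: "nat set \<Rightarrow> real" where
  "hook_weight S = (\<Prod>i\<in>S. 1 / fact i) * (\<Prod>i\<in>S. \<Prod>j | j \<in> S \<and> j < i. (real i - real j) / (real i + real j))"

lemma hook_weight_insert:
  assumes "finite S" "k \<notin> S"
  shows "hook_weight (insert k S) = hook_weight S / fact k * (\<Prod>j\<in>S. \<bar>real k - real j\<bar> / (real k + real j))"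
proof -
  let ?r = "\<lambda>i j. (real i - real j) / (real i + real j)"
  have 1: "(\<Prod>j | j \<in> insert k S \<and> j < i. ?r i j) = (\<Prod>j | j \<in> S \<and> j < i. ?r i j) * (if k < i then ?r i k else 1)" for i
  proof (cases "k < i")
    case True
    then have "{j \<in> insert k S. j < i} = insert k {j \<in> S. j < i}" by auto
    then show ?thesis using assms True by simp
  next
    case False
    then have "{j \<in> insert k S. j < i} = {j \<in> S. j < i}" by auto
    then show ?thesis using False by simp
  qed
  have 2: "(\<Prod>j | j \<in> S \<and> j < k. ?r k j) = (\<Prod>j\<in>S. if j < k then ?r k j else 1)"
    by (rule prod.inter_filter[OF assms(1)])
  have "(\<Prod>i\<in>insert k S. \<Prod>j | j \<in> insert k S \<and> j < i. ?r i j)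
     = (\<Prod>j\<in>S. if j < k then ?r k j else 1) * ((\<Prod>i\<in>S. \<Prod>j | j \<in> S \<and> j < i. ?r i j) * (\<Prod>i\<in>S. if k < i then ?r i k else 1))"
    unfolding prod.insert[OF assms] 1 2 prod.distrib by simp
  also have "\<dots> = (\<Prod>i\<in>S. \<Prod>j | j \<in> S \<and> j < i. ?r i j) *
      (\<Prod>j\<in>S. (if j < k then ?r k j else 1) * (if k < j then ?r j k else 1))"
    by (simp add: prod.distrib)
  also have "(\<Prod>j\<in>S. (if j < k then ?r k j else 1) * (if k < j then ?r j k else 1))
      = (\<Prod>j\<in>S. \<bar>real k - real j\<bar> / (real k + real j))"
  proof (rule prod.cong[OF refl])
    fix j assume "j \<in> S"
    then have "j \<noteq> k" using assms by auto
    then show "(if j < k then ?r k j else 1) * (if k < j then ?r j k else 1) = \<bar>real k - real j\<bar> / (real k + real j)"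
      by (cases "j < k") (auto simp: add.commute)
  qed
  finally show ?thesis using assms by (simp add: hook_weight_def)
qed

text \<open>Only the factorial of the moved part and its factors with the other parts change. Each
  numerator and denominator in \<open>cotrans\<close> splits into a difference and a sum, and these
  match the changed factors one by one.\<close>

lemma hook_weight_lower:
  assumes S: "finite S" "0 \<notin> S" and k: "k \<in> lowerable S"
  shows "hook_weight (lower k S) = cotrans S k * hook_weight S"
proof -
  define T where "T = S - {k}"
  have kS: "k \<in> S" "k - 1 \<notin> S" using k by (auto simp: lowerable_def)
  have k1: "1 \<le> k" using kS S by (cases k) auto
  have T: "finite T" "k \<notin> T" "k - 1 \<notin> T" "0 \<notin> T" "S = insert k T" using S kS by (auto simp: T_def)
  have low: "hook_weight (lower k S) = hook_weight T / fact (k - 1) * (\<Prod>j\<in>T. \<bar>real (k - 1) - real j\<bar> / (real (k - 1) + real j))"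
  proof (cases "k = 1")
    case True
    then have "lower k S = T" using S by (auto simp: lower_def T_def)
    \<comment> \<open>A part lowered to 0 would contribute only factors
      \<open>\<bar>0 - j\<bar> / (0 + j) = 1\<close>, so the general formula remains valid for k =
      1.\<close>
    moreover have "(\<Prod>j\<in>T. \<bar>real (k - 1) - real j\<bar> / (real (k - 1) + real j)) = 1"
    proof (rule prod.neutral, rule ballI)
      fix j assume "j \<in> T"
      then have "j \<noteq> 0" using T by metis
      then show "\<bar>real (k - 1) - real j\<bar> / (real (k - 1) + real j) = 1" using True by simp
    qed
    ultimately show ?thesis using True by simp
  next
    case False
    then have "lower k S = insert (k - 1) T"
      unfolding lower_def T_def[symmetric] using T(4) k1 by auto
    then show ?thesis using hook_weight_insert[OF T(1,3)] by simp
  qed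
  have f: "(fact k :: real) = real k * fact (k - 1)" using k1 by (simp add: fact_reduce)
  have "cotrans S k * hook_weight S = real k * (\<Prod>j\<in>T. (ybox k - real j * (real j + 1)) / (ybox k - ybox j)) *
      (hook_weight T / fact k * (\<Prod>j\<in>T. \<bar>real k - real j\<bar> / (real k + real j)))"
    unfolding cotrans_def T_def[symmetric] unfolding T(5) hook_weight_insert[OF T(1,2)] ..
  also have "\<dots> = hook_weight T / fact (k - 1) *
      (\<Prod>j\<in>T. (ybox k - real j * (real j + 1)) / (ybox k - ybox j) * (\<bar>real k - real j\<bar> / (real k + real j)))"
    unfolding f prod.distrib using k1 by (simp add: field_simps)
  also have "(\<Prod>j\<in>T. (ybox k - real j * (real j + 1)) / (ybox k - ybox j) * (\<bar>real k - real j\<bar> / (real k + real j)))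
      = (\<Prod>j\<in>T. \<bar>real (k - 1) - real j\<bar> / (real (k - 1) + real j))"
  proof (rule prod.cong[OF refl])
    fix j assume j: "j \<in> T"
    then have j': "j \<noteq> 0" "j \<noteq> k" "j \<noteq> k - 1" using T by metis+
    have r: "real (k - 1) = real k - 1" using k1 by (simp add: of_nat_diff)
    have nz: "real k - real j \<noteq> 0" "real k + real j - 1 \<noteq> 0" "real k + real j \<noteq> 0" using j' k1 by auto
    have frac: "(a * p) / q * (b / p) = (a * b) / q" if "p \<noteq> 0" for a b p q :: real
      using that by simp
    have s: "(real k - 1 - real j) * \<bar>real k - real j\<bar> = \<bar>real k - 1 - real j\<bar> * (real k - real j)"
    proof (cases "j < k")
      case True
      then have "real j \<le> real k - 1" using k1 by linarith
      then show ?thesis by simp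
    next
      case False
      then have "real k < real j" using j' by simp
      then show ?thesis by (simp add: algebra_simps)
    qed
    have "(ybox k - real j * (real j + 1)) / (ybox k - ybox j) * (\<bar>real k - real j\<bar> / (real k + real j))
       = ((real k - 1 - real j) * \<bar>real k - real j\<bar>) / ((real k - real j) * (real k + real j - 1))"
      unfolding ybox_diff ybox_diff2 by (rule frac[OF nz(3)])
    also have "\<dots> = \<bar>real k - 1 - real j\<bar> / (real k + real j - 1)"
      unfolding s using nz by simp
    finally show "(ybox k - real j * (real j + 1)) / (ybox k - ybox j) * (\<bar>real k - real j\<bar> / (real k + real j))
       = \<bar>real (k - 1) - real j\<bar> / (real (k - 1) + real j)" unfolding r by (simp add: algebra_simps)
  qed
  finally show ?thesis unfolding low ..
qed

text \<open>Because the values of \<open>cotrans\<close> add up to the size, the product formula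
  satisfies the recursion of \<open>std_count_rec\<close>.\<close>

lemma std_count_eq: "S \<in> strict_sets n \<Longrightarrow> real (std_count S) = fact n * hook_weight S"
proof (induction n arbitrary: S)
  case 0
  then show ?case by (simp add: strict_sets_0 std_count_empty hook_weight_def)
next
  case (Suc n)
  note S = strict_setsD[OF Suc.prems]
  have "real (std_count S) = (\<Sum>k\<in>lowerable S. real (std_count (lower k S)))"
    unfolding std_count_rec[OF Suc.prems] by simp
  also have "\<dots> = (\<Sum>k\<in>lowerable S. cotrans S k * (fact n * hook_weight S))"
    by (rule sum.cong[OF refl]) (simp add: Suc.IH[OF lower_strict_sets[OF Suc.prems]] hook_weight_lower[OF S(1,2)])
  also have "\<dots> = (\<Sum>k\<in>S. cotrans S k * (fact n * hook_weight S))" by (rule sum_cotrans_lowerable[OF S(1,2), symmetric])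
  also have "\<dots> = real (Suc n) * (fact n * hook_weight S)"
    unfolding sum_distrib_right[symmetric] sum_cotrans[OF S(1,2)] S(3) ..
  finally show ?case by (simp add: algebra_simps)
qed

section \<open>Expectations and their difference equation in the word length\<close>

definition expect :: "nat \<Rightarrow> nat \<Rightarrow> (nat set \<Rightarrow> real) \<Rightarrow> real" where
  "expect n d h = (\<Sum>S\<in>strict_sets n. weight n d S * h S)"

lemma weight_nonneg: "0 \<le> weight n d S"
  by (simp add: weight_def schurP_nonneg)

text \<open>\<open>hook_weight_lower\<close> transfers the weight to the smaller shape, and
  \<open>schurP_pieri\<close> sums over its enlargements with total factor d, which cancels one
  power of d in the normalization.\<close>

lemma expect_coherent:
  assumes d: "0 < d"
  shows "expect (Suc n) d (\<lambda>S. \<Sum>k\<in>S. cotrans S k * h (lower k S)) = (real n + 1) * expect n d h"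
proof -
  let ?C = "fact (Suc n) / real d ^ Suc n"
  have "expect (Suc n) d (\<lambda>S. \<Sum>k\<in>S. cotrans S k * h (lower k S))
      = (\<Sum>S\<in>strict_sets (Suc n). \<Sum>k\<in>lowerable S. ?C * (schurP d S * (hook_weight (lower k S) * h (lower k S))))"
    unfolding expect_def
  proof (rule sum.cong[OF refl])
    fix S assume S: "S \<in> strict_sets (Suc n)"
    note S' = strict_setsD[OF S]
    have w: "weight (Suc n) d S = ?C * (schurP d S * hook_weight S)"
      by (simp add: weight_def std_count_eq[OF S])
    show "weight (Suc n) d S * (\<Sum>k\<in>S. cotrans S k * h (lower k S))
      = (\<Sum>k\<in>lowerable S. ?C * (schurP d S * (hook_weight (lower k S) * h (lower k S))))"
      unfolding w sum_cotrans_lowerable[OF S'(1,2)] sum_distrib_left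
      by (rule sum.cong[OF refl]) (simp only: hook_weight_lower[OF S'(1,2)] mult_ac)
  qed
  also have "\<dots> = (\<Sum>S\<in>strict_sets n. \<Sum>k\<in>raisable S. ?C * (schurP d (upper k S) * (hook_weight S * h S)))"
    by (rule exchange_lower_upper[where F="\<lambda>L M. ?C * (schurP d L * (hook_weight M * h M))"])
  also have "\<dots> = (\<Sum>S\<in>strict_sets n. (real n + 1) * (weight n d S * h S))"
  proof (rule sum.cong[OF refl])
    fix S assume S: "S \<in> strict_sets n"
    have "(\<Sum>k\<in>raisable S. ?C * (schurP d (upper k S) * (hook_weight S * h S)))
        = ?C * ((\<Sum>k\<in>raisable S. schurP d (upper k S)) * (hook_weight S * h S))"
      by (simp add: sum_distrib_left sum_distrib_right)
    also have "\<dots> = (real n + 1) * (weight n d S * h S)"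
      unfolding schurP_pieri[OF S] weight_def std_count_eq[OF S] using d by (simp add: field_simps)
    finally show "(\<Sum>k\<in>raisable S. ?C * (schurP d (upper k S) * (hook_weight S * h S))) = (real n + 1) * (weight n d S * h S)" .
  qed
  finally show ?thesis by (simp add: expect_def sum_distrib_left)
qed

lemma expect_add: "expect n d (\<lambda>S. f S + g S) = expect n d f + expect n d g"
  by (simp add: expect_def distrib_left sum.distrib)

lemma expect_diff: "expect n d (\<lambda>S. f S - g S) = expect n d f - expect n d g"
  by (simp add: expect_def right_diff_distrib sum_subtractf)

lemma expect_cmult: "expect n d (\<lambda>S. c * f S) = c * expect n d f"
  by (simp add: expect_def sum_distrib_left mult_ac)

lemma expect_cong: "(\<And>S. S \<in> strict_sets n \<Longrightarrow> f S = g S) \<Longrightarrow> expect n d f = expect n d g"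
  by (simp add: expect_def)

text \<open>Restricting to shapes of nonzero mass lets later estimates use that at most d rows
  occur.\<close>

lemma expect_mono_weight: "(\<And>S. S \<in> strict_sets n \<Longrightarrow> schurP d S \<noteq> 0 \<Longrightarrow> f S \<le> g S) \<Longrightarrow> expect n d f \<le> expect n d g"
  unfolding expect_def by (rule sum_mono) (metis mult_left_mono mult_zero_left weight_def weight_nonneg order_refl div_0)

lemma expect_mono: "(\<And>S. S \<in> strict_sets n \<Longrightarrow> f S \<le> g S) \<Longrightarrow> expect n d f \<le> expect n d g"
  by (rule expect_mono_weight)

lemma expect_1: assumes "0 < d" shows "expect n d (\<lambda>_. 1) = 1"
proof (induction n)
  case 0
  have "schurP d {} = 1"
  proof (induction d)
    case (Suc d)
    have "strip_weight {} {} = 1" by (simp add: strip_weight_def interlaced_def tail_count_def)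
    then show ?case using Suc by (simp add: strict_sets_0)
  qed simp
  then show ?case by (simp add: expect_def strict_sets_0 weight_def std_count_empty)
next
  case (Suc n)
  have "expect (Suc n) d (\<lambda>S. \<Sum>k\<in>S. cotrans S k * 1) = real n + 1"
    using expect_coherent[OF assms, of n "\<lambda>_. 1"] Suc by simp
  moreover have "expect (Suc n) d (\<lambda>S. \<Sum>k\<in>S. cotrans S k * 1) = expect (Suc n) d (\<lambda>S. (real n + 1) * 1)"
    by (rule expect_cong) (simp add: sum_cotrans strict_setsD)
  ultimately show ?case unfolding expect_cmult by simp
qed

text \<open>The expected decrease of f under one random box removal, multiplied by the size of S so
  that no division by n remains.\<close>

definition generator :: "(nat set \<Rightarrow> real) \<Rightarrow> nat set \<Rightarrow> real" where
  "generator f S = (\<Sum>k\<in>S. cotrans S k * (f S - f (lower k S)))"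

lemma expect_generator:
  assumes "0 < d"
  shows "expect (Suc n) d (generator f) = (real n + 1) * (expect (Suc n) d f - expect n d f)"
proof -
  have "expect (Suc n) d (generator f) = expect (Suc n) d (\<lambda>S. (real n + 1) * f S - (\<Sum>k\<in>S. cotrans S k * f (lower k S)))"
  proof (rule expect_cong)
    fix S assume "S \<in> strict_sets (Suc n)"
    then have "(\<Sum>k\<in>S. cotrans S k) = real n + 1" using sum_cotrans strict_setsD by (metis of_nat_Suc add.commute)
    then show "generator f S = (real n + 1) * f S - (\<Sum>k\<in>S. cotrans S k * f (lower k S))"
      by (simp add: generator_def right_diff_distrib sum_subtractf sum_distrib_right[symmetric])
  qed
  then show ?thesis unfolding expect_diff expect_cmult expect_coherent[OF assms] by (simp add: algebra_simps)
qed

section \<open>The filtered algebra of observables\<close>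

definition is_strict :: "nat set \<Rightarrow> bool" where
  "is_strict S \<longleftrightarrow> finite S \<and> 0 \<notin> S"

lemma is_strictD: "is_strict S \<Longrightarrow> finite S" "is_strict S \<Longrightarrow> 0 \<notin> S"
  by (simp_all add: is_strict_def)

lemma is_strict_strict_sets: "S \<in> strict_sets n \<Longrightarrow> is_strict S"
  by (simp add: is_strict_def strict_sets_def)

definition qmonomial :: "nat list \<Rightarrow> nat set \<Rightarrow> real" where
  "qmonomial \<rho> S = (\<Prod>r\<leftarrow>\<rho>. qsum r S)"

definition qdegree :: "nat list \<Rightarrow> nat" where
  "qdegree \<rho> = (\<Sum>r\<leftarrow>\<rho>. 2 * r - 1)"

definition positive_list :: "nat list \<Rightarrow> bool" where
  "positive_list \<rho> \<longleftrightarrow> (\<forall>r\<in>set \<rho>. 1 \<le> r)"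

lemma qmonomial_simps [simp]: "qmonomial [] S = 1" "qmonomial (r # \<rho>) S = qsum r S * qmonomial \<rho> S"
  "qmonomial (\<rho> @ \<sigma>) S = qmonomial \<rho> S * qmonomial \<sigma> S"
  by (simp_all add: qmonomial_def)

lemma qdegree_simps [simp]: "qdegree [] = 0" "qdegree (r # \<rho>) = 2 * r - 1 + qdegree \<rho>" "qdegree (\<rho> @ \<sigma>) = qdegree \<rho> + qdegree \<sigma>"
  by (simp_all add: qdegree_def)

lemma positive_list_simps [simp]: "positive_list []" "positive_list (r # \<rho>) \<longleftrightarrow> 1 \<le> r \<and> positive_list \<rho>" "positive_list (\<rho> @ \<sigma>) \<longleftrightarrow> positive_list \<rho> \<and> positive_list \<sigma>"
  by (auto simp: positive_list_def)

text \<open>Two filtrations: the weight \<open>w\<close>, in which \<open>q r\<close> has weight \<open>r\<close> (its order of growth is \<open>n ^ r\<close> when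
  \<open>d\<close> is of order \<open>sqrt n\<close>), and the degree \<open>k\<close>, in which \<open>q r\<close> has degree \<open>2 r - 1\<close> (its order of
  growth is \<open>n ^ (2 r - 1)\<close> when \<open>d\<close> is fixed).\<close>

inductive_set observables :: "nat \<Rightarrow> nat \<Rightarrow> (nat set \<Rightarrow> real) set" for w k where
  observables_zero: "(\<And>S. is_strict S \<Longrightarrow> g S = 0) \<Longrightarrow> g \<in> observables w k"
| observables_step: "f \<in> observables w k \<Longrightarrow> positive_list \<rho> \<Longrightarrow> sum_list \<rho> \<le> w \<Longrightarrow> qdegree \<rho> \<le> k \<Longrightarrow>
    (\<And>S. is_strict S \<Longrightarrow> g S = c * qmonomial \<rho> S + f S) \<Longrightarrow> g \<in> observables w k"

lemma observables_cong: "f \<in> observables w k \<Longrightarrow> (\<And>S. is_strict S \<Longrightarrow> g S = f S) \<Longrightarrow> g \<in> observables w k"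
proof (induction arbitrary: g rule: observables.induct)
  case (observables_zero f)
  then show ?case by (intro observables.observables_zero) simp
next
  case (observables_step f \<rho> h c)
  then show ?case by (intro observables.observables_step[of f _ _ \<rho> g c]) auto
qed

lemma observables_mono: "f \<in> observables w k \<Longrightarrow> w \<le> w' \<Longrightarrow> k \<le> k' \<Longrightarrow> f \<in> observables w' k'"
proof (induction rule: observables.induct)
  case (observables_zero f)
  then show ?case by (intro observables.observables_zero) simp
next
  case (observables_step f \<rho> h c)
  then show ?case by (intro observables.observables_step[of f _ _ \<rho> h c]) auto
qed

lemma observables_monomial: "positive_list \<rho> \<Longrightarrow> sum_list \<rho> \<le> w \<Longrightarrow> qdegree \<rho> \<le> k \<Longrightarrow> (\<lambda>S. c * qmonomial \<rho> S) \<in> observables w k"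
  by (rule observables_step[of "\<lambda>_. 0" _ _ \<rho> _ c]) (auto intro: observables_zero)

lemma observables_qsum: "1 \<le> r \<Longrightarrow> qsum r \<in> observables r (2 * r - 1)"
  using observables_monomial[of "[r]" r "2 * r - 1" 1] by simp

lemma observables_add:
  assumes "f \<in> observables w k" "g \<in> observables w k"
  shows "(\<lambda>S. f S + g S) \<in> observables w k"
  using assms(1)
proof (induction rule: observables.induct)
  case (observables_zero f)
  then show ?case by (intro observables_cong[OF assms(2)]) simp
next
  case (observables_step f \<rho> h c)
  show ?case by (rule observables.observables_step[OF observables_step.IH observables_step.hyps(2-4), of _ c]) (simp add: observables_step.hyps(5))
qed

lemma observables_cmult:
  assumes "f \<in> observables w k"
  shows "(\<lambda>S. a * f S) \<in> observables w k"
  using assms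
proof (induction rule: observables.induct)
  case (observables_zero f)
  then show ?case by (intro observables.observables_zero) simp
next
  case (observables_step f \<rho> h c)
  show ?case
    by (rule observables.observables_step[OF observables_step.IH observables_step.hyps(2-4), of _ "a * c"]) (simp add: observables_step.hyps(5) algebra_simps)
qed

lemma observables_diff: "f \<in> observables w k \<Longrightarrow> g \<in> observables w k \<Longrightarrow> (\<lambda>S. f S - g S) \<in> observables w k"
  using observables_add[OF _ observables_cmult[of g w k "-1"]] by simp

lemma observables_sum: "(\<And>i. i \<in> I \<Longrightarrow> f i \<in> observables w k) \<Longrightarrow> (\<lambda>S. \<Sum>i\<in>I. f i S) \<in> observables w k"
  by (induction I rule: infinite_finite_induct) (auto intro: observables_zero observables_add)

lemma observables_mult:
  assumes f: "f \<in> observables w k" and g: "g \<in> observables w' k'"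
  shows "(\<lambda>S. f S * g S) \<in> observables (w + w') (k + k')"
  using f
proof (induction rule: observables.induct)
  case (observables_zero f)
  then show ?case by (intro observables.observables_zero) simp
next
  case (observables_step f \<rho> h c)
  have "(\<lambda>S. c * qmonomial \<rho> S * g S) \<in> observables (w + w') (k + k')"
    using g
  proof (induction rule: observables.induct)
    case (observables_zero f)
    then show ?case by (intro observables.observables_zero) simp
  next
    case (observables_step f' \<sigma> h' c')
    show ?case
      by (rule observables.observables_step[OF observables_step.IH, of "\<rho> @ \<sigma>" _ "c * c'"])
         (use \<open>positive_list \<rho>\<close> \<open>sum_list \<rho> \<le> w\<close> \<open>qdegree \<rho> \<le> k\<close> observables_step.hyps in \<open>simp_all add: algebra_simps\<close>)
  qed
  then show ?case
    by (rule observables_cong[OF observables_add[OF _ observables_step.IH]]) (simp add: observables_step.hyps(5) algebra_simps)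
qed

text \<open>The class seen as the span of monomials, up to equality on strict sets; linear
  statements then only need monomials.\<close>

lemma observables_induct [consumes 1, case_names zero monomial add cong]:
  assumes f: "f \<in> observables w k"
    and zero: "P (\<lambda>_. 0)"
    and mon: "\<And>\<rho> c. positive_list \<rho> \<Longrightarrow> sum_list \<rho> \<le> w \<Longrightarrow> qdegree \<rho> \<le> k \<Longrightarrow> P (\<lambda>S. c * qmonomial \<rho> S)"
    and add: "\<And>f g. P f \<Longrightarrow> P g \<Longrightarrow> P (\<lambda>S. f S + g S)"
    and cong: "\<And>f g. P f \<Longrightarrow> (\<And>S. is_strict S \<Longrightarrow> g S = f S) \<Longrightarrow> P g"
  shows "P f"
  using f
proof (induction rule: observables.induct)
  case (observables_zero f)
  then show ?case using cong[OF zero, of f] by simp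
next
  case (observables_step f \<rho> h c)
  show ?case using cong[OF add[OF mon[OF observables_step.hyps(2-4), of c] observables_step.IH], of h] observables_step.hyps(5) by simp
qed

text \<open>In \<open>cotrans_moment_rec\<close> each product has degree (2 i + 1) + (2 (m - i) - 1)
  = 2 m, one less than the linear term. The second statement keeps the top coefficient, from which
  the eigenvalues of the generator come.\<close>

lemma cotrans_moment_observables: "cotrans_moment m \<in> observables (m + 1) (2 * m + 1)"
  and cotrans_moment_observables_top: "(\<lambda>S. cotrans_moment m S - qsum (m + 1) S / (2 * (real m + 1))) \<in> observables (m + 1) (2 * m)"
proof (induction m rule: less_induct)
  case (less m)
  define c where "c = 1 / (2 * (real m + 1))"
  have c: "c * (2 * (real m + 1)) = 1" by (simp add: c_def)
  have e: "cotrans_moment m S = c * qsum (m + 1) S - c * 2 * (\<Sum>i<m. cotrans_moment i S * qsum (m - i) S)" if "is_strict S" for S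
  proof -
    have "c * (2 * (real m + 1)) * cotrans_moment m S = c * (qsum (m + 1) S - 2 * (\<Sum>i<m. cotrans_moment i S * qsum (m - i) S))"
      using cotrans_moment_rec[OF is_strictD[OF that], of m] by (simp add: mult.assoc)
    then show ?thesis unfolding c by (simp add: algebra_simps)
  qed
  have prods: "(\<lambda>S. \<Sum>i<m. cotrans_moment i S * qsum (m - i) S) \<in> observables (m + 1) (2 * m)"
  proof (rule observables_sum)
    fix i assume i: "i \<in> {..<m}"
    have "(\<lambda>S. cotrans_moment i S * qsum (m - i) S) \<in> observables (i + 1 + (m - i)) (2 * i + 1 + (2 * (m - i) - 1))"
      by (rule observables_mult[OF less(1) observables_qsum]) (use i in auto)
    then show "(\<lambda>S. cotrans_moment i S * qsum (m - i) S) \<in> observables (m + 1) (2 * m)"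
      by (rule observables_mono) (use i in auto)
  qed
  have 2: "(\<lambda>S. cotrans_moment m S - qsum (m + 1) S / (2 * (real m + 1))) \<in> observables (m + 1) (2 * m)"
    by (rule observables_cong[OF observables_cmult[OF prods, of "- (c * 2)"]]) (simp add: e, simp add: c_def)
  have "cotrans_moment m \<in> observables (m + 1) (2 * m + 1)"
  proof (rule observables_cong[OF observables_add[OF observables_mono[OF 2] observables_cmult[of "qsum (m + 1)" _ _ c]]])
    show "qsum (m + 1) \<in> observables (m + 1) (2 * m + 1)" using observables_qsum[of "m + 1"] by simp
  qed (simp_all add: c_def)
  then show "cotrans_moment m \<in> observables (m + 1) (2 * m + 1)" "(\<lambda>S. cotrans_moment m S - qsum (m + 1) S / (2 * (real m + 1))) \<in> observables (m + 1) (2 * m)"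
    using 2 by auto
qed

text \<open>Polynomials in \<open>ybox i\<close> with observable coefficients, considered only at
  removable boxes. \<open>ybox i\<close> counts as weight 1 and degree 2, since parts are of order
  sqrt n in one regime and of order n in the other.\<close>

inductive_set local_observables :: "nat \<Rightarrow> nat \<Rightarrow> (nat set \<Rightarrow> nat \<Rightarrow> real) set" for w k where
  local_observables_zero: "(\<And>S i. is_strict S \<Longrightarrow> i \<in> lowerable S \<Longrightarrow> G S i = 0) \<Longrightarrow> G \<in> local_observables w k"
| local_observables_step: "F \<in> local_observables w k \<Longrightarrow> f \<in> observables a b \<Longrightarrow> a + m \<le> w \<Longrightarrow> b + 2 * m \<le> k \<Longrightarrow>
    (\<And>S i. is_strict S \<Longrightarrow> i \<in> lowerable S \<Longrightarrow> G S i = f S * ybox i ^ m + F S i) \<Longrightarrow> G \<in> local_observables w k"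

lemma local_observables_cong: "F \<in> local_observables w k \<Longrightarrow> (\<And>S i. is_strict S \<Longrightarrow> i \<in> lowerable S \<Longrightarrow> G S i = F S i) \<Longrightarrow> G \<in> local_observables w k"
proof (induction arbitrary: G rule: local_observables.induct)
  case (local_observables_zero F)
  then show ?case by (intro local_observables.local_observables_zero) simp
next
  case (local_observables_step F f a b m H)
  show ?case by (rule local_observables.local_observables_step[OF local_observables_step.hyps(1-4)]) (simp add: local_observables_step)
qed

lemma local_observables_mono: "F \<in> local_observables w k \<Longrightarrow> w \<le> w' \<Longrightarrow> k \<le> k' \<Longrightarrow> F \<in> local_observables w' k'"
proof (induction rule: local_observables.induct)
  case (local_observables_zero F)
  then show ?case by (intro local_observables.local_observables_zero) simp
next
  case (local_observables_step F f a b m H)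
  show ?case by (rule local_observables.local_observables_step[of F _ _ f a b m]) (use local_observables_step in auto)
qed

lemma local_observables_monomial: "f \<in> observables a b \<Longrightarrow> a + m \<le> w \<Longrightarrow> b + 2 * m \<le> k \<Longrightarrow> (\<lambda>S i. f S * ybox i ^ m) \<in> local_observables w k"
  by (rule local_observables_step[of "\<lambda>_ _. 0" _ _ f a b m]) (auto intro: local_observables_zero)

lemma local_observables_observables: "f \<in> observables w k \<Longrightarrow> (\<lambda>S i. f S) \<in> local_observables w k"
  using local_observables_monomial[of f w k 0 w k] by simp

lemma local_observables_add:
  assumes "F \<in> local_observables w k" "G \<in> local_observables w k"
  shows "(\<lambda>S i. F S i + G S i) \<in> local_observables w k"
  using assms(1)
proof (induction rule: local_observables.induct)
  case (local_observables_zero F)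
  then show ?case by (intro local_observables_cong[OF assms(2)]) simp
next
  case (local_observables_step F f a b m H)
  show ?case by (rule local_observables.local_observables_step[OF local_observables_step.IH local_observables_step.hyps(2-4)]) (simp add: local_observables_step.hyps(5))
qed

lemma local_observables_mult:
  assumes F: "F \<in> local_observables w k" and G: "G \<in> local_observables w' k'"
  shows "(\<lambda>S i. F S i * G S i) \<in> local_observables (w + w') (k + k')"
  using F
proof (induction rule: local_observables.induct)
  case (local_observables_zero F)
  then show ?case by (intro local_observables.local_observables_zero) simp
next
  case (local_observables_step F f a b m H)
  note f = local_observables_step.hyps(2-4)
  have "(\<lambda>S i. f S * ybox i ^ m * G S i) \<in> local_observables (w + w') (k + k')"
    using G
  proof (induction rule: local_observables.induct)
    case (local_observables_zero F)
    then show ?case by (intro local_observables.local_observables_zero) simp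
  next
    case (local_observables_step F' f' a' b' m' H')
    show ?case
      by (rule local_observables.local_observables_step[OF local_observables_step.IH observables_mult[OF f(1) local_observables_step.hyps(2)], of "m + m'"])
         (use f local_observables_step.hyps in \<open>simp_all add: algebra_simps power_add\<close>)
  qed
  then show ?case
    by (rule local_observables_cong[OF local_observables_add[OF _ local_observables_step.IH]]) (simp add: local_observables_step.hyps(5) algebra_simps)
qed

lemma local_observables_cmult: "F \<in> local_observables w k \<Longrightarrow> (\<lambda>S i. c * F S i) \<in> local_observables w k"
  using local_observables_mult[OF local_observables_observables[OF observables_monomial[of "[]" 0 0 c]], of F w k] by simp

text \<open>The power m of \<open>ybox\<close> averages to \<open>cotrans_moment m\<close>, of
  weight m + 1 and degree 2 m + 1, so summation over boxes costs one in each grading.\<close>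

lemma sum_cotrans_local_observables:
  assumes "F \<in> local_observables w k"
  shows "(\<lambda>S. \<Sum>i\<in>S. cotrans S i * F S i) \<in> observables (w + 1) (k + 1)"
  using assms
proof (induction rule: local_observables.induct)
  case (local_observables_zero F)
  show ?case by (rule observables_zero) (simp add: sum_cotrans_lowerable is_strictD local_observables_zero)
next
  case (local_observables_step F f a b m H)
  have "(\<lambda>S. f S * cotrans_moment m S) \<in> observables (w + 1) (k + 1)"
    by (rule observables_mono[OF observables_mult[OF local_observables_step.hyps(2) cotrans_moment_observables]]) (use local_observables_step.hyps in auto)
  then show ?case
  proof (rule observables_cong[OF observables_add[OF _ local_observables_step.IH]])
    fix S assume S: "is_strict S"
    have "(\<Sum>i\<in>S. cotrans S i * H S i) = (\<Sum>i\<in>lowerable S. cotrans S i * H S i)"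
      by (rule sum_cotrans_lowerable[OF is_strictD[OF S]])
    also have "\<dots> = (\<Sum>i\<in>lowerable S. cotrans S i * (f S * ybox i ^ m + F S i))"
      by (simp add: local_observables_step.hyps(5)[OF S])
    also have "\<dots> = (\<Sum>i\<in>S. cotrans S i * (f S * ybox i ^ m + F S i))"
      by (rule sum_cotrans_lowerable[OF is_strictD[OF S], symmetric])
    also have "\<dots> = f S * cotrans_moment m S + (\<Sum>i\<in>S. cotrans S i * F S i)"
      by (simp add: cotrans_moment_def sum_distrib_left sum.distrib algebra_simps)
    finally show "(\<Sum>i\<in>S. cotrans S i * H S i) = f S * cotrans_moment m S + (\<Sum>i\<in>S. cotrans S i * F S i)" .
  qed
qed

text \<open>The polynomial in \<open>y = x (x - 1)\<close> that equals \<open>(x (x + 1)) ^ r + ((x - 1) (x - 2)) ^ r\<close>: the two bases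
  \<open>u\<close>, \<open>v\<close> satisfy \<open>u + v = 2 y + 2\<close> and \<open>u v = y\<^sup>2 - 2 y\<close>.\<close>

fun zpoly :: "nat \<Rightarrow> real poly" where
  "zpoly 0 = [:2:]"
| "zpoly (Suc 0) = [:2, 2:]"
| "zpoly (Suc (Suc n)) = [:2, 2:] * zpoly (Suc n) - [:0, -2, 1:] * zpoly n"

lemma poly_zpoly: "poly (zpoly n) (x * (x - 1)) = (x * (x + 1)) ^ n + ((x - 1) * (x - 2)) ^ n"
proof (induction n rule: zpoly.induct)
  case (3 n)
  define u v where "u = x * (x + 1)" and "v = (x - 1) * (x - 2)"
  have 1: "u + v = 2 + 2 * (x * (x - 1))" "u * v = (x * (x - 1)) * ((x * (x - 1)) - 2)"
    by (simp_all add: u_def v_def algebra_simps)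
  define y where "y = x * (x - 1)"
  have IH: "poly (zpoly (Suc n)) y = u ^ Suc n + v ^ Suc n" "poly (zpoly n) y = u ^ n + v ^ n"
    using 3 unfolding u_def v_def y_def by simp_all
  have "poly (zpoly (Suc (Suc n))) y = (2 + 2 * y) * poly (zpoly (Suc n)) y - y * (y - 2) * poly (zpoly n) y"
    by (simp add: algebra_simps)
  then have "poly (zpoly (Suc (Suc n))) y = (2 + 2 * y) * (u ^ Suc n + v ^ Suc n) - y * (y - 2) * (u ^ n + v ^ n)"
    unfolding IH .
  then have "poly (zpoly (Suc (Suc n))) (x * (x - 1)) = (u + v) * (u ^ Suc n + v ^ Suc n) - u * v * (u ^ n + v ^ n)"
    unfolding 1 y_def .
  also have "\<dots> = u ^ Suc (Suc n) + v ^ Suc (Suc n)" by (simp add: algebra_simps)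
  finally show ?case by (simp only: u_def v_def)
qed (simp_all add: algebra_simps)

lemma coeff_zpoly_high: "n < m \<Longrightarrow> coeff (zpoly n) m = 0"
proof (induction n arbitrary: m rule: zpoly.induct)
  case 1
  then show ?case by (cases m) auto
next
  case 2
  then obtain i where "m = Suc (Suc i)" by (metis Suc_lessE less_Suc0 not0_implies_Suc not_less_eq)
  then show ?case by simp
next
  case (3 n)
  then obtain i where "m = Suc (Suc i)" by (metis Suc_lessE)
  then show ?case using 3 by simp
qed

lemma coeff_zpoly_lead: "coeff (zpoly n) n = 2"
proof (induction n rule: zpoly.induct)
  case (3 n)
  then show ?case by (simp add: coeff_zpoly_high)
qed auto

lemma coeff_zpoly_rec: "coeff (zpoly (Suc (Suc n))) (Suc m) = 2 * coeff (zpoly (Suc n)) (Suc m)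
    + 2 * coeff (zpoly (Suc n)) m + 2 * coeff (zpoly n) m - (if m = 0 then 0 else coeff (zpoly n) (m - 1))"
  unfolding zpoly.simps(3) by (cases m) simp_all

text \<open>Divided by the 2 (n + 1) of \<open>cotrans_moment_observables_top\<close>, this
  coefficient gives 2 n + 1, the eigenvalue belonging to \<open>qsum (n + 1)\<close>.\<close>

lemma coeff_zpoly_next: "coeff (zpoly (Suc n)) n = 2 * (real n + 1) * (2 * real n + 1)"
proof (induction n rule: less_induct)
  case (less n)
  show ?case
  proof (cases n)
    case (Suc m)
    have "(if m = 0 then 0 else coeff (zpoly m) (m - 1)) = 2 * real m * (2 * real m - 1)"
      using less[of "m - 1"] Suc by (cases m) (auto simp: algebra_simps)
    then show ?thesis
      unfolding Suc coeff_zpoly_rec coeff_zpoly_lead using less[of m] Suc by (simp add: algebra_simps)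
  qed simp
qed

text \<open>The leading coefficient 2 of \<open>zpoly\<close> cancels against the middle term, so
  the exponent of x (x - 1) falls from r + 1 to r. This is the loss of one weight caused by removing
  a box.\<close>

lemma second_difference_expansion:
  fixes r :: nat
  defines "c \<equiv> coeff (zpoly (Suc r))"
  shows "c r = 2 * (real r + 1) * (2 * real r + 1)"
    and "(x * (x + 1)) ^ Suc r + ((x - 1) * (x - 2)) ^ Suc r - 2 * (x * (x - 1)) ^ Suc r = (\<Sum>m\<le>r. c m * (x * (x - 1)) ^ m)"
proof -
  show "c r = 2 * (real r + 1) * (2 * real r + 1)" unfolding c_def by (rule coeff_zpoly_next)
  have "degree (zpoly (Suc r)) \<le> Suc r" by (rule degree_le) (use coeff_zpoly_high in blast)
  then have "poly (zpoly (Suc r)) y = (\<Sum>m\<le>Suc r. c m * y ^ m)" for y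
    unfolding poly_altdef c_def
    by (intro sum.mono_neutral_left) (auto simp: coeff_eq_0)
  then have "(x * (x + 1)) ^ Suc r + ((x - 1) * (x - 2)) ^ Suc r = (\<Sum>m\<le>Suc r. c m * (x * (x - 1)) ^ m)"
    by (metis poly_zpoly)
  moreover have "c (Suc r) = 2" unfolding c_def by (rule coeff_zpoly_lead)
  ultimately show "(x * (x + 1)) ^ Suc r + ((x - 1) * (x - 2)) ^ Suc r - 2 * (x * (x - 1)) ^ Suc r = (\<Sum>m\<le>r. c m * (x * (x - 1)) ^ m)"
    by simp
qed

section \<open>Discrete derivatives and the generator on monomials\<close>

definition box_diff :: "(nat set \<Rightarrow> real) \<Rightarrow> nat set \<Rightarrow> nat \<Rightarrow> real" where
  "box_diff f S k = f S - f (lower k S)"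

lemma sum_lower_fun:
  fixes \<phi> :: "nat \<Rightarrow> real"
  assumes S: "is_strict S" and k: "k \<in> lowerable S" and \<phi>: "\<phi> 0 = 0"
  shows "sum \<phi> S - sum \<phi> (lower k S) = \<phi> k - \<phi> (k - 1)"
proof -
  have k': "k \<in> S" "k - 1 \<notin> S" using k by (auto simp: lowerable_def)
  have "sum \<phi> (lower k S) = sum \<phi> (insert (k - 1) (S - {k}))"
    unfolding lower_def by (rule sum.mono_neutral_left) (use is_strictD[OF S] \<phi> in auto)
  also have "\<dots> = \<phi> (k - 1) + sum \<phi> (S - {k})" by (rule sum.insert) (use is_strictD[OF S] k' in auto)
  also have "sum \<phi> (S - {k}) = sum \<phi> S - \<phi> k" using sum.remove[OF is_strictD(1)[OF S] k'(1), of \<phi>] by simp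
  finally show ?thesis by simp
qed

text \<open>The summand of \<open>qsum\<close> is itself a difference, so moving a part from k to k
  - 1 produces the second difference of the preceding expansion at x = k.\<close>

lemma box_diff_qsum:
  assumes S: "is_strict S" and k: "k \<in> lowerable S"
  shows "box_diff (qsum (Suc r)) S k = (\<Sum>m\<le>r. coeff (zpoly (Suc r)) m * ybox k ^ m)"
proof -
  define \<phi> where "\<phi> j = (real j * (real j + 1)) ^ Suc r - ybox j ^ Suc r" for j
  have k1: "1 \<le> k" using k is_strictD(2)[OF S] by (cases k) (auto simp: lowerable_def)
  have "box_diff (qsum (Suc r)) S k = \<phi> k - \<phi> (k - 1)"
    unfolding box_diff_def qsum_def \<phi>_def[symmetric] by (rule sum_lower_fun[OF S k]) (simp add: \<phi>_def ybox_def)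
  also have "\<dots> = (real k * (real k + 1)) ^ Suc r + ((real k - 1) * (real k - 2)) ^ Suc r - 2 * (real k * (real k - 1)) ^ Suc r"
    using k1 by (simp only: \<phi>_def ybox_def of_nat_diff) (simp add: algebra_simps)
  also have "\<dots> = (\<Sum>m\<le>r. coeff (zpoly (Suc r)) m * ybox k ^ m)"
    unfolding second_difference_expansion(2) ybox_def ..
  finally show ?thesis .
qed

lemma local_observables_sum: "(\<And>i. i \<in> I \<Longrightarrow> F i \<in> local_observables w k) \<Longrightarrow> (\<lambda>S j. \<Sum>i\<in>I. F i S j) \<in> local_observables w k"
  by (induction I rule: infinite_finite_induct) (auto intro: local_observables_zero local_observables_add)

lemma box_diff_qsum_local_observables: "1 \<le> r \<Longrightarrow> box_diff (qsum r) \<in> local_observables (r - 1) (2 * r - 2)"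
proof (cases r)
  case (Suc n)
  have "(\<lambda>S i. \<Sum>m\<le>n. (coeff (zpoly (Suc n)) m * qmonomial [] S) * ybox i ^ m) \<in> local_observables n (2 * n)"
    by (rule local_observables_sum, rule local_observables_monomial[OF observables_monomial[of "[]" 0 0]]) auto
  then have "box_diff (qsum (Suc n)) \<in> local_observables n (2 * n)" by (rule local_observables_cong) (simp add: box_diff_qsum)
  then show ?thesis unfolding Suc by simp
qed simp

lemma box_diff_mult: "box_diff (\<lambda>S. f S * g S) S k = f S * box_diff g S k + g S * box_diff f S k - box_diff f S k * box_diff g S k"
  by (simp add: box_diff_def algebra_simps)

lemma positive_list_bounds: "positive_list \<rho> \<Longrightarrow> \<rho> \<noteq> [] \<Longrightarrow> 1 \<le> sum_list \<rho> \<and> 1 \<le> qdegree \<rho>"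
  by (cases \<rho>) auto

text \<open>The Leibniz rule with its correction term: the two main terms lose one in each grading,
  the product of two increments loses two.\<close>

lemma box_diff_qmonomial_local_observables: "positive_list \<rho> \<Longrightarrow> box_diff (qmonomial \<rho>) \<in> local_observables (sum_list \<rho> - 1) (qdegree \<rho> - 1)"
proof (induction \<rho>)
  case Nil
  show ?case by (rule local_observables_zero) (simp add: box_diff_def)
next
  case (Cons r \<rho>)
  have r: "1 \<le> r" and p: "positive_list \<rho>" using Cons.prems by auto
  show ?case
  proof (cases "\<rho> = []")
    case True
    have "box_diff (qmonomial [r]) \<in> local_observables (r - 1) (2 * r - 2)"
      by (rule local_observables_cong[OF box_diff_qsum_local_observables[OF r]]) (simp add: box_diff_def)
    moreover have "sum_list [r] - 1 = r - 1" "qdegree [r] - 1 = 2 * r - 2" by simp_all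
    ultimately show ?thesis unfolding True by metis
  next
    case False
    note b = positive_list_bounds[OF p False]
    have 1: "(\<lambda>S i. qsum r S * box_diff (qmonomial \<rho>) S i) \<in> local_observables (sum_list (r # \<rho>) - 1) (qdegree (r # \<rho>) - 1)"
      by (rule local_observables_mono[OF local_observables_mult[OF local_observables_observables[OF observables_qsum[OF r]] Cons.IH[OF p]]]) (use b r in auto)
    have "(\<lambda>S. qmonomial \<rho> S) \<in> observables (sum_list \<rho>) (qdegree \<rho>)"
      using observables_monomial[OF p order_refl order_refl, of 1] by simp
    then have 2: "(\<lambda>S i. qmonomial \<rho> S * box_diff (qsum r) S i) \<in> local_observables (sum_list (r # \<rho>) - 1) (qdegree (r # \<rho>) - 1)"
      by (intro local_observables_mono[OF local_observables_mult[OF local_observables_observables box_diff_qsum_local_observables[OF r]]]) (use b r in auto)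
    have 3: "(\<lambda>S i. - 1 * (box_diff (qsum r) S i * box_diff (qmonomial \<rho>) S i)) \<in> local_observables (sum_list (r # \<rho>) - 1) (qdegree (r # \<rho>) - 1)"
      by (rule local_observables_cmult, rule local_observables_mono[OF local_observables_mult[OF box_diff_qsum_local_observables[OF r] Cons.IH[OF p]]]) (use b r in auto)
    have e: "box_diff (qmonomial (r # \<rho>)) S i = qsum r S * box_diff (qmonomial \<rho>) S i + qmonomial \<rho> S * box_diff (qsum r) S i + - 1 * (box_diff (qsum r) S i * box_diff (qmonomial \<rho>) S i)" for S i
      by (simp add: box_diff_def algebra_simps)
    show ?thesis by (rule local_observables_cong[OF local_observables_add[OF local_observables_add[OF 1 2] 3] e])
  qed
qed

lemma generator_eq: "generator f S = (\<Sum>k\<in>S. cotrans S k * box_diff f S k)"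
  by (simp add: generator_def box_diff_def)

text \<open>The defect of \<open>generator\<close> in the Leibniz rule, see
  \<open>generator_mult\<close>.\<close>

definition carre_du_champ :: "(nat set \<Rightarrow> real) \<Rightarrow> (nat set \<Rightarrow> real) \<Rightarrow> nat set \<Rightarrow> real" where
  "carre_du_champ f g S = (\<Sum>k\<in>S. cotrans S k * (box_diff f S k * box_diff g S k))"

lemma generator_mult: "generator (\<lambda>S. f S * g S) S = f S * generator g S + g S * generator f S - carre_du_champ f g S"
  by (simp add: generator_eq box_diff_mult carre_du_champ_def sum_distrib_left sum.distrib sum_subtractf algebra_simps)

text \<open>Each of the two increments loses one in both gradings and summation over boxes restores
  one. The net loss in weight is what later makes covariances small.\<close>

lemma carre_du_champ_observables:
  assumes "positive_list \<rho>" "positive_list \<sigma>" "\<rho> \<noteq> []" "\<sigma> \<noteq> []"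
  shows "carre_du_champ (qmonomial \<rho>) (qmonomial \<sigma>) \<in> observables (sum_list \<rho> + sum_list \<sigma> - 1) (qdegree \<rho> + qdegree \<sigma> - 1)"
  unfolding carre_du_champ_def
  by (rule observables_mono[OF sum_cotrans_local_observables[OF local_observables_mult[OF box_diff_qmonomial_local_observables[OF assms(1)] box_diff_qmonomial_local_observables[OF assms(2)]]]])
     (use positive_list_bounds[OF assms(1,3)] positive_list_bounds[OF assms(2,4)] in auto)

text \<open>With r = n + 1, the top coefficient 2 (n + 1) (2 n + 1) of the increment meets the
  leading part \<open>qsum r / (2 (n + 1))\<close> of \<open>cotrans_moment n\<close>; everything
  else has smaller degree.\<close>

lemma generator_qsum:
  assumes "1 \<le> r"
  shows "(\<lambda>S. generator (qsum r) S - (2 * real r - 1) * qsum r S) \<in> observables r (2 * r - 2)"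
proof -
  obtain n where n: "r = Suc n" using assms by (cases r) auto
  let ?c = "coeff (zpoly (Suc n))"
  have lead: "?c n = 2 * (real n + 1) * (2 * real n + 1)" by (rule second_difference_expansion(1))
  have e: "generator (qsum r) S - (2 * real r - 1) * qsum r S
      = ?c n * (cotrans_moment n S - qsum (n + 1) S / (2 * (real n + 1))) + (\<Sum>m<n. ?c m * cotrans_moment m S)" if S: "is_strict S" for S
  proof -
    have "generator (qsum r) S = (\<Sum>k\<in>lowerable S. cotrans S k * box_diff (qsum r) S k)"
      unfolding generator_eq by (rule sum_cotrans_lowerable[OF is_strictD[OF S]])
    also have "\<dots> = (\<Sum>k\<in>lowerable S. cotrans S k * (\<Sum>m\<le>n. ?c m * ybox k ^ m))"
      by (simp add: n box_diff_qsum[OF S])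
    also have "\<dots> = (\<Sum>k\<in>S. cotrans S k * (\<Sum>m\<le>n. ?c m * ybox k ^ m))"
      by (rule sum_cotrans_lowerable[OF is_strictD[OF S], symmetric])
    also have "\<dots> = (\<Sum>m\<le>n. ?c m * cotrans_moment m S)"
      unfolding sum_distrib_left cotrans_moment_def by (subst sum.swap) (simp add: mult_ac)
    also have "\<dots> = ?c n * cotrans_moment n S + (\<Sum>m<n. ?c m * cotrans_moment m S)"
      by (simp add: lessThan_Suc_atMost[symmetric])
    finally show ?thesis unfolding lead n by (simp add: field_simps)
  qed
  have 1: "(\<lambda>S. ?c n * (cotrans_moment n S - qsum (n + 1) S / (2 * (real n + 1)))) \<in> observables r (2 * r - 2)"
    by (rule observables_cmult, rule observables_mono[OF cotrans_moment_observables_top]) (simp_all add: n)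
  have 2: "(\<lambda>S. \<Sum>m<n. ?c m * cotrans_moment m S) \<in> observables r (2 * r - 2)"
    by (rule observables_sum, rule observables_cmult, rule observables_mono[OF cotrans_moment_observables]) (auto simp: n)
  show ?thesis by (rule observables_cong[OF observables_add[OF 1 2] e])
qed

text \<open>Eigenvalues add under products. The remainder keeps the full weight and loses only
  degree, which is why inductions run on the degree.\<close>

lemma generator_qmonomial:
  assumes "positive_list \<rho>"
  shows "(\<lambda>S. generator (qmonomial \<rho>) S - real (qdegree \<rho>) * qmonomial \<rho> S) \<in> observables (sum_list \<rho>) (qdegree \<rho> - 1)"
  using assms
proof (induction \<rho>)
  case Nil
  show ?case by (rule observables_zero) (simp add: generator_def)
next
  case (Cons r \<rho>)
  have r: "1 \<le> r" and p: "positive_list \<rho>" using Cons.prems by auto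
  show ?case
  proof (cases "\<rho> = []")
    case True
    have "(\<lambda>S. generator (qmonomial [r]) S - real (qdegree [r]) * qmonomial [r] S) \<in> observables r (2 * r - 2)"
      by (rule observables_cong[OF generator_qsum[OF r]]) (use r in \<open>simp add: generator_def of_nat_diff\<close>)
    moreover have "sum_list [r] = r" "qdegree [r] - 1 = 2 * r - 2" by simp_all
    ultimately show ?thesis unfolding True by metis
  next
    case False
    note b = positive_list_bounds[OF p False]
    have q: "qmonomial \<rho> \<in> observables (sum_list \<rho>) (qdegree \<rho>)"
      using observables_monomial[OF p order_refl order_refl, of 1] by simp
    have 1: "(\<lambda>S. qsum r S * (generator (qmonomial \<rho>) S - real (qdegree \<rho>) * qmonomial \<rho> S)) \<in> observables (sum_list (r # \<rho>)) (qdegree (r # \<rho>) - 1)"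
      by (rule observables_mono[OF observables_mult[OF observables_qsum[OF r] Cons.IH[OF p]]]) (use b r in auto)
    have 2: "(\<lambda>S. qmonomial \<rho> S * (generator (qsum r) S - (2 * real r - 1) * qsum r S)) \<in> observables (sum_list (r # \<rho>)) (qdegree (r # \<rho>) - 1)"
      by (rule observables_mono[OF observables_mult[OF q generator_qsum[OF r]]]) (use b r in auto)
    have "carre_du_champ (qmonomial [r]) (qmonomial \<rho>) \<in> observables (sum_list (r # \<rho>)) (qdegree (r # \<rho>) - 1)"
      by (rule observables_mono[OF carre_du_champ_observables]) (use b r p False in auto)
    moreover have "carre_du_champ (qmonomial [r]) (qmonomial \<rho>) = carre_du_champ (qsum r) (qmonomial \<rho>)" by (rule ext) (simp add: carre_du_champ_def box_diff_def)
    ultimately have 3: "carre_du_champ (qsum r) (qmonomial \<rho>) \<in> observables (sum_list (r # \<rho>)) (qdegree (r # \<rho>) - 1)" by simp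
    have rr: "real (qdegree (r # \<rho>)) = 2 * real r - 1 + real (qdegree \<rho>)" using r by (simp add: of_nat_diff)
    have q': "qmonomial (r # \<rho>) = (\<lambda>S. qsum r S * qmonomial \<rho> S)" by (rule ext) simp
    have e: "generator (qmonomial (r # \<rho>)) S - real (qdegree (r # \<rho>)) * qmonomial (r # \<rho>) S
       = qsum r S * (generator (qmonomial \<rho>) S - real (qdegree \<rho>) * qmonomial \<rho> S)
        + qmonomial \<rho> S * (generator (qsum r) S - (2 * real r - 1) * qsum r S) - carre_du_champ (qsum r) (qmonomial \<rho>) S" for S
      unfolding rr q' generator_mult by (simp add: algebra_simps)
    show ?thesis by (rule observables_cong[OF observables_diff[OF observables_add[OF 1 2] 3] e])
  qed
qed

section \<open>The largest part\<close>

text \<open>Falling factorials replace powers of n since they are exact eigenfunctions of the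
  difference operator in \<open>expect_generator\<close>, see \<open>falling_diff\<close>.\<close>

definition falling :: "nat \<Rightarrow> nat \<Rightarrow> real" where
  "falling n j = (\<Prod>i<j. real n - real i)"

lemma falling_0 [simp]: "falling n 0 = 1"
  by (simp add: falling_def)

lemma falling_Suc: "falling n (Suc j) = falling n j * (real n - real j)"
  by (simp add: falling_def)

lemma falling_Suc_Suc: "falling (Suc n) (Suc j) = (real n + 1) * falling n j"
  unfolding falling_def prod.lessThan_Suc_shift by (simp add: add.commute)

lemma falling_eq_0: "n < j \<Longrightarrow> falling n j = 0"
  unfolding falling_def by (rule prod_zero) auto

lemma falling_nonneg: "0 \<le> falling n j"
proof (cases "n < j")
  case False
  then show ?thesis unfolding falling_def by (intro prod_nonneg) auto
qed (simp add: falling_eq_0)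

lemma falling_le_power: "falling n j \<le> real n ^ j"
proof (cases "n < j")
  case False
  then have "falling n j \<le> (\<Prod>i<j. real n)" unfolding falling_def by (intro prod_mono) auto
  then show ?thesis by simp
qed (simp add: falling_eq_0)

lemma falling_self: "falling n n = fact n"
  by (induction n) (simp_all add: falling_Suc_Suc algebra_simps)

lemma falling_diff: "(real n + 1) * (falling (Suc n) j - falling n j) = real j * falling (Suc n) j"
proof (cases j)
  case (Suc i)
  show ?thesis unfolding Suc falling_Suc_Suc falling_Suc[of n] by (simp add: algebra_simps)
qed simp

lemma falling_ge: "real L \<le> y \<Longrightarrow> y \<le> real m \<Longrightarrow> (y - real L) ^ L \<le> falling m L"
proof -
  assume a: "real L \<le> y" "y \<le> real m"
  have "(\<Prod>i<L. y - real L) \<le> falling m L" unfolding falling_def by (rule prod_mono) (use a in auto)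
  then show ?thesis by simp
qed

definition max_part :: "nat set \<Rightarrow> nat" where
  "max_part S = Max (insert 0 S)"

lemma max_part_ge: "finite S \<Longrightarrow> k \<in> S \<Longrightarrow> k \<le> max_part S"
  by (simp add: max_part_def)

lemma max_part_empty [simp]: "max_part {} = 0"
  by (simp add: max_part_def)

lemma max_part_mem: "finite S \<Longrightarrow> S \<noteq> {} \<Longrightarrow> max_part S \<in> S"
  by (simp add: max_part_def)

lemma max_part_eqI: "finite S \<Longrightarrow> k \<in> S \<Longrightarrow> (\<And>j. j \<in> S \<Longrightarrow> j \<le> k) \<Longrightarrow> max_part S = k"
  unfolding max_part_def by (rule Max_eqI) auto

text \<open>For the largest part every factor of the product lies between 0 and 1.\<close>

lemma cotrans_max_le:
  assumes S: "is_strict S" and k: "k \<in> S" "\<And>j. j \<in> S \<Longrightarrow> j \<le> k"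
  shows "0 \<le> cotrans S k" "cotrans S k \<le> real k"
proof -
  have f: "0 \<le> (ybox k - real j * (real j + 1)) / (ybox k - ybox j) \<and> (ybox k - real j * (real j + 1)) / (ybox k - ybox j) \<le> 1"
    if j: "j \<in> S - {k}" for j
  proof -
    have "j \<noteq> 0" using j is_strictD(2)[OF S] by (metis DiffD1)
    moreover have "j < k" using j k(2)[of j] by auto
    ultimately have jk: "1 \<le> real j" "real j \<le> real k - 1" by auto
    have d: "0 < ybox k - ybox j" unfolding ybox_diff using jk by (intro mult_pos_pos) auto
    have n: "0 \<le> ybox k - real j * (real j + 1)" unfolding ybox_diff2 using jk by (intro mult_nonneg_nonneg) auto
    have "ybox k - real j * (real j + 1) \<le> ybox k - ybox j" using jk by (simp add: ybox_def algebra_simps)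
    then show ?thesis using d n by simp
  qed
  have "0 \<le> (\<Prod>j\<in>S - {k}. (ybox k - real j * (real j + 1)) / (ybox k - ybox j))"
    by (rule prod_nonneg) (use f in blast)
  then show "0 \<le> cotrans S k" unfolding cotrans_def by simp
  have "(\<Prod>j\<in>S - {k}. (ybox k - real j * (real j + 1)) / (ybox k - ybox j)) \<le> 1"
    by (rule prod_le_1) (use f in blast)
  then have "real k * (\<Prod>j\<in>S - {k}. (ybox k - real j * (real j + 1)) / (ybox k - ybox j)) \<le> real k * 1"
    by (rule mult_left_mono) simp
  then show "cotrans S k \<le> real k" unfolding cotrans_def by simp
qed

text \<open>Only a box taken from the longest row, of length m, changes the maximum. Its rate is at
  most m, while \<open>falling m L\<close> then loses the fraction L / m, so the total loss is at
  most \<open>L * falling m L\<close>.\<close>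

lemma sum_cotrans_max_ge:
  assumes S: "is_strict S" "S \<noteq> {}"
  shows "(real (\<Sum>S) - real L) * falling (max_part S) L \<le> (\<Sum>k\<in>S. cotrans S k * falling (max_part (lower k S)) L)"
proof -
  note fin = is_strictD(1)[OF S(1)]
  define m where "m = max_part S"
  have m: "m \<in> S" "\<And>j. j \<in> S \<Longrightarrow> j \<le> m" using max_part_mem[OF fin S(2)] max_part_ge[OF fin] by (auto simp: m_def)
  have m1: "1 \<le> m" using m(1) is_strictD(2)[OF S(1)] by (cases m) auto
  have other: "max_part (lower k S) = m" if k: "k \<in> lowerable S" "k \<noteq> m" for k
  proof (rule max_part_eqI)
    show "finite (lower k S)" by (rule lower_props(1)[OF fin])
    show "m \<in> lower k S" using m m1 k by (auto simp: lower_def)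
    show "j \<le> m" if "j \<in> lower k S" for j
      using that m(2)[of j] m(2)[of k] k(1) by (auto simp: lower_def lowerable_def)
  qed
  have self: "max_part (lower m S) = m - 1" if k: "m \<in> lowerable S"
  proof (cases "m = 1")
    case True
    have "lower m S = {}"
    proof -
      have "S = {1}" using m True is_strictD(2)[OF S(1)] by (auto simp: le_Suc_eq)
      then show ?thesis using True by (auto simp: lower_def)
    qed
    then show ?thesis using True by simp
  next
    case False
    show ?thesis
    proof (rule max_part_eqI)
      show "finite (lower m S)" by (rule lower_props(1)[OF fin])
      show "m - 1 \<in> lower m S" using m1 False by (auto simp: lower_def)
      show "j \<le> m - 1" if "j \<in> lower m S" for j
        using that m(2)[of j] by (auto simp: lower_def)
    qed
  qed
  have key: "real m * (falling m L - falling (m - 1) L) = real L * falling m L"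
    using falling_diff[of "m - 1" L] m1 by (simp add: of_nat_diff)
  have d0: "0 \<le> falling m L - falling (m - 1) L"
  proof -
    have "0 \<le> real m * (falling m L - falling (m - 1) L)" unfolding key using falling_nonneg by simp
    then show ?thesis using m1 by (simp add: zero_le_mult_iff)
  qed
  have "(\<Sum>k\<in>S. cotrans S k * falling (max_part (lower k S)) L) = (\<Sum>k\<in>lowerable S. cotrans S k * falling (max_part (lower k S)) L)"
    by (rule sum_cotrans_lowerable[OF is_strictD[OF S(1)]])
  also have "\<dots> = (\<Sum>k\<in>lowerable S. cotrans S k * (falling m L - (if k = m then falling m L - falling (m - 1) L else 0)))"
    by (rule sum.cong[OF refl]) (use other self in auto)
  also have "\<dots> = (\<Sum>k\<in>S. cotrans S k * (falling m L - (if k = m then falling m L - falling (m - 1) L else 0)))"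
    by (rule sum_cotrans_lowerable[OF is_strictD[OF S(1)], symmetric])
  also have "\<dots> = (\<Sum>k\<in>S. cotrans S k) * falling m L - (\<Sum>k\<in>S. if k = m then cotrans S k * (falling m L - falling (m - 1) L) else 0)"
    unfolding sum_distrib_right sum_subtractf[symmetric] by (rule sum.cong) (auto simp: right_diff_distrib)
  also have "(\<Sum>k\<in>S. if k = m then cotrans S k * (falling m L - falling (m - 1) L) else 0) = cotrans S m * (falling m L - falling (m - 1) L)"
    using m fin by simp
  also have "(\<Sum>k\<in>S. cotrans S k) = real (\<Sum>S)" by (rule sum_cotrans[OF is_strictD[OF S(1)]])
  finally have e: "(\<Sum>k\<in>S. cotrans S k * falling (max_part (lower k S)) L) = real (\<Sum>S) * falling m L - cotrans S m * (falling m L - falling (m - 1) L)" .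
  have "cotrans S m * (falling m L - falling (m - 1) L) \<le> real m * (falling m L - falling (m - 1) L)"
    by (rule mult_right_mono[OF cotrans_max_le(2)[OF S(1) m] d0])
  then show ?thesis unfolding e key m_def[symmetric] by (simp add: algebra_simps)
qed

lemma strict_sets_max_eq:
  assumes "S \<in> strict_sets L" "L \<le> max_part S" "1 \<le> L"
  shows "S = {L}"
proof -
  note S = strict_setsD[OF assms(1)]
  have ne: "S \<noteq> {}" using assms S by auto
  have m: "max_part S \<in> S" by (rule max_part_mem[OF S(1) ne])
  have "\<Sum>S = max_part S + \<Sum>(S - {max_part S})" using sum.remove[OF S(1) m, of id] by simp
  then have z: "max_part S = L" "\<Sum>(S - {max_part S}) = 0" using S(3) assms(2) by auto
  have "S - {max_part S} = {}"
  proof (rule ccontr)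
    assume "S - {max_part S} \<noteq> {}"
    then obtain j where "j \<in> S - {max_part S}" by blast
    then have "j = 0" using z(2) S(1) by (simp add: sum_eq_0_iff)
    then show False using \<open>j \<in> S - {max_part S}\<close> S(2) by simp
  qed
  then show ?thesis using m z by auto
qed

text \<open>By \<open>sum_cotrans_max_ge\<close> the expectation divided by
  \<open>falling n L\<close> does not increase with n, so its value at n = L bounds it. There the
  only shape with a nonzero contribution is the single row.\<close>

lemma expect_falling_max_le:
  assumes d: "0 < d" and L: "1 \<le> L" "L \<le> n"
  shows "expect n d (\<lambda>S. falling (max_part S) L) \<le> falling n L * (schurP d {L} / real d ^ L)"
  using L(2)
proof (induction n rule: dec_induct)
  case base
  have LL: "{L} \<in> strict_sets L" using L by (simp add: strict_sets_def)
  have "expect L d (\<lambda>S. falling (max_part S) L) = (\<Sum>S\<in>{{L}}. weight L d S * falling (max_part S) L)"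
    unfolding expect_def
  proof (rule sum.mono_neutral_right[OF finite_strict_sets])
    show "\<forall>S\<in>strict_sets L - {{L}}. weight L d S * falling (max_part S) L = 0"
      using strict_sets_max_eq L falling_eq_0 by (metis DiffE insertCI leI mult_zero_right)
  qed (use LL in auto)
  also have "\<dots> = weight L d {L} * fact L" by (simp add: max_part_def falling_self)
  also have "weight L d {L} = schurP d {L} / real d ^ L"
  proof -
    have e: "{j. j = L \<and> j < L} = {}" by auto
    show ?thesis unfolding weight_def std_count_eq[OF LL] by (simp add: hook_weight_def e)
  qed
  finally show ?case by (simp add: falling_self mult.commute)
next
  case (step n)
  let ?h = "\<lambda>S. falling (max_part S) L"
  let ?p = "schurP d {L} / real d ^ L"
  have "(real (Suc n) - real L) * expect (Suc n) d ?h \<le> expect (Suc n) d (\<lambda>S. \<Sum>k\<in>S. cotrans S k * ?h (lower k S))"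
    unfolding expect_cmult[symmetric]
  proof (rule expect_mono)
    fix S assume S: "S \<in> strict_sets (Suc n)"
    then have "S \<noteq> {}" using strict_setsD(3)[OF S] by auto
    then show "(real (Suc n) - real L) * falling (max_part S) L \<le> (\<Sum>k\<in>S. cotrans S k * falling (max_part (lower k S)) L)"
      using sum_cotrans_max_ge[OF is_strict_strict_sets[OF S], of L] strict_setsD(3)[OF S] by simp
  qed
  also have "\<dots> = (real n + 1) * expect n d ?h" by (rule expect_coherent[OF d])
  also have "\<dots> \<le> (real n + 1) * (falling n L * ?p)" by (rule mult_left_mono[OF step.IH]) simp
  also have "\<dots> = (real (Suc n) - real L) * (falling (Suc n) L * ?p)"
  proof -
    have k: "(real n + 1) * falling n L = (real (Suc n) - real L) * falling (Suc n) L"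
      using falling_diff[of n L] by (simp add: algebra_simps)
    show ?thesis unfolding mult.assoc[symmetric] k ..
  qed
  finally show ?case by (rule mult_left_le_imp_le) (use step.hyps in simp)
qed

text \<open>A coefficient bound: up to a factor 2, the values on single rows have generating
  function ((1 + t) / (1 - t)) ^ d, so each is at most this value divided by
  \<open>t ^ L\<close>.\<close>

lemma schurP_single_le:
  assumes t: "0 < t" "t < 1" and L: "1 \<le> L"
  shows "schurP d {L} \<le> (1 / t) ^ L * ((1 + t) / (1 - t)) ^ d"
  using L
proof (induction d arbitrary: L)
  case (Suc d)
  let ?c = "((1 + t) / (1 - t)) ^ d"
  have c: "1 \<le> ?c" by (rule one_le_power) (use t in \<open>simp add: field_simps\<close>)
  have tl: "tail_count {L} j = (if j \<le> L then 1 else 0)" for j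
  proof -
    have "{k \<in> {L}. j \<le> k} = (if j \<le> L then {L} else {})" by auto
    then show ?thesis by (simp add: tail_count_def)
  qed
  \<comment> \<open>A single row interlaces only with the empty set and with single rows, so the
    recursion never leaves them.\<close>
  have strip_weight_supp: "strip_weight M {L} = 0" if M: "M \<in> strict_sets n" "M \<noteq> {}" "\<And>j. M \<noteq> {j}" for M n
  proof -
    note M' = strict_setsD[OF M(1)]
    have "card M \<noteq> 0" "card M \<noteq> 1" using M M'(1) by (auto simp: card_1_singleton_iff)
    then have "\<not> tail_count M 1 \<le> tail_count {L} 1" using tail_count_1[OF M'(2)] tl[of 1] Suc.prems by simp
    then show ?thesis by (auto simp: strip_weight_def interlaced_def)
  qed
  have strip_weight_le: "strip_weight {j} {L} \<le> 2" for j
  proof -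
    have "card ({j} - {L}) \<le> 1" by (rule order_trans[OF card_mono[of "{j}"]]) auto
    then have "(2::real) ^ card ({j} - {L}) \<le> 2 ^ 1" by (rule power_increasing) simp
    then show ?thesis by (simp add: strip_weight_def)
  qed
  have strip_weight_LL: "strip_weight {L} {L} \<le> 1" by (simp add: strip_weight_def)
  have strip_weight_0: "strip_weight {} {L} \<le> 1" by (simp add: strip_weight_def)
  have P0: "schurP d {} \<le> 1"
  proof (induction d)
    case (Suc d)
    have "strip_weight {} {} = 1" by (simp add: strip_weight_def interlaced_def)
    then show ?case using Suc by (simp add: strict_sets_0)
  qed simp
  have inner: "(\<Sum>M\<in>strict_sets n. strip_weight M {L} * schurP d M) \<le> (if n = 0 then 1 else if n = L then 1 else 2) * ((1 / t) ^ n * ?c)"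
    if "n \<le> L" for n
  proof (cases "n = 0")
    case True
    have "strip_weight {} {L} * schurP d {} \<le> 1 * 1" by (rule mult_mono[OF strip_weight_0 P0]) (simp_all add: schurP_nonneg)
    then show ?thesis using True c by (simp add: strict_sets_0)
  next
    case False
    then have nn: "{n} \<in> strict_sets n" by (simp add: strict_sets_def)
    have "(\<Sum>M\<in>strict_sets n. strip_weight M {L} * schurP d M) = (\<Sum>M\<in>{{n}}. strip_weight M {L} * schurP d M)"
    proof (rule sum.mono_neutral_right[OF finite_strict_sets])
      show "\<forall>M\<in>strict_sets n - {{n}}. strip_weight M {L} * schurP d M = 0"
      proof
        fix M assume M: "M \<in> strict_sets n - {{n}}"
        have "M \<noteq> {j}" for j using M strict_setsD(3)[of M n] by auto
        moreover have "M \<noteq> {}" using M False strict_setsD(3)[of M n] by auto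
        ultimately show "strip_weight M {L} * schurP d M = 0" using strip_weight_supp[of M n] M by simp
      qed
    qed (use nn in auto)
    also have "\<dots> = strip_weight {n} {L} * schurP d {n}" by simp
    also have "\<dots> \<le> (if n = L then 1 else 2) * ((1 / t) ^ n * ?c)"
      by (rule mult_mono) (use strip_weight_le strip_weight_LL Suc.IH[of n] False schurP_nonneg in auto)
    finally show ?thesis using False by simp
  qed
  have "schurP (Suc d) {L} \<le> (\<Sum>n\<le>L. (if n = 0 then 1 else if n = L then 1 else 2) * ((1 / t) ^ n * ?c))"
    unfolding schurP.simps using inner by (auto intro: sum_mono)
  also have "\<dots> = ?c * (\<Sum>n\<le>L. (if n = 0 then 1 else if n = L then 1 else 2) * (1 / t) ^ n)"
    by (simp add: sum_distrib_left mult_ac)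
  also have "(\<Sum>n\<le>L. (if n = 0 then 1 else if n = L then 1 else 2) * (1 / t) ^ n) \<le> (1 / t) ^ L * ((1 + t) / (1 - t))"
  proof -
    \<comment> \<open>The geometric sum is extended to all smaller exponents; adding the last term,
      of coefficient 1, completes 2 t / (1 - t) to (1 + t) / (1 - t).\<close>
    have g: "(\<Sum>n<m. 2 * (1 / t) ^ n) \<le> (1 / t) ^ m * (2 * t / (1 - t))" for m
    proof (induction m)
      case (Suc m)
      have "(1 / t) ^ m * (2 * t / (1 - t)) + 2 * (1 / t) ^ m = (1 / t) ^ Suc m * (2 * t / (1 - t))"
        using t by (simp add: field_simps)
      then show ?case using Suc by simp
    qed (use t in auto)
    have "(\<Sum>n\<le>L. (if n = 0 then 1 else if n = L then 1 else 2) * (1 / t) ^ n)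
        \<le> (\<Sum>n<L. 2 * (1 / t) ^ n) + (1 / t) ^ L"
    proof -
      have "(\<Sum>n<L. (if n = 0 then 1 else if n = L then 1 else 2) * (1 / t) ^ n) \<le> (\<Sum>n<L. 2 * (1 / t) ^ n)"
        by (rule sum_mono, rule mult_right_mono) (use t in auto)
      then show ?thesis using Suc.prems by (simp add: lessThan_Suc_atMost[symmetric])
    qed
    also have "\<dots> \<le> (1 / t) ^ L * (2 * t / (1 - t)) + (1 / t) ^ L" using g[of L] by simp
    also have "\<dots> = (1 / t) ^ L * ((1 + t) / (1 - t))" using t by (simp add: field_simps)
    finally show ?thesis .
  qed
  finally show ?case using c by (simp add: mult_ac)
qed (use t in simp)

text \<open>Markov's inequality for \<open>falling (max_part S) L\<close>, which is at least
  \<open>(y - L) ^ L\<close> on the event.\<close>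

lemma prob_max_le:
  assumes d: "0 < d" and L: "1 \<le> L" "L \<le> n" "real L \<le> y"
  shows "(y - real L) ^ L * expect n d (\<lambda>S. of_bool (y \<le> real (max_part S))) \<le> real n ^ L * (schurP d {L} / real d ^ L)"
proof -
  have "(y - real L) ^ L * expect n d (\<lambda>S. of_bool (y \<le> real (max_part S))) \<le> expect n d (\<lambda>S. falling (max_part S) L)"
    unfolding expect_cmult[symmetric]
  proof (rule expect_mono)
    fix S
    show "(y - real L) ^ L * of_bool (y \<le> real (max_part S)) \<le> falling (max_part S) L"
      using falling_ge[OF L(3), of "max_part S"] falling_nonneg[of "max_part S" L] by (cases "y \<le> real (max_part S)") auto
  qed
  also have "\<dots> \<le> falling n L * (schurP d {L} / real d ^ L)" by (rule expect_falling_max_le[OF d L(1,2)])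
  also have "\<dots> \<le> real n ^ L * (schurP d {L} / real d ^ L)"
    by (rule mult_right_mono[OF falling_le_power]) (simp add: schurP_nonneg)
  finally show ?thesis .
qed

section \<open>Fixed alphabet, long words\<close>

lemma expect_nonneg: "(\<And>S. S \<in> strict_sets n \<Longrightarrow> 0 \<le> f S) \<Longrightarrow> 0 \<le> expect n d f"
  unfolding expect_def by (intro sum_nonneg mult_nonneg_nonneg weight_nonneg)

lemma prob_max_fixed_d:
  assumes d: "0 < d" and \<delta>: "0 < \<delta>"
  shows "(\<lambda>n. expect n d (\<lambda>S. of_bool ((1 + \<delta>) * real n / real d \<le> real (max_part S)))) \<longlonglongrightarrow> 0"
proof (rule order_tendstoI)
  let ?p = "\<lambda>n. expect n d (\<lambda>S. of_bool ((1 + \<delta>) * real n / real d \<le> real (max_part S)))"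
  fix a :: real assume "a < 0"
  moreover have "0 \<le> ?p n" for n by (rule expect_nonneg) simp
  ultimately show "eventually (\<lambda>n. a < ?p n) sequentially" by (simp add: less_le_trans)
next
  let ?p = "\<lambda>n. expect n d (\<lambda>S. of_bool ((1 + \<delta>) * real n / real d \<le> real (max_part S)))"
  fix e :: real assume e: "0 < e"
  \<comment> \<open>With this t the bound tends, for n to infinity, to at most
    \<open>C * q ^ L\<close> with q < 1; hence L is fixed first and n grows afterwards.\<close>
  define t where "t = 1 / (1 + \<delta> / 2)"
  have t: "0 < t" "t < 1" "1 / t = 1 + \<delta> / 2" using \<delta> by (auto simp: t_def)
  define C where "C = ((1 + t) / (1 - t)) ^ d"
  define q where "q = (1 + \<delta> / 2) / (1 + \<delta>)"
  have q: "0 \<le> q" "q < 1" using \<delta> by (auto simp: q_def)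
  have "(\<lambda>L. C * q ^ L) \<longlonglongrightarrow> C * 0" by (intro tendsto_mult tendsto_const LIMSEQ_power_zero) (use q in auto)
  then have "eventually (\<lambda>L. C * q ^ L < e) sequentially" using e by (intro order_tendstoD(2)) auto
  then obtain L where L: "1 \<le> L" "C * q ^ L < e"
    using eventually_conj[OF _ eventually_ge_at_top[of 1], of "\<lambda>L. C * q ^ L < e"]
    unfolding eventually_sequentially by (metis le_refl)
  define P where "P = schurP d {L} / real d ^ L"
  have P: "P \<le> C * (1 / t / real d) ^ L"
    using schurP_single_le[OF t(1,2) L(1), of d] d unfolding P_def C_def power_divide by (simp add: field_simps)
  define f where "f n = (real n / ((1 + \<delta>) * real n / real d - real L)) ^ L * P" for n
  define v where "v = (1 + \<delta>) / real d"
  have v: "0 < v" "(1 + \<delta>) * real n / real d = v * real n" for n using d \<delta> by (auto simp: v_def)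
  have "(\<lambda>n. 1 / (v - real L * (1 / real n))) \<longlonglongrightarrow> 1 / (v - real L * 0)"
    by (intro tendsto_intros lim_1_over_n) (use v in auto)
  then have "(\<lambda>n. real n / ((1 + \<delta>) * real n / real d - real L)) \<longlonglongrightarrow> 1 / (v - real L * 0)"
  proof (rule Lim_transform_eventually)
    show "\<forall>\<^sub>F n in sequentially. 1 / (v - real L * (1 / real n)) = real n / ((1 + \<delta>) * real n / real d - real L)"
      using eventually_gt_at_top[of 0] by eventually_elim (simp only: v(2), simp add: field_simps)
  qed
  then have "(\<lambda>n. real n / ((1 + \<delta>) * real n / real d - real L)) \<longlonglongrightarrow> real d / (1 + \<delta>)"
    by (simp add: v_def)
  then have "f \<longlonglongrightarrow> (real d / (1 + \<delta>)) ^ L * P"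
    unfolding f_def by (intro tendsto_mult tendsto_power tendsto_const)
  moreover have "(real d / (1 + \<delta>)) ^ L * P < e"
  proof -
    have "(real d / (1 + \<delta>)) ^ L * P \<le> (real d / (1 + \<delta>)) ^ L * (C * (1 / t / real d) ^ L)"
      by (rule mult_left_mono[OF P]) (use \<delta> in simp)
    also have "\<dots> = C * ((real d / (1 + \<delta>)) * (1 / t / real d)) ^ L" by (simp only: power_mult_distrib mult_ac)
    also have "(real d / (1 + \<delta>)) * (1 / t / real d) = q" unfolding t(3) q_def using d by simp
    finally show ?thesis using L(2) by simp
  qed
  ultimately have "eventually (\<lambda>n. f n < e) sequentially" by (rule order_tendstoD(2))
  moreover have "eventually (\<lambda>n. real L < (1 + \<delta>) * real n / real d) sequentially"
  proof -
    have "filterlim (\<lambda>n. v * real n) at_top sequentially"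
      by (rule filterlim_tendsto_pos_mult_at_top[OF tendsto_const v(1) filterlim_real_sequentially])
    then show ?thesis unfolding v(2) by (simp add: filterlim_at_top_dense)
  qed
  ultimately show "eventually (\<lambda>n. ?p n < e) sequentially"
    using eventually_ge_at_top[of L]
  proof eventually_elim
    case (elim n)
    let ?y = "(1 + \<delta>) * real n / real d"
    have y: "0 < ?y - real L" using elim by simp
    have "(?y - real L) ^ L * ?p n \<le> real n ^ L * P"
      unfolding P_def by (rule prob_max_le[OF d L(1) elim(3)]) (use elim in simp)
    then have "?p n \<le> real n ^ L * P / (?y - real L) ^ L" using y by (simp add: pos_le_divide_eq mult.commute)
    also have "\<dots> = f n" by (simp add: f_def power_divide)
    finally show ?case using elim by simp
  qed
qed

text \<open>Induction by Chebyshev's sum inequality: the x i and their powers are equally ordered,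
  so the double sum in \<open>cheb\<close> has nonnegative terms.\<close>

lemma power_mean_lower:
  fixes x :: "'a \<Rightarrow> real"
  assumes "finite S" "card S \<le> d" "\<And>i. i \<in> S \<Longrightarrow> 0 \<le> x i"
  shows "(\<Sum>i\<in>S. x i) ^ Suc m \<le> real d ^ m * (\<Sum>i\<in>S. x i ^ Suc m)"
proof (induction m)
  case (Suc m)
  let ?s = "\<lambda>m. \<Sum>i\<in>S. x i ^ m"
  have cheb: "?s 1 * ?s (Suc m) \<le> real (card S) * ?s (Suc (Suc m))"
  proof -
    have "0 \<le> (\<Sum>i\<in>S. \<Sum>j\<in>S. (x i - x j) * (x i ^ Suc m - x j ^ Suc m))"
    proof (intro sum_nonneg)
      fix i j assume ij: "i \<in> S" "j \<in> S"
      show "0 \<le> (x i - x j) * (x i ^ Suc m - x j ^ Suc m)"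
      proof (cases "x i \<le> x j")
        case True
        then show ?thesis using power_mono[OF True assms(3)[OF ij(1)], of "Suc m"] by (intro mult_nonpos_nonpos) auto
      next
        case False
        then show ?thesis using power_mono[of "x j" "x i" "Suc m"] assms(3)[OF ij(2)] by (intro mult_nonneg_nonneg) auto
      qed
    qed
    also have "\<dots> = 2 * (real (card S) * ?s (Suc (Suc m))) - 2 * (?s 1 * ?s (Suc m))"
    proof -
      have "(\<Sum>i\<in>S. \<Sum>j\<in>S. (x i - x j) * (x i ^ Suc m - x j ^ Suc m))
          = (\<Sum>i\<in>S. \<Sum>j\<in>S. x i ^ Suc (Suc m) + x j ^ Suc (Suc m) - x i * x j ^ Suc m - x i ^ Suc m * x j)"
        by (intro sum.cong refl) (simp add: algebra_simps)
      also have "\<dots> = real (card S) * ?s (Suc (Suc m)) + real (card S) * ?s (Suc (Suc m)) - ?s 1 * ?s (Suc m) - ?s (Suc m) * ?s 1"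
        by (simp only: sum_subtractf sum.distrib sum_constant sum_distrib_left[symmetric] sum_distrib_right[symmetric] sum_product[symmetric] power_one_right)
      finally show ?thesis by simp
    qed
    finally show ?thesis by simp
  qed
  have s1: "0 \<le> ?s 1" by (rule sum_nonneg) (use assms(3) in simp)
  have s2: "0 \<le> ?s (Suc (Suc m))" by (rule sum_nonneg) (use assms(3) in simp)
  have "(\<Sum>i\<in>S. x i) ^ Suc (Suc m) = ?s 1 * (\<Sum>i\<in>S. x i) ^ Suc m" by simp
  also have "\<dots> \<le> ?s 1 * (real d ^ m * ?s (Suc m))" by (rule mult_left_mono[OF Suc.IH s1])
  also have "\<dots> = real d ^ m * (?s 1 * ?s (Suc m))" by simp
  also have "\<dots> \<le> real d ^ m * (real d * ?s (Suc (Suc m)))"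
    by (rule mult_left_mono[OF order_trans[OF cheb]], rule mult_right_mono) (use assms(2) s2 in auto)
  finally show ?case by (simp add: mult_ac)
qed simp

text \<open>Estimates for the summand of \<open>qsum\<close> after \<open>real j ^ r\<close> is
  factored out; both have the correct leading term.\<close>

lemma odd_part_bounds:
  fixes x :: real
  assumes "0 \<le> x"
  shows "2 * real (Suc m) * x ^ m \<le> (x + 1) ^ Suc m - (x - 1) ^ Suc m"
    and "1 \<le> x \<Longrightarrow> (x + 1) ^ Suc m - (x - 1) ^ Suc m \<le> 2 * real (Suc m) * (x + 1) ^ m"
proof -
  show "2 * real (Suc m) * x ^ m \<le> (x + 1) ^ Suc m - (x - 1) ^ Suc m"
  proof (induction m)
    case (Suc m)
    have s: "2 * x ^ n \<le> (x + 1) ^ n + (x - 1) ^ n" for n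
    proof -
      \<comment> \<open>Odd k cancel and even k are nonnegative, so keeping only k = 0 gives a lower
        bound.\<close>
      have "(x + 1) ^ n + (x - 1) ^ n = (\<Sum>k\<le>n. real (n choose k) * x ^ (n - k) * (1 + (-1) ^ k))"
        using binomial_ring[of 1 x n] binomial_ring[of "-1" x n]
        by (simp add: add.commute algebra_simps sum.distrib)
      also have "\<dots> \<ge> (\<Sum>k\<in>{0}. real (n choose k) * x ^ (n - k) * (1 + (-1) ^ k))"
      proof (rule sum_mono2)
        fix k assume "k \<in> {..n} - {0}"
        have "0 \<le> 1 + (-1 :: real) ^ k" by (cases "even k") auto
        then show "0 \<le> real (n choose k) * x ^ (n - k) * (1 + (-1) ^ k)" using assms by (intro mult_nonneg_nonneg) auto
      qed auto
      finally show ?thesis by simp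
    qed
    have "(x + 1) ^ Suc (Suc m) - (x - 1) ^ Suc (Suc m) = x * ((x + 1) ^ Suc m - (x - 1) ^ Suc m) + ((x + 1) ^ Suc m + (x - 1) ^ Suc m)"
      by (simp add: algebra_simps)
    also have "\<dots> \<ge> x * (2 * real (Suc m) * x ^ m) + 2 * x ^ Suc m"
      by (rule add_mono[OF mult_left_mono[OF Suc assms] s])
    also have "x * (2 * real (Suc m) * x ^ m) + 2 * x ^ Suc m = 2 * real (Suc (Suc m)) * x ^ Suc m"
      by (simp add: algebra_simps)
    finally show ?case .
  qed simp
next
  assume x: "1 \<le> x"
  show "(x + 1) ^ Suc m - (x - 1) ^ Suc m \<le> 2 * real (Suc m) * (x + 1) ^ m"
  proof (induction m)
    case (Suc m)
    have "(x + 1) ^ Suc (Suc m) - (x - 1) ^ Suc (Suc m) = (x + 1) * ((x + 1) ^ Suc m - (x - 1) ^ Suc m) + 2 * (x - 1) ^ Suc m"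
      by (simp add: algebra_simps)
    also have "\<dots> \<le> (x + 1) * (2 * real (Suc m) * (x + 1) ^ m) + 2 * (x + 1) ^ Suc m"
      by (intro add_mono mult_left_mono Suc power_mono) (use x in auto)
    also have "\<dots> = 2 * real (Suc (Suc m)) * (x + 1) ^ Suc m" by (simp add: algebra_simps)
    finally show ?case .
  qed simp
qed

lemma qsum_term: "(real j * (real j + 1)) ^ r - ybox j ^ r = real j ^ r * ((real j + 1) ^ r - (real j - 1) ^ r)"
  by (simp only: ybox_def power_mult_distrib) (simp only: right_diff_distrib)

lemma qsum_bounds:
  assumes S: "S \<in> strict_sets n" and r: "1 \<le> r"
  shows "card S \<le> d \<Longrightarrow> 2 * real r * real n ^ (2 * r - 1) \<le> real d ^ (2 * r - 2) * qsum r S"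
    and "qsum r S \<le> 2 * real r * real n * (real (max_part S) + 1) ^ (2 * r - 2)"
    and "0 \<le> qsum r S"
proof -
  obtain m where m: "r = Suc m" using r by (cases r) auto
  note S' = strict_setsD[OF S]
  have "real n = real (\<Sum>S)" using S'(3) by simp
  also have "\<dots> = (\<Sum>j\<in>S. real j)" by simp
  finally have n: "real n = (\<Sum>j\<in>S. real j)" .
  have lo: "2 * real r * (\<Sum>j\<in>S. real j ^ Suc (2 * m)) \<le> qsum r S"
    unfolding qsum_def sum_distrib_left
  proof (rule sum_mono)
    fix j assume "j \<in> S"
    have e: "real j ^ Suc (2 * m) = real j ^ Suc m * real j ^ m" by (simp add: mult_2 power_add)
    have "2 * real r * real j ^ Suc (2 * m) = real j ^ Suc m * (2 * real (Suc m) * real j ^ m)"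
      unfolding m e by (simp only: mult_ac)
    also have "\<dots> \<le> real j ^ Suc m * ((real j + 1) ^ Suc m - (real j - 1) ^ Suc m)"
      by (rule mult_left_mono[OF odd_part_bounds(1)]) auto
    finally show "2 * real r * real j ^ Suc (2 * m) \<le> (real j * (real j + 1)) ^ r - ybox j ^ r"
      unfolding qsum_term m .
  qed
  then show "0 \<le> qsum r S" by (rule order_trans[rotated]) (simp add: sum_nonneg)
  show "2 * real r * real n ^ (2 * r - 1) \<le> real d ^ (2 * r - 2) * qsum r S" if "card S \<le> d"
  proof -
    have "real n ^ Suc (2 * m) \<le> real d ^ (2 * m) * (\<Sum>j\<in>S. real j ^ Suc (2 * m))"
      unfolding n by (rule power_mean_lower[OF S'(1) that]) simp
    then have "2 * real r * real n ^ Suc (2 * m) \<le> 2 * real r * (real d ^ (2 * m) * (\<Sum>j\<in>S. real j ^ Suc (2 * m)))"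
      by (rule mult_left_mono) simp
    also have "\<dots> = real d ^ (2 * m) * (2 * real r * (\<Sum>j\<in>S. real j ^ Suc (2 * m)))" by simp
    also have "\<dots> \<le> real d ^ (2 * m) * qsum r S" by (rule mult_left_mono[OF lo]) simp
    finally show ?thesis by (simp add: m)
  qed
  show "qsum r S \<le> 2 * real r * real n * (real (max_part S) + 1) ^ (2 * r - 2)"
    unfolding qsum_def n sum_distrib_left sum_distrib_right
  proof (rule sum_mono)
    fix j assume j: "j \<in> S"
    have e2: "2 * r - 2 = m + m" by (simp add: m)
    have j1: "1 \<le> real j" using j S'(2) by (cases j) auto
    have jm: "real j \<le> real (max_part S)" using max_part_ge[OF S'(1) j] by simp
    have "real j ^ Suc m * ((real j + 1) ^ Suc m - (real j - 1) ^ Suc m) \<le> real j ^ Suc m * (2 * real (Suc m) * (real j + 1) ^ m)"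
      by (rule mult_left_mono[OF odd_part_bounds(2)]) (use j1 in auto)
    also have "\<dots> = 2 * real r * real j * (real j ^ m * (real j + 1) ^ m)"
      unfolding m power_Suc by (simp only: mult_ac)
    also have "\<dots> \<le> 2 * real r * real j * ((real (max_part S) + 1) ^ m * (real (max_part S) + 1) ^ m)"
      by (intro mult_left_mono mult_mono power_mono) (use jm in auto)
    finally show "(real j * (real j + 1)) ^ r - ybox j ^ r \<le> 2 * real r * real j * (real (max_part S) + 1) ^ (2 * r - 2)"
      unfolding qsum_term e2 power_add unfolding m .
  qed
qed

text \<open>If d rows had the common length n / d, a monomial would be about
  \<open>lead \<rho> * n ^ qdegree \<rho> / d ^ excess \<rho>\<close>, with \<open>excess\<close>
  defined next.\<close>

definition lead :: "nat list \<Rightarrow> real" where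
  "lead \<rho> = (\<Prod>r\<leftarrow>\<rho>. 2 * real r)"

definition excess :: "nat list \<Rightarrow> nat" where
  "excess \<rho> = (\<Sum>r\<leftarrow>\<rho>. 2 * r - 2)"

lemma lead_simps [simp]: "lead [] = 1" "lead (r # \<rho>) = 2 * real r * lead \<rho>" "lead (\<rho> @ \<sigma>) = lead \<rho> * lead \<sigma>"
  by (simp_all add: lead_def)

lemma excess_simps [simp]: "excess [] = 0" "excess (r # \<rho>) = 2 * r - 2 + excess \<rho>" "excess (\<rho> @ \<sigma>) = excess \<rho> + excess \<sigma>"
  by (simp_all add: excess_def)

lemma lead_nonneg: "0 \<le> lead \<rho>"
  by (induction \<rho>) auto

lemma qdegree_excess: "positive_list \<rho> \<Longrightarrow> qdegree \<rho> = excess \<rho> + length \<rho>"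
  by (induction \<rho>) auto

text \<open>Conversion between the gradings: for d of order sqrt n the quotient
  \<open>n ^ qdegree \<rho> / d ^ excess \<rho>\<close> is of order
  \<open>n ^ sum_list \<rho>\<close>.\<close>

lemma excess_wt: "positive_list \<rho> \<Longrightarrow> 2 * qdegree \<rho> = 2 * sum_list \<rho> + excess \<rho>"
  by (induction \<rho>) auto

lemma qmonomial_bounds:
  assumes S: "S \<in> strict_sets n" and p: "positive_list \<rho>"
  shows "card S \<le> d \<Longrightarrow> lead \<rho> * real n ^ qdegree \<rho> \<le> real d ^ excess \<rho> * qmonomial \<rho> S"
    and "qmonomial \<rho> S \<le> lead \<rho> * real n ^ length \<rho> * (real (max_part S) + 1) ^ excess \<rho>"
    and "0 \<le> qmonomial \<rho> S"
proof -
  show nn: "0 \<le> qmonomial \<rho> S" using p by (induction \<rho>) (auto intro!: mult_nonneg_nonneg qsum_bounds(3)[OF S])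
  show "lead \<rho> * real n ^ qdegree \<rho> \<le> real d ^ excess \<rho> * qmonomial \<rho> S" if c: "card S \<le> d"
    using p
  proof (induction \<rho>)
    case (Cons r \<rho>)
    then have r: "1 \<le> r" and p: "positive_list \<rho>" by auto
    have "lead (r # \<rho>) * real n ^ qdegree (r # \<rho>) = (2 * real r * real n ^ (2 * r - 1)) * (lead \<rho> * real n ^ qdegree \<rho>)"
      by (simp add: power_add mult_ac)
    also have "\<dots> \<le> (real d ^ (2 * r - 2) * qsum r S) * (real d ^ excess \<rho> * qmonomial \<rho> S)"
      by (rule mult_mono[OF qsum_bounds(1)[OF S r c] Cons.IH[OF p]])
         (use qsum_bounds(3)[OF S r] lead_nonneg in auto)
    also have "\<dots> = real d ^ excess (r # \<rho>) * qmonomial (r # \<rho>) S" by (simp add: power_add mult_ac)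
    finally show ?case .
  qed simp
  show "qmonomial \<rho> S \<le> lead \<rho> * real n ^ length \<rho> * (real (max_part S) + 1) ^ excess \<rho>"
    using p
  proof (induction \<rho>)
    case (Cons r \<rho>)
    then have r: "1 \<le> r" and p: "positive_list \<rho>" by auto
    have nn: "0 \<le> qmonomial \<rho> S" using p by (induction \<rho>) (auto intro!: mult_nonneg_nonneg qsum_bounds(3)[OF S])
    have "qmonomial (r # \<rho>) S \<le> (2 * real r * real n * (real (max_part S) + 1) ^ (2 * r - 2)) * (lead \<rho> * real n ^ length \<rho> * (real (max_part S) + 1) ^ excess \<rho>)"
      unfolding qmonomial_simps by (rule mult_mono[OF qsum_bounds(2)[OF S r] Cons.IH[OF p] _ nn]) simp
    also have "\<dots> = lead (r # \<rho>) * real n ^ length (r # \<rho>) * (real (max_part S) + 1) ^ excess (r # \<rho>)"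
      by (simp add: power_add mult_ac)
    finally show ?case .
  qed simp
qed

text \<open>The maximum never exceeds n, so the ratio is at most 2 even on the exceptional event,
  whose probability vanishes by \<open>prob_max_fixed_d\<close>.\<close>

lemma expect_max_power:
  assumes d: "0 < d" and a: "(1 / real d) ^ m < a"
  shows "eventually (\<lambda>n. expect n d (\<lambda>S. ((real (max_part S) + 1) / real n) ^ m) < a) sequentially"
proof -
  have "((\<lambda>\<delta>. ((1 + \<delta>) / real d) ^ m) \<longlongrightarrow> ((1 + 0) / real d) ^ m) (at_right 0)"
    by (intro tendsto_intros) (use d in auto)
  then have "eventually (\<lambda>\<delta>. ((1 + \<delta>) / real d) ^ m < a) (at_right 0)"
    using a by (intro order_tendstoD(2)) (auto simp: power_divide)
  then obtain \<delta> where \<delta>: "0 < \<delta>" "((1 + \<delta>) / real d) ^ m < a"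
    unfolding eventually_at_right_field by (metis dense)
  let ?p = "\<lambda>n. expect n d (\<lambda>S. of_bool ((1 + \<delta>) * real n / real d \<le> real (max_part S)))"
  have "(\<lambda>n. ((1 + \<delta>) / real d + 1 / real n) ^ m + 2 ^ m * ?p n) \<longlonglongrightarrow> ((1 + \<delta>) / real d + 0) ^ m + 2 ^ m * 0"
    by (intro tendsto_add tendsto_power tendsto_mult tendsto_const prob_max_fixed_d[OF d \<delta>(1)] lim_1_over_n)
  then have "eventually (\<lambda>n. ((1 + \<delta>) / real d + 1 / real n) ^ m + 2 ^ m * ?p n < a) sequentially"
    using \<delta>(2) by (intro order_tendstoD(2)) auto
  then show ?thesis using eventually_gt_at_top[of 0]
  proof eventually_elim
    case (elim n)
    have "expect n d (\<lambda>S. ((real (max_part S) + 1) / real n) ^ m)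
       \<le> expect n d (\<lambda>S. ((1 + \<delta>) / real d + 1 / real n) ^ m * 1 + 2 ^ m * of_bool ((1 + \<delta>) * real n / real d \<le> real (max_part S)))"
    proof (rule expect_mono)
      fix S assume S: "S \<in> strict_sets n"
      have mn: "max_part S \<le> n"
        using strict_sets_le[OF S] strict_setsD[OF S] max_part_mem[of S] by (cases "S = {}") auto
      show "((real (max_part S) + 1) / real n) ^ m \<le> ((1 + \<delta>) / real d + 1 / real n) ^ m * 1 + 2 ^ m * of_bool ((1 + \<delta>) * real n / real d \<le> real (max_part S))"
      proof (cases "(1 + \<delta>) * real n / real d \<le> real (max_part S)")
        case True
        have "(real (max_part S) + 1) / real n \<le> 2" using mn elim by (simp add: pos_divide_le_eq)
        then have "((real (max_part S) + 1) / real n) ^ m \<le> 2 ^ m" by (intro power_mono) auto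
        moreover have "0 \<le> ((1 + \<delta>) / real d + 1 / real n) ^ m" using \<delta> by (intro zero_le_power add_nonneg_nonneg) auto
        ultimately show ?thesis using True by simp
      next
        case False
        then have "real (max_part S) / real n \<le> (1 + \<delta>) / real d" using elim d by (simp add: field_simps)
        then have "((real (max_part S) + 1) / real n) ^ m \<le> ((1 + \<delta>) / real d + 1 / real n) ^ m"
          by (intro power_mono) (auto simp: add_divide_distrib)
        then show ?thesis using False by simp
      qed
    qed
    also have "\<dots> = ((1 + \<delta>) / real d + 1 / real n) ^ m + 2 ^ m * ?p n"
      unfolding expect_add expect_cmult expect_1[OF d] by simp
    finally show ?case using elim by simp
  qed
qed

text \<open>The lower bound holds for every shape of nonzero mass, by the power mean inequality with
  at most d rows. The upper bound comes from the largest part being asymptotically at most n /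
  d.\<close>

lemma expect_qmonomial_fixed_d:
  assumes d: "0 < d" and p: "positive_list \<rho>"
  shows "(\<lambda>n. expect n d (qmonomial \<rho>) / real n ^ qdegree \<rho>) \<longlonglongrightarrow> lead \<rho> / real d ^ excess \<rho>"
proof (rule order_tendstoI)
  fix a assume a: "a < lead \<rho> / real d ^ excess \<rho>"
  show "eventually (\<lambda>n. a < expect n d (qmonomial \<rho>) / real n ^ qdegree \<rho>) sequentially"
    using eventually_gt_at_top[of 0]
  proof eventually_elim
    case (elim n)
    have "lead \<rho> * real n ^ qdegree \<rho> = expect n d (\<lambda>S. lead \<rho> * real n ^ qdegree \<rho> * 1)"
      unfolding expect_cmult expect_1[OF d] by simp
    also have "\<dots> \<le> expect n d (\<lambda>S. real d ^ excess \<rho> * qmonomial \<rho> S)"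
    proof (rule expect_mono_weight)
      fix S assume S: "S \<in> strict_sets n" "schurP d S \<noteq> 0"
      have "card S \<le> d" using schurP_eq_0[of S d] S strict_setsD[OF S(1)] by fastforce
      then show "lead \<rho> * real n ^ qdegree \<rho> * 1 \<le> real d ^ excess \<rho> * qmonomial \<rho> S" using qmonomial_bounds(1)[OF S(1) p] by simp
    qed
    also have "\<dots> = real d ^ excess \<rho> * expect n d (qmonomial \<rho>)" unfolding expect_cmult ..
    finally have "lead \<rho> / real d ^ excess \<rho> \<le> expect n d (qmonomial \<rho>) / real n ^ qdegree \<rho>"
      using d elim by (simp add: field_simps)
    then show ?case using a by simp
  qed
next
  fix a assume a: "lead \<rho> / real d ^ excess \<rho> < a"
  show "eventually (\<lambda>n. expect n d (qmonomial \<rho>) / real n ^ qdegree \<rho> < a) sequentially"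
  proof -
    have l: "0 < lead \<rho>" using p by (induction \<rho>) auto
    have "(1 / real d) ^ excess \<rho> < a / lead \<rho>" using a l d by (simp add: power_divide field_simps)
    from expect_max_power[OF d this] eventually_gt_at_top[of 0] show ?thesis
    proof eventually_elim
      case (elim n)
      have "expect n d (qmonomial \<rho>) \<le> expect n d (\<lambda>S. (lead \<rho> * real n ^ qdegree \<rho>) * ((real (max_part S) + 1) / real n) ^ excess \<rho>)"
      proof (rule expect_mono)
        fix S assume S: "S \<in> strict_sets n"
        have e: "(lead \<rho> * real n ^ qdegree \<rho>) * ((real (max_part S) + 1) / real n) ^ excess \<rho>
          = lead \<rho> * real n ^ length \<rho> * (real (max_part S) + 1) ^ excess \<rho>"
          unfolding qdegree_excess[OF p] using elim by (simp add: power_add power_divide)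
        show "qmonomial \<rho> S \<le> (lead \<rho> * real n ^ qdegree \<rho>) * ((real (max_part S) + 1) / real n) ^ excess \<rho>"
          unfolding e by (rule qmonomial_bounds(2)[OF S p])
      qed
      also have "\<dots> = (lead \<rho> * real n ^ qdegree \<rho>) * expect n d (\<lambda>S. ((real (max_part S) + 1) / real n) ^ excess \<rho>)"
        by (rule expect_cmult)
      also have "\<dots> < (lead \<rho> * real n ^ qdegree \<rho>) * (a / lead \<rho>)"
        by (rule mult_strict_left_mono[OF elim(1)]) (use l elim in simp)
      finally show ?case using l elim by (simp add: field_simps)
    qed
  qed
qed

section \<open>Expectations and covariances as polynomials in the two parameters\<close>

lemma falling_mult_expand: "\<exists>c. \<forall>n. falling n i * falling n j = (\<Sum>l\<le>i + j. c l * falling n l)"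
proof (induction j)
  case 0
  show ?case
  proof (intro exI allI)
    fix n
    have "(\<Sum>l\<le>i. (if l = i then 1 else 0) * falling n l) = (\<Sum>l\<le>i. if l = i then falling n l else 0)"
      by (rule sum.cong) auto
    then show "falling n i * falling n 0 = (\<Sum>l\<le>i + 0. (if l = i then 1 else 0) * falling n l)" by simp
  qed
next
  case (Suc j)
  then obtain c where c: "\<And>n. falling n i * falling n j = (\<Sum>l\<le>i + j. c l * falling n l)" by blast
  define c' where "c' l = (if l = 0 then 0 else c (l - 1)) + (if l \<le> i + j then c l * (real l - real j) else 0)" for l
  have "falling n i * falling n (Suc j) = (\<Sum>l\<le>i + Suc j. c' l * falling n l)" for n
  proof -
    have "falling n i * falling n (Suc j) = (\<Sum>l\<le>i + j. c l * falling n l) * (real n - real j)"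
      by (simp add: falling_Suc c[symmetric])
    also have "\<dots> = (\<Sum>l\<le>i + j. c l * falling n (Suc l) + c l * (real l - real j) * falling n l)"
      unfolding sum_distrib_right by (rule sum.cong) (simp_all add: falling_Suc algebra_simps)
    also have "\<dots> = (\<Sum>l\<le>i + j. c l * falling n (Suc l)) + (\<Sum>l\<le>i + j. c l * (real l - real j) * falling n l)"
      by (rule sum.distrib)
    also have "(\<Sum>l\<le>i + j. c l * falling n (Suc l)) = (\<Sum>l\<le>Suc (i + j). (if l = 0 then 0 else c (l - 1)) * falling n l)"
      unfolding sum.atMost_Suc_shift by simp
    also have "(\<Sum>l\<le>i + j. c l * (real l - real j) * falling n l)
        = (\<Sum>l\<le>Suc (i + j). (if l \<le> i + j then c l * (real l - real j) else 0) * falling n l)"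
      by simp
    finally show ?thesis by (simp add: c'_def distrib_right sum.distrib)
  qed
  then show ?case by blast
qed

text \<open>Source terms of the difference equation live at n + 1, so factors taken at n have to be
  rewritten there.\<close>

lemma falling_shift_expand: "\<exists>c. \<forall>n. falling n m = (\<Sum>l\<le>m. c l * falling (Suc n) l)"
proof (induction m)
  case 0
  show ?case by (rule exI[of _ "\<lambda>_. 1"]) simp
next
  case (Suc m)
  then obtain c where c: "\<And>n. falling n m = (\<Sum>l\<le>m. c l * falling (Suc n) l)" by blast
  define c' where "c' l = (if l = Suc m then 1 else - (real m + 1) * c l)" for l
  have "falling n (Suc m) = (\<Sum>l\<le>Suc m. c' l * falling (Suc n) l)" for n
  proof -
    have "falling n (Suc m) = falling (Suc n) (Suc m) - (real m + 1) * falling n m"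
      unfolding falling_Suc_Suc falling_Suc[of n] by (simp add: algebra_simps)
    also have "(real m + 1) * falling n m = - (\<Sum>l\<le>m. c' l * falling (Suc n) l)"
      unfolding c[of n] sum_distrib_left sum_negf[symmetric] by (rule sum.cong) (auto simp: c'_def algebra_simps)
    finally show ?thesis by (simp add: c'_def)
  qed
  then show ?case by blast
qed

text \<open>The condition \<open>2 * j \<le> w + b\<close> makes every term of order at most \<open>sqrt n ^ w\<close> when \<open>d\<close> is of order \<open>sqrt n\<close>.\<close>

inductive_set expansions :: "nat \<Rightarrow> nat \<Rightarrow> (nat \<Rightarrow> nat \<Rightarrow> real) set" for w k where
  expansions_zero: "(\<And>n d. 0 < d \<Longrightarrow> G n d = 0) \<Longrightarrow> G \<in> expansions w k"
| expansions_step: "F \<in> expansions w k \<Longrightarrow> j \<le> k \<Longrightarrow> 2 * j \<le> w + b \<Longrightarrow>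
    (\<And>n d. 0 < d \<Longrightarrow> G n d = c * falling n j / real d ^ b + F n d) \<Longrightarrow> G \<in> expansions w k"

lemma expansions_cong: "F \<in> expansions w k \<Longrightarrow> (\<And>n d. 0 < d \<Longrightarrow> G n d = F n d) \<Longrightarrow> G \<in> expansions w k"
proof (induction arbitrary: G rule: expansions.induct)
  case (expansions_zero F)
  then show ?case by (intro expansions.expansions_zero) simp
next
  case (expansions_step F j b H c)
  show ?case by (rule expansions.expansions_step[OF expansions_step.hyps(1-3), of _ c]) (simp add: expansions_step)
qed

lemma expansions_mono: "F \<in> expansions w k \<Longrightarrow> w \<le> w' \<Longrightarrow> k \<le> k' \<Longrightarrow> F \<in> expansions w' k'"
proof (induction rule: expansions.induct)
  case (expansions_zero F)
  then show ?case by (intro expansions.expansions_zero) simp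
next
  case (expansions_step F j b H c)
  show ?case by (rule expansions.expansions_step[of F _ _ j b _ c]) (use expansions_step in auto)
qed

lemma expansions_monomial: "j \<le> k \<Longrightarrow> 2 * j \<le> w + b \<Longrightarrow> (\<lambda>n d. c * falling n j / real d ^ b) \<in> expansions w k"
  by (rule expansions_step[of "\<lambda>_ _. 0" _ _ j b _ c]) (auto intro: expansions_zero)

lemma expansions_add:
  assumes "F \<in> expansions w k" "G \<in> expansions w k"
  shows "(\<lambda>n d. F n d + G n d) \<in> expansions w k"
  using assms(1)
proof (induction rule: expansions.induct)
  case (expansions_zero F)
  then show ?case by (intro expansions_cong[OF assms(2)]) simp
next
  case (expansions_step F j b H c)
  show ?case by (rule expansions.expansions_step[OF expansions_step.IH expansions_step.hyps(2,3), of _ c]) (simp add: expansions_step.hyps(4))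
qed

lemma expansions_cmult:
  assumes "F \<in> expansions w k"
  shows "(\<lambda>n d. a * F n d) \<in> expansions w k"
  using assms
proof (induction rule: expansions.induct)
  case (expansions_zero F)
  then show ?case by (intro expansions.expansions_zero) simp
next
  case (expansions_step F j b H c)
  show ?case by (rule expansions.expansions_step[OF expansions_step.IH expansions_step.hyps(2,3), of _ "a * c"]) (simp add: expansions_step.hyps(4) algebra_simps)
qed

lemma expansions_diff: "F \<in> expansions w k \<Longrightarrow> G \<in> expansions w k \<Longrightarrow> (\<lambda>n d. F n d - G n d) \<in> expansions w k"
  using expansions_add[OF _ expansions_cmult[of G w k "-1"]] by simp

lemma expansions_sum: "(\<And>i. i \<in> I \<Longrightarrow> F i \<in> expansions w k) \<Longrightarrow> (\<lambda>n d. \<Sum>i\<in>I. F i n d) \<in> expansions w k"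
  by (induction I rule: infinite_finite_induct) (auto intro: expansions_zero expansions_add)

text \<open>Each difference lowers the power of n by one and the prefactor restores one. The net
  loss of one power of n is 2 on the scale of \<open>w\<close>, which counts powers of sqrt
  n.\<close>

lemma expansions_nabla_prod:
  assumes F: "F \<in> expansions w k" and G: "G \<in> expansions w' k'"
  shows "\<exists>K\<in>expansions (w + w' - 2) (k + k' - 1). \<forall>n d. 0 < d \<longrightarrow>
     (real n + 1) * (F (Suc n) d - F n d) * (G (Suc n) d - G n d) = K (Suc n) d"
  using F
proof (induction rule: expansions.induct)
  case (expansions_zero F)
  show ?case by (rule bexI[of _ "\<lambda>_ _. 0"]) (auto simp: expansions_zero intro: expansions.expansions_zero)
next
  case (expansions_step F i b H c)
  note F = expansions_step.hyps(2-4)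
  have "\<exists>K\<in>expansions (w + w' - 2) (k + k' - 1). \<forall>n d. 0 < d \<longrightarrow>
     (real n + 1) * (c * falling (Suc n) i / real d ^ b - c * falling n i / real d ^ b) * (G (Suc n) d - G n d) = K (Suc n) d"
    using G
  proof (induction rule: expansions.induct)
    case (expansions_zero F)
    show ?case by (rule bexI[of _ "\<lambda>_ _. 0"]) (auto simp: expansions_zero intro: expansions.expansions_zero)
  next
    case (expansions_step F' j b' H' c')
    note F' = expansions_step.hyps(2-4)
    have "\<exists>K\<in>expansions (w + w' - 2) (k + k' - 1). \<forall>n d. 0 < d \<longrightarrow>
       (real n + 1) * (c * falling (Suc n) i / real d ^ b - c * falling n i / real d ^ b)
         * (c' * falling (Suc n) j / real d ^ b' - c' * falling n j / real d ^ b') = K (Suc n) d"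
    proof (cases "i = 0 \<or> j = 0")
      case True
      then show ?thesis by (intro bexI[of _ "\<lambda>_ _. 0"]) (auto intro: expansions.expansions_zero)
    next
      case False
      then obtain i' where i: "i = Suc i'" by (cases i) auto
      obtain e where e: "\<And>n. falling n i' = (\<Sum>l\<le>i'. e l * falling (Suc n) l)" using falling_shift_expand[of i'] by blast
      define f where "f l = (SOME f. \<forall>n. falling n l * falling n j = (\<Sum>m\<le>l + j. f m * falling n m))" for l
      have f: "falling n l * falling n j = (\<Sum>m\<le>l + j. f l m * falling n m)" for n l
        using someI_ex[OF falling_mult_expand[of l j]] unfolding f_def by blast
      define a where "a = c * c' * real i * real j"
      define K where "K n d = (\<Sum>l\<le>i'. \<Sum>m\<le>l + j. (a * e l * f l m) * falling n m / real d ^ (b + b'))" for n d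
      have "K \<in> expansions (w + w' - 2) (k + k' - 1)"
        unfolding K_def
      proof (intro expansions_sum expansions_monomial)
        fix l m assume lm: "l \<in> {..i'}" "m \<in> {..l + j}"
        show "m \<le> k + k' - 1" using lm F(1) F'(1) i False by auto
        show "2 * m \<le> w + w' - 2 + (b + b')" using lm F(2) F'(2) i False by auto
      qed
      moreover have "(real n + 1) * (c * falling (Suc n) i / real d ^ b - c * falling n i / real d ^ b)
         * (c' * falling (Suc n) j / real d ^ b' - c' * falling n j / real d ^ b') = K (Suc n) d" if "0 < d" for n d
      proof -
        have 1: "falling (Suc n) i - falling n i = real i * falling n i'"
          unfolding i falling_Suc_Suc falling_Suc[of n] by (simp add: algebra_simps)
        have "(real n + 1) * (c * falling (Suc n) i / real d ^ b - c * falling n i / real d ^ b)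
         * (c' * falling (Suc n) j / real d ^ b' - c' * falling n j / real d ^ b')
          = c * c' * (falling (Suc n) i - falling n i) * ((real n + 1) * (falling (Suc n) j - falling n j)) / (real d ^ b * real d ^ b')"
          by (simp add: diff_divide_distrib[symmetric] right_diff_distrib[symmetric])
        also have "\<dots> = a * falling n i' * falling (Suc n) j / real d ^ (b + b')"
          unfolding 1 falling_diff by (simp add: a_def power_add)
        also have "a * falling n i' * falling (Suc n) j = (\<Sum>l\<le>i'. a * e l * (falling (Suc n) l * falling (Suc n) j))"
          unfolding e sum_distrib_left sum_distrib_right by (simp add: mult_ac)
        also have "\<dots> = (\<Sum>l\<le>i'. \<Sum>m\<le>l + j. a * e l * f l m * falling (Suc n) m)"
          unfolding f sum_distrib_left by (simp add: mult_ac)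
        finally show ?thesis by (simp add: K_def sum_divide_distrib)
      qed
      ultimately show ?thesis by blast
    qed
    then obtain K1 where K1: "K1 \<in> expansions (w + w' - 2) (k + k' - 1)"
      "\<And>n d. 0 < d \<Longrightarrow> (real n + 1) * (c * falling (Suc n) i / real d ^ b - c * falling n i / real d ^ b)
         * (c' * falling (Suc n) j / real d ^ b' - c' * falling n j / real d ^ b') = K1 (Suc n) d" by blast
    obtain K2 where K2: "K2 \<in> expansions (w + w' - 2) (k + k' - 1)"
      "\<And>n d. 0 < d \<Longrightarrow> (real n + 1) * (c * falling (Suc n) i / real d ^ b - c * falling n i / real d ^ b)
         * (F' (Suc n) d - F' n d) = K2 (Suc n) d" using expansions_step.IH by blast
    show ?case
    proof (rule bexI[OF _ expansions_add[OF K1(1) K2(1)]], intro allI impI)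
      fix n d :: nat assume d: "0 < d"
      show "(real n + 1) * (c * falling (Suc n) i / real d ^ b - c * falling n i / real d ^ b) * (H' (Suc n) d - H' n d)
        = K1 (Suc n) d + K2 (Suc n) d"
        unfolding K1(2)[OF d, symmetric] K2(2)[OF d, symmetric] F'(3)[OF d] by (simp only: algebra_simps)
    qed
  qed
  then obtain K1 where K1: "K1 \<in> expansions (w + w' - 2) (k + k' - 1)"
    "\<And>n d. 0 < d \<Longrightarrow> (real n + 1) * (c * falling (Suc n) i / real d ^ b - c * falling n i / real d ^ b) * (G (Suc n) d - G n d) = K1 (Suc n) d"
    by blast
  obtain K2 where K2: "K2 \<in> expansions (w + w' - 2) (k + k' - 1)"
    "\<And>n d. 0 < d \<Longrightarrow> (real n + 1) * (F (Suc n) d - F n d) * (G (Suc n) d - G n d) = K2 (Suc n) d"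
    using expansions_step.IH by blast
  show ?case
  proof (rule bexI[OF _ expansions_add[OF K1(1) K2(1)]], intro allI impI)
    fix n d :: nat assume d: "0 < d"
    show "(real n + 1) * (H (Suc n) d - H n d) * (G (Suc n) d - G n d) = K1 (Suc n) d + K2 (Suc n) d"
      unfolding K1(2)[OF d, symmetric] K2(2)[OF d, symmetric] F(3)[OF d] by (simp only: algebra_simps)
  qed
qed

lemma falling_over_power: "(\<lambda>n. falling n j / real n ^ j) \<longlonglongrightarrow> 1"
proof -
  have "(\<lambda>n. \<Prod>i<j. 1 - real i * (1 / real n)) \<longlonglongrightarrow> (\<Prod>i<j. 1 - real i * 0)"
    by (intro tendsto_prod tendsto_diff tendsto_mult tendsto_const lim_1_over_n)
  then have "(\<lambda>n. \<Prod>i<j. 1 - real i * (1 / real n)) \<longlonglongrightarrow> 1" by simp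
  then show ?thesis
  proof (rule Lim_transform_eventually)
    show "\<forall>\<^sub>F n in sequentially. (\<Prod>i<j. 1 - real i * (1 / real n)) = falling n j / real n ^ j"
      using eventually_gt_at_top[of 0]
    proof eventually_elim
      case (elim n)
      have "falling n j / real n ^ j = (\<Prod>i<j. (real n - real i) / real n)"
        by (simp add: falling_def prod_dividef)
      also have "\<dots> = (\<Prod>i<j. 1 - real i * (1 / real n))"
        by (rule prod.cong) (use elim in \<open>simp_all add: field_simps\<close>)
      finally show ?case by simp
    qed
  qed
qed

lemma expansions_low_degree:
  assumes "F \<in> expansions w m" "m < k" "0 < d"
  shows "(\<lambda>n. F n d / real n ^ k) \<longlonglongrightarrow> 0"
  using assms(1)
proof (induction rule: expansions.induct)
  case (expansions_zero F)
  then show ?case using assms by simp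
next
  case (expansions_step F j b H c)
  have jk: "j < k" using expansions_step assms by simp
  have "(\<lambda>n. c / real d ^ b * ((falling n j / real n ^ j) * (1 / real n) ^ (k - j)) + F n d / real n ^ k)
      \<longlonglongrightarrow> c / real d ^ b * (1 * 0 ^ (k - j)) + 0"
    by (intro tendsto_intros falling_over_power lim_1_over_n expansions_step.IH)
  then have "(\<lambda>n. c / real d ^ b * ((falling n j / real n ^ j) * (1 / real n) ^ (k - j)) + F n d / real n ^ k) \<longlonglongrightarrow> 0"
    using jk by (simp add: power_0_left)
  moreover have "c / real d ^ b * ((falling n j / real n ^ j) * (1 / real n) ^ (k - j)) + F n d / real n ^ k = H n d / real n ^ k" for n
  proof -
    have "real n ^ k = real n ^ j * real n ^ (k - j)" using jk by (simp add: power_add[symmetric])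
    then show ?thesis unfolding expansions_step.hyps(4)[OF assms(3)] by (simp add: power_divide add_divide_distrib)
  qed
  ultimately show ?case by simp
qed

text \<open>On \<open>falling n j\<close> the operator acts as multiplication by j - k, and this is
  nonzero because j \<le> m < k.\<close>

lemma expansions_solve:
  assumes "H \<in> expansions w m" "m < k"
  shows "\<exists>G\<in>expansions w m. \<forall>n d. 0 < d \<longrightarrow> (real n + 1) * (G (Suc n) d - G n d) - real k * G (Suc n) d = H (Suc n) d"
  using assms(1)
proof (induction rule: expansions.induct)
  case (expansions_zero H)
  show ?case by (rule bexI[of _ "\<lambda>_ _. 0"]) (auto simp: expansions_zero intro: expansions.expansions_zero)
next
  case (expansions_step F j b H c)
  then obtain G where G: "G \<in> expansions w m"
    "\<And>n d. 0 < d \<Longrightarrow> (real n + 1) * (G (Suc n) d - G n d) - real k * G (Suc n) d = F (Suc n) d" by blast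
  define c' where "c' = c / (real j - real k)"
  have c': "c = c' * (real j - real k)" using expansions_step assms(2) by (simp add: c'_def)
  show ?case
  proof (rule bexI[OF _ expansions_add[OF expansions_monomial[OF expansions_step.hyps(2,3), of c'] G(1)]], intro allI impI)
    fix n d :: nat assume d: "0 < d"
    have "(real n + 1) * (c' * falling (Suc n) j / real d ^ b - c' * falling n j / real d ^ b)
        = c' / real d ^ b * ((real n + 1) * (falling (Suc n) j - falling n j))"
      by (simp add: diff_divide_distrib right_diff_distrib mult_ac)
    also have "\<dots> = c' / real d ^ b * (real j * falling (Suc n) j)" unfolding falling_diff ..
    finally have 1: "(real n + 1) * (c' * falling (Suc n) j / real d ^ b - c' * falling n j / real d ^ b) = real j * (c' * falling (Suc n) j / real d ^ b)"
      by simp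
    have "(real n + 1) * (c' * falling (Suc n) j / real d ^ b + G (Suc n) d - (c' * falling n j / real d ^ b + G n d))
        - real k * (c' * falling (Suc n) j / real d ^ b + G (Suc n) d)
      = (real n + 1) * (c' * falling (Suc n) j / real d ^ b - c' * falling n j / real d ^ b) - real k * (c' * falling (Suc n) j / real d ^ b)
        + ((real n + 1) * (G (Suc n) d - G n d) - real k * G (Suc n) d)"
      by (simp only: algebra_simps)
    also have "\<dots> = c * falling (Suc n) j / real d ^ b + F (Suc n) d"
      unfolding 1 G(2)[OF d] c' by (simp add: left_diff_distrib right_diff_distrib diff_divide_distrib mult_ac)
    finally show "(real n + 1) * (c' * falling (Suc n) j / real d ^ b + G (Suc n) d - (c' * falling n j / real d ^ b + G n d))
        - real k * (c' * falling (Suc n) j / real d ^ b + G (Suc n) d) = H (Suc n) d"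
      unfolding expansions_step.hyps(4)[OF d] .
  qed
qed

text \<open>The coefficient n + 1 - k vanishes at n = k - 1, which forces D to be 0 below k and
  leaves one free value at k. Above k the recursion propagates it as a multiple of
  \<open>falling n k\<close>, and the limit identifies the multiple.\<close>

lemma falling_recurrence_unique:
  fixes D :: "nat \<Rightarrow> real"
  assumes k: "1 \<le> k" and rec: "\<And>n. (real n + 1) * (D (Suc n) - D n) = real k * D (Suc n)"
    and lim: "(\<lambda>n. D n / real n ^ k) \<longlonglongrightarrow> A"
  shows "D n = A * falling n k"
proof -
  have r: "(real n + 1 - real k) * D (Suc n) = (real n + 1) * D n" for n
    using rec[of n] by (simp add: algebra_simps)
  have low: "D n = 0" if "n < k" for n
  proof -
    have "n \<le> k - 1" using that by simp
    then show ?thesis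
    proof (induction n rule: inc_induct)
      case base
      show ?case using r[of "k - 1"] k by (simp add: of_nat_diff)
    next
      case (step n)
      then show ?case using r[of n] by simp
    qed
  qed
  define C where "C = D k / falling k k"
  have hi: "D n = C * falling n k" if "k \<le> n" for n
    using that
  proof (induction n rule: dec_induct)
    case base
    have "falling k k \<noteq> 0" by (simp add: falling_self)
    then show ?case by (simp add: C_def)
  next
    case (step n)
    have kk: "(real n + 1) * falling n k = (real n + 1 - real k) * falling (Suc n) k"
      using falling_diff[of n k] by (simp add: algebra_simps)
    have "(real n + 1 - real k) * D (Suc n) = (real n + 1 - real k) * (C * falling (Suc n) k)"
      unfolding r step.IH using kk by (simp add: mult_ac)
    moreover have "real n + 1 - real k \<noteq> 0" using step by linarith
    ultimately show ?case by simp
  qed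
  have "(\<lambda>n. C * (falling n k / real n ^ k)) \<longlonglongrightarrow> C * 1" by (intro tendsto_intros falling_over_power)
  then have "(\<lambda>n. D n / real n ^ k) \<longlonglongrightarrow> C * 1"
  proof (rule Lim_transform_eventually)
    show "\<forall>\<^sub>F n in sequentially. C * (falling n k / real n ^ k) = D n / real n ^ k"
      using eventually_ge_at_top[of k] by eventually_elim (simp add: hi)
  qed
  then have "A = C" using LIMSEQ_unique[OF lim] by simp
  then show ?thesis using low[of n] hi[of n] falling_eq_0[of n k] by (cases "n < k") auto
qed

text \<open>A particular solution of degree below k disappears in the limit, so \<open>A d\<close>
  is exactly the coefficient of the homogeneous solution.\<close>

lemma expansions_invert:
  assumes k: "1 \<le> k" and H: "H \<in> expansions w (k - 1)"
    and eq: "\<And>n d. 0 < d \<Longrightarrow> (real n + 1) * (F (Suc n) d - F n d) - real k * F (Suc n) d = H (Suc n) d"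
    and lim: "\<And>d. 0 < d \<Longrightarrow> (\<lambda>n. F n d / real n ^ k) \<longlonglongrightarrow> A d"
    and A: "(\<lambda>n d. A d * falling n k) \<in> expansions w k"
  shows "F \<in> expansions w k"
proof -
  obtain G where G: "G \<in> expansions w (k - 1)"
    "\<And>n d. 0 < d \<Longrightarrow> (real n + 1) * (G (Suc n) d - G n d) - real k * G (Suc n) d = H (Suc n) d"
    using expansions_solve[OF H, of k] k by auto
  have "F n d = A d * falling n k + G n d" if d: "0 < d" for n d
  proof -
    have "F n d - G n d = A d * falling n k"
    proof (rule falling_recurrence_unique[OF k, where D="\<lambda>n. F n d - G n d"])
      show "(real m + 1) * (F (Suc m) d - G (Suc m) d - (F m d - G m d)) = real k * (F (Suc m) d - G (Suc m) d)" for m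
        using eq[OF d, of m] G(2)[OF d, of m] by (simp add: algebra_simps)
      have "(\<lambda>n. F n d / real n ^ k - G n d / real n ^ k) \<longlonglongrightarrow> A d - 0"
        by (intro tendsto_diff lim[OF d] expansions_low_degree[OF G(1) _ d]) (use k in simp)
      then show "(\<lambda>n. (F n d - G n d) / real n ^ k) \<longlonglongrightarrow> A d" by (simp add: diff_divide_distrib)
    qed
    then show ?thesis by simp
  qed
  then show ?thesis by (rule expansions_cong[OF expansions_add[OF A expansions_mono[OF G(1)]], rotated 2]) (use k in auto)
qed

lemma expect_observables_from_monomials:
  assumes f: "f \<in> observables w k"
    and mon: "\<And>\<rho>. positive_list \<rho> \<Longrightarrow> qdegree \<rho> \<le> k \<Longrightarrow> (\<lambda>n d. expect n d (qmonomial \<rho>)) \<in> expansions (2 * sum_list \<rho>) (qdegree \<rho>)"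
  shows "(\<lambda>n d. expect n d f) \<in> expansions (2 * w) k"
  using f
proof (induction rule: observables_induct)
  case zero
  show ?case by (rule expansions_zero) (simp add: expect_def)
next
  case (monomial \<rho> c)
  have "(\<lambda>n d. c * expect n d (qmonomial \<rho>)) \<in> expansions (2 * w) k"
    by (rule expansions_cmult, rule expansions_mono[OF mon]) (use monomial in auto)
  then show ?case by (simp add: expect_cmult)
next
  case (add f g)
  then show ?case using expansions_add by (simp add: expect_add)
next
  case (cong f g)
  have "expect n d g = expect n d f" for n d by (rule expect_cong) (simp add: cong is_strict_strict_sets)
  then show ?case using cong by simp
qed

text \<open>Induction on the degree: the source has the same weight and smaller degree, and the
  homogeneous term fits the weight by \<open>excess_wt\<close>.\<close>

lemma expect_qmonomial_expansions: "positive_list \<rho> \<Longrightarrow> (\<lambda>n d. expect n d (qmonomial \<rho>)) \<in> expansions (2 * sum_list \<rho>) (qdegree \<rho>)"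
proof (induction "qdegree \<rho>" arbitrary: \<rho> rule: less_induct)
  case less
  show ?case
  proof (cases "\<rho> = []")
    case True
    have "qmonomial [] = (\<lambda>_. 1)" by (rule ext) simp
    then have "expect n d (qmonomial \<rho>) = 1 * falling n 0 / real d ^ 0" if "0 < d" for n d
      using expect_1[OF that] True by simp
    then show ?thesis by (rule expansions_cong[OF expansions_monomial, rotated 2]) auto
  next
    case False
    note b = positive_list_bounds[OF less.prems False]
    let ?k = "qdegree \<rho>"
    define g where "g S = generator (qmonomial \<rho>) S - real ?k * qmonomial \<rho> S" for S
    have gQ: "g \<in> observables (sum_list \<rho>) (?k - 1)" unfolding g_def by (rule generator_qmonomial[OF less.prems])
    show ?thesis
    proof (rule expansions_invert[where H="\<lambda>n d. expect n d g" and A="\<lambda>d. lead \<rho> / real d ^ excess \<rho>"])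
      show "1 \<le> ?k" using b by simp
      show "(\<lambda>n d. expect n d g) \<in> expansions (2 * sum_list \<rho>) (?k - 1)"
        by (rule expect_observables_from_monomials[OF gQ]) (use less.hyps b in auto)
      show "(real n + 1) * (expect (Suc n) d (qmonomial \<rho>) - expect n d (qmonomial \<rho>)) - real ?k * expect (Suc n) d (qmonomial \<rho>) = expect (Suc n) d g"
        if d: "0 < d" for n d
        unfolding g_def expect_diff expect_cmult expect_generator[OF d] ..
      show "(\<lambda>n. expect n d (qmonomial \<rho>) / real n ^ ?k) \<longlonglongrightarrow> lead \<rho> / real d ^ excess \<rho>" if "0 < d" for d
        by (rule expect_qmonomial_fixed_d[OF that less.prems])
      have "(\<lambda>n d. lead \<rho> * falling n ?k / real d ^ excess \<rho>) \<in> expansions (2 * sum_list \<rho>) ?k"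
        by (rule expansions_monomial) (use excess_wt[OF less.prems] in auto)
      then show "(\<lambda>n d. lead \<rho> / real d ^ excess \<rho> * falling n ?k) \<in> expansions (2 * sum_list \<rho>) ?k" by simp
    qed
  qed
qed

lemma expect_expansions: "f \<in> observables w k \<Longrightarrow> (\<lambda>n d. expect n d f) \<in> expansions (2 * w) k"
  by (rule expect_observables_from_monomials) (auto intro: expect_qmonomial_expansions)

section \<open>Covariances of observables\<close>

definition cov :: "(nat set \<Rightarrow> real) \<Rightarrow> (nat set \<Rightarrow> real) \<Rightarrow> nat \<Rightarrow> nat \<Rightarrow> real" where
  "cov f g n d = expect n d (\<lambda>S. f S * g S) - expect n d f * expect n d g"

lemma cov_commute: "cov f g n d = cov g f n d"
  by (simp add: cov_def mult.commute)

lemma cov_add: "cov f (\<lambda>S. g S + h S) n d = cov f g n d + cov f h n d"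
  by (simp add: cov_def distrib_left expect_add)

lemma cov_cmult: "cov f (\<lambda>S. c * g S) n d = c * cov f g n d"
proof -
  have "(\<lambda>S. f S * (c * g S)) = (\<lambda>S. c * (f S * g S))" by (simp add: mult_ac)
  then show ?thesis by (simp add: cov_def expect_cmult algebra_simps)
qed

lemma cov_cong: "(\<And>S. is_strict S \<Longrightarrow> g S = h S) \<Longrightarrow> cov f g n d = cov f h n d"
  unfolding cov_def by (metis (mono_tags, lifting) expect_cong is_strict_strict_sets)

lemma cov_zero: "cov f (\<lambda>_. 0) n d = 0"
  by (simp add: cov_def expect_def)

lemma cov_observables_from_monomials:
  assumes g: "g \<in> observables w k"
    and mon: "\<And>\<sigma>. positive_list \<sigma> \<Longrightarrow> sum_list \<sigma> \<le> w \<Longrightarrow> qdegree \<sigma> \<le> k \<Longrightarrow> cov f (qmonomial \<sigma>) \<in> expansions W K"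
  shows "cov f g \<in> expansions W K"
  using g
proof (induction rule: observables_induct)
  case zero
  show ?case by (rule expansions_zero) (simp add: cov_zero)
next
  case (monomial \<rho> c)
  show ?case by (rule expansions_cong[OF expansions_cmult[OF mon[OF monomial]] cov_cmult])
next
  case (add g h)
  show ?case by (rule expansions_cong[OF expansions_add[OF add] cov_add])
next
  case (cong g h)
  show ?case by (rule expansions_cong[OF cong(1)]) (rule cov_cong[OF cong(2)])
qed

text \<open>The last summand is the discrete correction that appears when the product of two
  expectations is differenced.\<close>

lemma cov_Suc:
  assumes d: "0 < d"
  shows "(real n + 1) * (cov f g (Suc n) d - cov f g n d)
    = cov f (generator g) (Suc n) d + cov g (generator f) (Suc n) d - expect (Suc n) d (carre_du_champ f g)
      + (real n + 1) * (expect (Suc n) d f - expect n d f) * (expect (Suc n) d g - expect n d g)"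
proof -
  have "(real n + 1) * (expect (Suc n) d (\<lambda>S. f S * g S) - expect n d (\<lambda>S. f S * g S))
      = expect (Suc n) d (\<lambda>S. f S * generator g S + g S * generator f S - carre_du_champ f g S)"
    unfolding expect_generator[OF d, symmetric] generator_mult[abs_def] ..
  also have "\<dots> = expect (Suc n) d (\<lambda>S. f S * generator g S) + expect (Suc n) d (\<lambda>S. g S * generator f S) - expect (Suc n) d (carre_du_champ f g)"
    unfolding expect_diff expect_add ..
  finally show ?thesis unfolding cov_def expect_generator[OF d] by (simp add: algebra_simps)
qed

text \<open>Induction on the total degree. Covariances with the remainders of smaller degree are
  covered by the induction hypothesis, the carre du champ and the product of increments have lower
  weight by themselves, and the homogeneous coefficient is 0.\<close>

lemma cov_qmonomial_expansions:
  "positive_list \<rho> \<Longrightarrow> positive_list \<sigma> \<Longrightarrow> cov (qmonomial \<rho>) (qmonomial \<sigma>) \<in> expansions (2 * (sum_list \<rho> + sum_list \<sigma>) - 1) (qdegree \<rho> + qdegree \<sigma>)"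
proof (induction "qdegree \<rho> + qdegree \<sigma>" arbitrary: \<rho> \<sigma> rule: less_induct)
  case less
  have triv: "cov f (\<lambda>_. 1) n d = 0" if "0 < d" for f n d
    using expect_1[OF that] by (simp add: cov_def)
  have e1: "qmonomial [] = (\<lambda>_. 1)" by (rule ext) simp
  show ?case
  proof (cases "\<rho> = [] \<or> \<sigma> = []")
    case True
    then show ?thesis
    proof
      assume "\<sigma> = []"
      then show ?thesis by (intro expansions_zero) (simp only: e1 triv)
    next
      assume "\<rho> = []"
      then show ?thesis by (intro expansions_zero) (simp only: e1 cov_commute[of "\<lambda>_. 1"] triv)
    qed
  next
    case False
    then have ne: "\<rho> \<noteq> []" "\<sigma> \<noteq> []" by auto
    note b = positive_list_bounds[OF less.prems(1) ne(1)] positive_list_bounds[OF less.prems(2) ne(2)]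
    let ?f = "qmonomial \<rho>" and ?g = "qmonomial \<sigma>"
    let ?W = "2 * (sum_list \<rho> + sum_list \<sigma>) - 1" and ?k = "qdegree \<rho> + qdegree \<sigma>"
    define f1 where "f1 S = generator ?f S - real (qdegree \<rho>) * ?f S" for S
    define g1 where "g1 S = generator ?g S - real (qdegree \<sigma>) * ?g S" for S
    have f1: "f1 \<in> observables (sum_list \<rho>) (qdegree \<rho> - 1)" unfolding f1_def by (rule generator_qmonomial[OF less.prems(1)])
    have g1: "g1 \<in> observables (sum_list \<sigma>) (qdegree \<sigma> - 1)" unfolding g1_def by (rule generator_qmonomial[OF less.prems(2)])
    have 1: "cov ?f g1 \<in> expansions ?W (?k - 1)"
    proof (rule cov_observables_from_monomials[OF g1])
      fix \<tau> assume t: "positive_list \<tau>" "sum_list \<tau> \<le> sum_list \<sigma>" "qdegree \<tau> \<le> qdegree \<sigma> - 1"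
      have "cov ?f (qmonomial \<tau>) \<in> expansions (2 * (sum_list \<rho> + sum_list \<tau>) - 1) (qdegree \<rho> + qdegree \<tau>)"
        by (rule less.hyps) (use t b less.prems in auto)
      then show "cov ?f (qmonomial \<tau>) \<in> expansions ?W (?k - 1)" by (rule expansions_mono) (use t b in auto)
    qed
    have 2: "cov ?g f1 \<in> expansions ?W (?k - 1)"
    proof (rule cov_observables_from_monomials[OF f1])
      fix \<tau> assume t: "positive_list \<tau>" "sum_list \<tau> \<le> sum_list \<rho>" "qdegree \<tau> \<le> qdegree \<rho> - 1"
      have "cov ?g (qmonomial \<tau>) \<in> expansions (2 * (sum_list \<sigma> + sum_list \<tau>) - 1) (qdegree \<sigma> + qdegree \<tau>)"
        by (rule less.hyps) (use t b less.prems in auto)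
      then show "cov ?g (qmonomial \<tau>) \<in> expansions ?W (?k - 1)" by (rule expansions_mono) (use t b in auto)
    qed
    have 3: "(\<lambda>n d. expect n d (carre_du_champ ?f ?g)) \<in> expansions ?W (?k - 1)"
      by (rule expansions_mono[OF expect_expansions[OF carre_du_champ_observables[OF less.prems ne]]]) (use b in auto)
    obtain K where K: "K \<in> expansions (2 * sum_list \<rho> + 2 * sum_list \<sigma> - 2) (?k - 1)"
      "\<And>n d. 0 < d \<Longrightarrow> (real n + 1) * (expect (Suc n) d ?f - expect n d ?f) * (expect (Suc n) d ?g - expect n d ?g) = K (Suc n) d"
      using expansions_nabla_prod[OF expect_qmonomial_expansions[OF less.prems(1)] expect_qmonomial_expansions[OF less.prems(2)]] by blast
    have 4: "K \<in> expansions ?W (?k - 1)" by (rule expansions_mono[OF K(1)]) auto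
    show ?thesis
    proof (rule expansions_invert[where A="\<lambda>_. 0"])
      show "1 \<le> ?k" using b by simp
      show "(\<lambda>n d. (cov ?f g1 n d + cov ?g f1 n d) - expect n d (carre_du_champ ?f ?g) + K n d) \<in> expansions ?W (?k - 1)"
        by (rule expansions_add[OF expansions_diff[OF expansions_add[OF 1 2] 3] 4])
      show "(\<lambda>n d. 0 * falling n ?k) \<in> expansions ?W ?k" by (rule expansions_zero) simp
      show "(real n + 1) * (cov ?f ?g (Suc n) d - cov ?f ?g n d) - real ?k * cov ?f ?g (Suc n) d
        = (cov ?f g1 (Suc n) d + cov ?g f1 (Suc n) d) - expect (Suc n) d (carre_du_champ ?f ?g) + K (Suc n) d" if d: "0 < d" for n d
      proof -
        have "cov ?f (generator ?g) (Suc n) d = cov ?f (\<lambda>S. real (qdegree \<sigma>) * ?g S + g1 S) (Suc n) d" by (simp add: g1_def)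
        then have c1: "cov ?f (generator ?g) (Suc n) d = real (qdegree \<sigma>) * cov ?f ?g (Suc n) d + cov ?f g1 (Suc n) d"
          unfolding cov_add cov_cmult .
        have "cov ?g (generator ?f) (Suc n) d = cov ?g (\<lambda>S. real (qdegree \<rho>) * ?f S + f1 S) (Suc n) d" by (simp add: f1_def)
        then have c2: "cov ?g (generator ?f) (Suc n) d = real (qdegree \<rho>) * cov ?f ?g (Suc n) d + cov ?g f1 (Suc n) d"
          unfolding cov_add cov_cmult cov_commute[of ?g ?f] .
        show ?thesis unfolding cov_Suc[OF d] c1 c2 K(2)[OF d] by (simp add: algebra_simps)
      qed
      \<comment> \<open>\<open>lead\<close> is multiplicative and \<open>excess\<close> additive
        under concatenation, so the limits of the two parts of the covariance coincide.\<close>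
      show "(\<lambda>n. cov ?f ?g n d / real n ^ ?k) \<longlonglongrightarrow> 0" if d: "0 < d" for d
      proof -
        have p: "positive_list (\<rho> @ \<sigma>)" using less.prems by simp
        have "(\<lambda>n. expect n d (qmonomial (\<rho> @ \<sigma>)) / real n ^ qdegree (\<rho> @ \<sigma>)
            - (expect n d ?f / real n ^ qdegree \<rho>) * (expect n d ?g / real n ^ qdegree \<sigma>))
          \<longlonglongrightarrow> lead (\<rho> @ \<sigma>) / real d ^ excess (\<rho> @ \<sigma>) - (lead \<rho> / real d ^ excess \<rho>) * (lead \<sigma> / real d ^ excess \<sigma>)"
          by (intro tendsto_diff tendsto_mult expect_qmonomial_fixed_d d p less.prems)
        moreover have "qmonomial (\<rho> @ \<sigma>) = (\<lambda>S. ?f S * ?g S)" by (rule ext) simp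
        ultimately show ?thesis by (simp add: cov_def power_add diff_divide_distrib)
      qed
    qed
  qed
qed

lemma cov_expansions:
  assumes f: "f \<in> observables w k" and g: "g \<in> observables w' k'"
  shows "cov f g \<in> expansions (2 * (w + w') - 1) (k + k')"
proof (rule cov_observables_from_monomials[OF g])
  fix \<sigma> assume s: "positive_list \<sigma>" "sum_list \<sigma> \<le> w'" "qdegree \<sigma> \<le> k'"
  have "cov (qmonomial \<sigma>) f \<in> expansions (2 * (w + w') - 1) (k + k')"
  proof (rule cov_observables_from_monomials[OF f])
    fix \<rho> assume r: "positive_list \<rho>" "sum_list \<rho> \<le> w" "qdegree \<rho> \<le> k"
    show "cov (qmonomial \<sigma>) (qmonomial \<rho>) \<in> expansions (2 * (w + w') - 1) (k + k')"
      by (rule expansions_mono[OF cov_qmonomial_expansions[OF s(1) r(1)]]) (use s r in auto)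
  qed
  then show "cov f (qmonomial \<sigma>) \<in> expansions (2 * (w + w') - 1) (k + k')"
    by (rule expansions_cong) (rule cov_commute)
qed

section \<open>Convergence in probability along the ratio filter\<close>

text \<open>Convergence along this filter makes each limit a function of c alone; any admissible
  sequence is recovered by \<open>ratio_filter_seq\<close>.\<close>

definition ratio_filter :: "real \<Rightarrow> (nat \<times> nat) filter" where
  "ratio_filter c = inf (filtercomap fst sequentially)
     (inf (filtercomap (\<lambda>p. sqrt (real (fst p)) / real (snd p)) (nhds c)) (principal {p. 0 < snd p}))"

lemma ratio_filter_fst: "filterlim fst sequentially (ratio_filter c)"
  unfolding ratio_filter_def by (rule filterlim_mono[OF filterlim_filtercomap order_refl inf_le1])

lemma ratio_filter_ratio: "((\<lambda>p. sqrt (real (fst p)) / real (snd p)) \<longlongrightarrow> c) (ratio_filter c)"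
  unfolding ratio_filter_def
  by (rule filterlim_mono[OF filterlim_filtercomap order_refl order_trans[OF inf_le2 inf_le1]])

lemma ratio_filter_pos: "eventually (\<lambda>p. 0 < snd p) (ratio_filter c)"
proof -
  have "ratio_filter c \<le> principal {p. 0 < snd p}" unfolding ratio_filter_def by (meson inf_le2 order_trans)
  then show ?thesis by (metis (mono_tags, lifting) eventually_principal filter_leD mem_Collect_eq)
qed

lemma ratio_filter_eventually: "eventually P sequentially \<Longrightarrow> eventually (\<lambda>p. P (fst p)) (ratio_filter c)"
  using ratio_filter_fst unfolding filterlim_iff by blast

lemma ratio_filter_seq:
  assumes "\<And>n. 0 < d n" "(\<lambda>n. sqrt (real n) / real (d n)) \<longlonglongrightarrow> c"
  shows "filterlim (\<lambda>n. (n, d n)) (ratio_filter c) sequentially"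
  unfolding ratio_filter_def filterlim_inf filterlim_filtercomap_iff filterlim_principal
  using assms by (simp add: comp_def filterlim_ident)

lemma inverse_sqrt_tendsto: "((\<lambda>p. 1 / sqrt (real (fst p))) \<longlongrightarrow> 0) (ratio_filter c)"
proof -
  have "(\<lambda>n. 1 / sqrt (real n)) \<longlonglongrightarrow> 0"
    by (rule real_tendsto_divide_at_top[OF tendsto_const filterlim_compose[OF sqrt_at_top filterlim_real_sequentially]])
  then show ?thesis by (rule filterlim_compose[OF _ ratio_filter_fst])
qed

text \<open>Each term splits into \<open>falling n j / n ^ j\<close>, a power of sqrt n / d, and 1 /
  sqrt n to the exponent w + b - 2 j, which the defining condition makes nonnegative.\<close>

lemma expansions_limit:
  assumes "F \<in> expansions w k"
  shows "\<exists>l. ((\<lambda>p. F (fst p) (snd p) / sqrt (real (fst p)) ^ w) \<longlongrightarrow> l) (ratio_filter c)"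
  using assms
proof (induction rule: expansions.induct)
  case (expansions_zero F)
  have "((\<lambda>p. F (fst p) (snd p) / sqrt (real (fst p)) ^ w) \<longlongrightarrow> 0) (ratio_filter c)"
    by (rule tendsto_eventually) (use ratio_filter_pos in \<open>rule eventually_mono, simp add: expansions_zero\<close>)
  then show ?case by blast
next
  case (expansions_step F j b H a)
  then obtain l where l: "((\<lambda>p. F (fst p) (snd p) / sqrt (real (fst p)) ^ w) \<longlongrightarrow> l) (ratio_filter c)" by blast
  let ?f = "\<lambda>p. a * (falling (fst p) j / real (fst p) ^ j) * (sqrt (real (fst p)) / real (snd p)) ^ b
      * (1 / sqrt (real (fst p))) ^ (w + b - 2 * j) + F (fst p) (snd p) / sqrt (real (fst p)) ^ w"
  have "(?f \<longlongrightarrow> a * 1 * c ^ b * 0 ^ (w + b - 2 * j) + l) (ratio_filter c)"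
    by (intro tendsto_add tendsto_mult tendsto_power tendsto_const l ratio_filter_ratio inverse_sqrt_tendsto
        filterlim_compose[OF falling_over_power ratio_filter_fst])
  moreover have "eventually (\<lambda>p. ?f p = H (fst p) (snd p) / sqrt (real (fst p)) ^ w) (ratio_filter c)"
    using ratio_filter_pos ratio_filter_eventually[OF eventually_gt_at_top[of 0]]
  proof eventually_elim
    case (elim p)
    define s where "s = sqrt (real (fst p))"
    have s: "0 < s" "real (fst p) = s ^ 2" using elim by (auto simp: s_def)
    have "s ^ w * s ^ b = s ^ (2 * j) * s ^ (w + b - 2 * j)"
      using expansions_step.hyps(3) by (simp add: power_add[symmetric])
    then have e: "(1 / s ^ (2 * j)) * s ^ b * (1 / s) ^ (w + b - 2 * j) = 1 / s ^ w"
      using s by (simp add: field_simps power_divide)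
    have "a * (falling (fst p) j / (s ^ 2) ^ j) * (s / real (snd p)) ^ b * (1 / s) ^ (w + b - 2 * j)
      = a * falling (fst p) j / real (snd p) ^ b * ((1 / s ^ (2 * j)) * s ^ b * (1 / s) ^ (w + b - 2 * j))"
      by (simp add: power_divide power_mult)
    also have "\<dots> = a * falling (fst p) j / real (snd p) ^ b / s ^ w" unfolding e by simp
    finally show ?case
      unfolding expansions_step.hyps(4)[OF elim(1)] s_def[symmetric] unfolding s(2) by (simp only: add_divide_distrib)
  qed
  ultimately have "((\<lambda>p. H (fst p) (snd p) / sqrt (real (fst p)) ^ w) \<longlongrightarrow> a * 1 * c ^ b * 0 ^ (w + b - 2 * j) + l) (ratio_filter c)"
    by (rule Lim_transform_eventually)
  then show ?case by blast
qed

definition small :: "real \<Rightarrow> (nat \<Rightarrow> nat set \<Rightarrow> bool) \<Rightarrow> bool" where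
  "small c B \<longleftrightarrow> ((\<lambda>p. expect (fst p) (snd p) (\<lambda>S. of_bool (B (fst p) S))) \<longlongrightarrow> 0) (ratio_filter c)"

lemma small_union:
  assumes "small c B1" "small c B2"
    and imp: "eventually (\<lambda>n. \<forall>S\<in>strict_sets n. B n S \<longrightarrow> B1 n S \<or> B2 n S) sequentially"
  shows "small c B"
  unfolding small_def
proof (rule tendsto_sandwich[OF _ _ tendsto_const])
  show "((\<lambda>p. expect (fst p) (snd p) (\<lambda>S. of_bool (B1 (fst p) S)) + expect (fst p) (snd p) (\<lambda>S. of_bool (B2 (fst p) S))) \<longlongrightarrow> 0) (ratio_filter c)"
    using tendsto_add[OF assms(1,2)[unfolded small_def]] by simp
  show "\<forall>\<^sub>F p in ratio_filter c. 0 \<le> expect (fst p) (snd p) (\<lambda>S. of_bool (B (fst p) S))"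
    by (intro always_eventually allI expect_nonneg) simp
  show "\<forall>\<^sub>F p in ratio_filter c. expect (fst p) (snd p) (\<lambda>S. of_bool (B (fst p) S))
     \<le> expect (fst p) (snd p) (\<lambda>S. of_bool (B1 (fst p) S)) + expect (fst p) (snd p) (\<lambda>S. of_bool (B2 (fst p) S))"
    using ratio_filter_eventually[OF imp]
  proof eventually_elim
    case (elim p)
    show ?case unfolding expect_add[symmetric] by (rule expect_mono) (use elim in auto)
  qed
qed

lemma small_False: "small c (\<lambda>_ _. False)"
  by (simp add: small_def expect_def)

lemma small_mono: "small c B1 \<Longrightarrow> eventually (\<lambda>n. \<forall>S\<in>strict_sets n. B n S \<longrightarrow> B1 n S) sequentially \<Longrightarrow> small c B"
  by (rule small_union[OF _ small_False]) simp_all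

lemma small_finite_union:
  assumes "finite I" "\<And>i. i \<in> I \<Longrightarrow> small c (B i)"
  shows "small c (\<lambda>n S. \<exists>i\<in>I. B i n S)"
  using assms
proof (induction I rule: finite_induct)
  case empty
  then show ?case using small_False by simp
next
  case (insert i I)
  show ?case by (rule small_union[of c "B i" "\<lambda>n S. \<exists>i\<in>I. B i n S"]) (use insert in auto)
qed

lemma not_small_True: assumes "ratio_filter c \<noteq> bot" shows "\<not> small c (\<lambda>_ _. True)"
proof
  assume "small c (\<lambda>_ _. True)"
  then have "((\<lambda>p. expect (fst p) (snd p) (\<lambda>S. 1)) \<longlongrightarrow> 0) (ratio_filter c)" by (simp add: small_def)
  moreover have "((\<lambda>p. expect (fst p) (snd p) (\<lambda>S. 1)) \<longlongrightarrow> 1) (ratio_filter c)"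
    by (rule tendsto_eventually) (use ratio_filter_pos in \<open>rule eventually_mono, simp add: expect_1\<close>)
  ultimately show False using tendsto_unique[OF assms] by fastforce
qed

lemma small_bot: "ratio_filter c = bot \<Longrightarrow> small c B"
  by (simp add: small_def)

definition conv_prob :: "real \<Rightarrow> (nat \<Rightarrow> nat set \<Rightarrow> real) \<Rightarrow> real \<Rightarrow> bool" where
  "conv_prob c X a \<longleftrightarrow> (\<forall>\<epsilon>>0. small c (\<lambda>n S. \<epsilon> < \<bar>X n S - a\<bar>))"

lemma conv_prob_add:
  assumes "conv_prob c X a" "conv_prob c Y b"
  shows "conv_prob c (\<lambda>n S. X n S + Y n S) (a + b)"
  unfolding conv_prob_def
proof (intro allI impI)
  fix \<epsilon> :: real assume "0 < \<epsilon>"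
  then have "small c (\<lambda>n S. \<epsilon> / 2 < \<bar>X n S - a\<bar>)" "small c (\<lambda>n S. \<epsilon> / 2 < \<bar>Y n S - b\<bar>)"
    using assms unfolding conv_prob_def by (metis half_gt_zero)+
  then show "small c (\<lambda>n S. \<epsilon> < \<bar>X n S + Y n S - (a + b)\<bar>)"
    by (rule small_union) (intro always_eventually allI ballI impI, linarith)
qed

lemma conv_prob_cmult:
  assumes "conv_prob c X a"
  shows "conv_prob c (\<lambda>n S. u * X n S) (u * a)"
proof (cases "u = 0")
  case True
  then show ?thesis using small_False by (simp add: conv_prob_def order_less_not_sym)
next
  case False
  show ?thesis unfolding conv_prob_def
  proof (intro allI impI)
    fix \<epsilon> :: real assume "0 < \<epsilon>"
    then have "0 < \<epsilon> / \<bar>u\<bar>" using False by simp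
    then have "small c (\<lambda>n S. \<epsilon> / \<bar>u\<bar> < \<bar>X n S - a\<bar>)" using assms unfolding conv_prob_def by blast
    moreover have "\<epsilon> / \<bar>u\<bar> < \<bar>x - a\<bar> \<longleftrightarrow> \<epsilon> < \<bar>u * x - u * a\<bar>" for x
    proof -
      have "\<bar>u * x - u * a\<bar> = \<bar>x - a\<bar> * \<bar>u\<bar>"
        unfolding right_diff_distrib[symmetric] abs_mult by (rule mult.commute)
      then show ?thesis using False by (simp add: pos_divide_less_eq)
    qed
    ultimately show "small c (\<lambda>n S. \<epsilon> < \<bar>u * X n S - u * a\<bar>)" by simp
  qed
qed

lemma conv_prob_zero: "conv_prob c (\<lambda>_ _. 0) 0"
  using small_False by (simp add: conv_prob_def order_less_not_sym)

lemma conv_prob_sum: "(\<And>i. i \<in> I \<Longrightarrow> conv_prob c (X i) (a i)) \<Longrightarrow> conv_prob c (\<lambda>n S. \<Sum>i\<in>I. X i n S) (\<Sum>i\<in>I. a i)"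
  by (induction I rule: infinite_finite_induct) (auto intro: conv_prob_add conv_prob_zero)

text \<open>Completeness: constants belonging to two tolerances differ by at most the sum of the
  tolerances, since otherwise the whole space would be small. Hence they form a Cauchy
  sequence.\<close>

lemma conv_prob_approx:
  assumes "\<And>\<epsilon>. 0 < \<epsilon> \<Longrightarrow> \<exists>a. small c (\<lambda>n S. \<epsilon> < \<bar>X n S - a\<bar>)"
  shows "\<exists>a. conv_prob c X a"
proof (cases "ratio_filter c = bot")
  case True
  then show ?thesis using small_bot by (simp add: conv_prob_def)
next
  case False
  define e where "e i = 1 / real (Suc i)" for i
  have e: "0 < e i" for i by (simp add: e_def)
  have "\<exists>a. \<forall>i. small c (\<lambda>n S. e i < \<bar>X n S - a i\<bar>)" using assms[OF e] by metis
  then obtain a where a: "\<And>i. small c (\<lambda>n S. e i < \<bar>X n S - a i\<bar>)" by blast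
  have close: "\<bar>a i - a j\<bar> \<le> e i + e j" for i j
  proof (rule ccontr)
    assume "\<not> \<bar>a i - a j\<bar> \<le> e i + e j"
    then have "e i < \<bar>x - a i\<bar> \<or> e j < \<bar>x - a j\<bar>" for x by linarith
    then have "small c (\<lambda>_ _. True)" by (intro small_union[OF a[of i] a[of j]]) auto
    then show False using not_small_True[OF False] by blast
  qed
  have e0: "e \<longlonglongrightarrow> 0" unfolding e_def by (rule LIMSEQ_Suc[OF lim_1_over_n])
  have "Cauchy a"
  proof (rule metric_CauchyI)
    fix \<epsilon> :: real assume "0 < \<epsilon>"
    then have "eventually (\<lambda>i. e i < \<epsilon> / 2) sequentially" using order_tendstoD(2)[OF e0, of "\<epsilon> / 2"] by simp
    then obtain M where M: "\<And>i. M \<le> i \<Longrightarrow> e i < \<epsilon> / 2" unfolding eventually_sequentially by blast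
    show "\<exists>M. \<forall>m\<ge>M. \<forall>n\<ge>M. dist (a m) (a n) < \<epsilon>"
    proof (intro exI allI impI)
      fix m n assume "M \<le> m" "M \<le> n"
      then show "dist (a m) (a n) < \<epsilon>" using close[of m n] M[of m] M[of n] by (simp add: dist_real_def)
    qed
  qed
  then obtain L where L: "a \<longlonglongrightarrow> L" using convergent_eq_Cauchy[of a] by (auto simp: convergent_def)
  have "conv_prob c X L"
    unfolding conv_prob_def
  proof (intro allI impI)
    fix \<epsilon> :: real assume \<epsilon>: "0 < \<epsilon>"
    have "eventually (\<lambda>i. e i < \<epsilon> / 2) sequentially" using order_tendstoD(2)[OF e0, of "\<epsilon> / 2"] \<epsilon> by simp
    moreover have "eventually (\<lambda>i. dist (a i) L < \<epsilon> / 2) sequentially" using tendstoD[OF L, of "\<epsilon> / 2"] \<epsilon> by simp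
    ultimately have "eventually (\<lambda>i. e i < \<epsilon> / 2 \<and> dist (a i) L < \<epsilon> / 2) sequentially" by (rule eventually_conj)
    then obtain i where i: "e i < \<epsilon> / 2" "\<bar>a i - L\<bar> < \<epsilon> / 2"
      unfolding eventually_sequentially dist_real_def by blast
    show "small c (\<lambda>n S. \<epsilon> < \<bar>X n S - L\<bar>)"
      by (rule small_mono[OF a[of i]]) (use i in \<open>intro always_eventually allI ballI impI, linarith\<close>)
  qed
  then show ?thesis by blast
qed

section \<open>Odd power sums, their concentration, and the size of the largest part\<close>

definition power_sum_odd :: "nat \<Rightarrow> nat set \<Rightarrow> real" where
  "power_sum_odd r S = (\<Sum>j\<in>S. real j ^ (2 * r - 1))"

lemma qsum_expand:
  "qsum r S = (\<Sum>s\<le>r. real (r choose s) * (1 - (-1) ^ s) * (\<Sum>j\<in>S. real j ^ (2 * r - s)))"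
proof -
  have e: "(x + 1) ^ r - (x - 1) ^ r = (\<Sum>s\<le>r. real (r choose s) * (1 - (-1) ^ s) * x ^ (r - s))" for x :: real
    using binomial_ring[of 1 x r] binomial_ring[of "-1" x r]
    by (simp add: add.commute algebra_simps sum_subtractf)
  have "qsum r S = (\<Sum>j\<in>S. \<Sum>s\<le>r. real (r choose s) * (1 - (-1) ^ s) * real j ^ (2 * r - s))"
    unfolding qsum_def
  proof (rule sum.cong[OF refl])
    fix j
    have "real j ^ r * (\<Sum>s\<le>r. real (r choose s) * (1 - (-1) ^ s) * real j ^ (r - s))
        = (\<Sum>s\<le>r. real (r choose s) * (1 - (-1) ^ s) * (real j ^ r * real j ^ (r - s)))"
      by (simp add: sum_distrib_left mult_ac)
    also have "\<dots> = (\<Sum>s\<le>r. real (r choose s) * (1 - (-1) ^ s) * real j ^ (2 * r - s))"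
      by (rule sum.cong) (simp_all add: power_add[symmetric] mult_2)
    finally show "(real j * (real j + 1)) ^ r - ybox j ^ r = (\<Sum>s\<le>r. real (r choose s) * (1 - (-1) ^ s) * real j ^ (2 * r - s))"
      unfolding qsum_term e .
  qed
  also have "\<dots> = (\<Sum>s\<le>r. real (r choose s) * (1 - (-1) ^ s) * (\<Sum>j\<in>S. real j ^ (2 * r - s)))"
    by (subst sum.swap) (simp add: sum_distrib_left)
  finally show ?thesis .
qed

text \<open>In \<open>qsum_expand\<close> only odd s survive, so \<open>qsum r\<close> is 2 r times
  the r-th odd power sum plus earlier ones, a triangular system.\<close>

lemma power_sum_odd_observables: "1 \<le> r \<Longrightarrow> power_sum_odd r \<in> observables r (2 * r - 1)"
proof (induction r rule: less_induct)
  case (less r)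
  let ?t = "\<lambda>s S. real (r choose s) * (1 - (-1) ^ s) * (\<Sum>j\<in>S. real j ^ (2 * r - s))"
  have low: "?t s \<in> observables r (2 * r - 1)" if s: "s \<in> {2..r}" for s
  proof (cases "even s")
    case True
    then show ?thesis by (intro observables_zero) simp
  next
    case False
    then obtain i where i: "s = 2 * i + 1" by (elim oddE)
    have ri: "1 \<le> r - i" "r - i < r" "2 * r - s = 2 * (r - i) - 1" using i s by auto
    have "power_sum_odd (r - i) \<in> observables r (2 * r - 1)"
      by (rule observables_mono[OF less.IH[OF ri(2,1)]]) auto
    then show ?thesis unfolding ri(3) power_sum_odd_def[symmetric] by (rule observables_cmult)
  qed
  have set: "{..r} = insert 0 (insert 1 {2..r})" using less.prems by auto
  have e: "qsum r S = 2 * real r * power_sum_odd r S + (\<Sum>s\<in>{2..r}. ?t s S)" for S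
    unfolding qsum_expand set by (simp add: power_sum_odd_def)
  have "(\<lambda>S. 1 / (2 * real r) * (qsum r S - (\<Sum>s\<in>{2..r}. ?t s S))) \<in> observables r (2 * r - 1)"
    by (rule observables_cmult, rule observables_diff[OF observables_qsum[OF less.prems]], rule observables_sum, rule low)
  then show ?case by (rule observables_cong) (use less.prems in \<open>simp add: e\<close>)
qed

text \<open>Chebyshev's inequality: the variance is of order at most
  \<open>sqrt n ^ (4 r - 1)\<close>, against the squared scale
  \<open>sqrt n ^ (4 r)\<close>.\<close>

lemma moment_conv_prob:
  assumes r: "1 \<le> r"
  shows "\<exists>a. conv_prob c (\<lambda>n S. power_sum_odd r S / real n ^ r) a"
proof -
  note Q = power_sum_odd_observables[OF r]
  obtain a where a: "((\<lambda>p. expect (fst p) (snd p) (power_sum_odd r) / sqrt (real (fst p)) ^ (2 * r)) \<longlongrightarrow> a) (ratio_filter c)"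
    using expansions_limit[OF expect_expansions[OF Q]] by blast
  obtain l where "((\<lambda>p. cov (power_sum_odd r) (power_sum_odd r) (fst p) (snd p) / sqrt (real (fst p)) ^ (2 * (r + r) - 1)) \<longlongrightarrow> l) (ratio_filter c)"
    using expansions_limit[OF cov_expansions[OF Q Q]] by blast
  then have v: "((\<lambda>p. cov (power_sum_odd r) (power_sum_odd r) (fst p) (snd p) / sqrt (real (fst p)) ^ (2 * (r + r) - 1) * (1 / sqrt (real (fst p)))) \<longlongrightarrow> l * 0) (ratio_filter c)"
    by (intro tendsto_mult inverse_sqrt_tendsto)
  have "conv_prob c (\<lambda>n S. power_sum_odd r S / real n ^ r) a"
    unfolding conv_prob_def small_def
  proof (intro allI impI)
    fix \<epsilon> :: real assume \<epsilon>: "0 < \<epsilon>"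
    \<comment> \<open>One half of \<epsilon> is reserved for the distance of the mean from its
      limit, hence 2 / \<epsilon> instead of 1 / \<epsilon>.\<close>
    let ?v = "\<lambda>p. (2 / \<epsilon>)\<^sup>2 * (cov (power_sum_odd r) (power_sum_odd r) (fst p) (snd p) / sqrt (real (fst p)) ^ (2 * (r + r) - 1) * (1 / sqrt (real (fst p))))"
    show "((\<lambda>p. expect (fst p) (snd p) (\<lambda>S. of_bool (\<epsilon> < \<bar>power_sum_odd r S / real (fst p) ^ r - a\<bar>))) \<longlongrightarrow> 0) (ratio_filter c)"
    proof (rule tendsto_sandwich[OF _ _ tendsto_const])
      show "(?v \<longlongrightarrow> 0) (ratio_filter c)" using tendsto_mult[OF tendsto_const v] by simp
      show "\<forall>\<^sub>F p in ratio_filter c. 0 \<le> expect (fst p) (snd p) (\<lambda>S. of_bool (\<epsilon> < \<bar>power_sum_odd r S / real (fst p) ^ r - a\<bar>))"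
        by (intro always_eventually allI expect_nonneg) simp
      have "eventually (\<lambda>p. dist (expect (fst p) (snd p) (power_sum_odd r) / sqrt (real (fst p)) ^ (2 * r)) a < \<epsilon> / 2) (ratio_filter c)"
        using tendstoD[OF a, of "\<epsilon> / 2"] \<epsilon> by simp
      then show "\<forall>\<^sub>F p in ratio_filter c. expect (fst p) (snd p) (\<lambda>S. of_bool (\<epsilon> < \<bar>power_sum_odd r S / real (fst p) ^ r - a\<bar>)) \<le> ?v p"
        using ratio_filter_pos ratio_filter_eventually[OF eventually_gt_at_top[of 0]]
      proof eventually_elim
        case (elim p)
        obtain n d where p: "p = (n, d)" by (cases p)
        have d: "0 < d" and n: "0 < n" using elim p by auto
        define m where "m = expect n d (power_sum_odd r)"
        have sq: "sqrt (real n) ^ (2 * i) = real n ^ i" for i by (simp add: power_mult)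
        have ma: "\<bar>m / real n ^ r - a\<bar> < \<epsilon> / 2" using elim(1) by (simp add: p m_def dist_real_def sq)
        have "expect n d (\<lambda>S. of_bool (\<epsilon> < \<bar>power_sum_odd r S / real n ^ r - a\<bar>))
          \<le> expect n d (\<lambda>S. (2 / \<epsilon>)\<^sup>2 * (1 / real n ^ (2 * r)) * (power_sum_odd r S * power_sum_odd r S + (m\<^sup>2 * 1 + (- 2 * m) * power_sum_odd r S)))"
        proof (rule expect_mono)
          fix S
          have e: "(2 / \<epsilon>)\<^sup>2 * (1 / real n ^ (2 * r)) * (power_sum_odd r S * power_sum_odd r S + (m\<^sup>2 * 1 + (- 2 * m) * power_sum_odd r S)) = (2 / \<epsilon> * (power_sum_odd r S / real n ^ r - m / real n ^ r))\<^sup>2"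
          proof -
            have "(2 / \<epsilon> * (power_sum_odd r S / real n ^ r - m / real n ^ r))\<^sup>2 = (2 / \<epsilon>)\<^sup>2 * ((power_sum_odd r S - m)\<^sup>2 / (real n ^ r)\<^sup>2)"
              by (simp only: diff_divide_distrib[symmetric] power_mult_distrib power_divide)
            moreover have "(power_sum_odd r S - m)\<^sup>2 = power_sum_odd r S * power_sum_odd r S + (m\<^sup>2 * 1 + (- 2 * m) * power_sum_odd r S)"
              by (simp add: power2_eq_square algebra_simps)
            moreover have "(real n ^ r)\<^sup>2 = real n ^ (2 * r)" by (simp add: power_mult[symmetric] mult.commute)
            ultimately show ?thesis by simp
          qed
          show "of_bool (\<epsilon> < \<bar>power_sum_odd r S / real n ^ r - a\<bar>) \<le> (2 / \<epsilon>)\<^sup>2 * (1 / real n ^ (2 * r)) * (power_sum_odd r S * power_sum_odd r S + (m\<^sup>2 * 1 + (- 2 * m) * power_sum_odd r S))"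
          proof (cases "\<epsilon> < \<bar>power_sum_odd r S / real n ^ r - a\<bar>")
            case True
            then have "\<epsilon> / 2 < \<bar>power_sum_odd r S / real n ^ r - m / real n ^ r\<bar>" using ma by linarith
            then have "1 \<le> \<bar>2 / \<epsilon> * (power_sum_odd r S / real n ^ r - m / real n ^ r)\<bar>"
              unfolding abs_mult using \<epsilon> by (simp add: pos_le_divide_eq)
            then have "1 \<le> (2 / \<epsilon> * (power_sum_odd r S / real n ^ r - m / real n ^ r))\<^sup>2"
              by (metis one_le_power power2_abs)
            then show ?thesis unfolding e using True by simp
          next
            case False
            then show ?thesis unfolding e by simp
          qed
        qed
        also have "\<dots> = (2 / \<epsilon>)\<^sup>2 * (1 / real n ^ (2 * r)) * (expect n d (\<lambda>S. power_sum_odd r S * power_sum_odd r S) + (m\<^sup>2 + (- 2 * m) * m))"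
          unfolding expect_cmult expect_add expect_1[OF d] m_def[symmetric] by simp
        also have "\<dots> = (2 / \<epsilon>)\<^sup>2 * (cov (power_sum_odd r) (power_sum_odd r) n d / real n ^ (2 * r))"
          by (simp add: cov_def m_def[symmetric] power2_eq_square)
        also have "real n ^ (2 * r) = sqrt (real n) ^ (2 * (r + r) - 1) * sqrt (real n)"
        proof -
          have "real n ^ (2 * r) = sqrt (real n) ^ (2 * (2 * r))" by (rule sq[symmetric])
          also have "2 * (2 * r) = Suc (2 * (r + r) - 1)" using r by simp
          finally show ?thesis by (simp only: power_Suc mult.commute)
        qed
        finally show ?case by (simp add: p)
      qed
    qed
  qed
  then show ?thesis by blast
qed

lemma max_small: "\<exists>K>0. small c (\<lambda>n S. K * sqrt (real n) \<le> real (max_part S))"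
proof -
  define C where "C = \<bar>c\<bar> + 1"
  have C: "1 \<le> C" "c < C" by (auto simp: C_def)
  \<comment> \<open>The summand 2 pays for L \<le> 2 sqrt n in \<open>y - L\<close>; the rest gains
    a factor exp (- 3 L), of which exp (2 L) is lost to the generating function.\<close>
  define K where "K = 2 + 2 * C * exp 3"
  have K: "0 < K" using C by (simp add: K_def add_pos_pos)
  have "small c (\<lambda>n S. K * sqrt (real n) \<le> real (max_part S))"
    unfolding small_def
  proof (rule tendsto_sandwich[OF _ _ tendsto_const])
    show "\<forall>\<^sub>F p in ratio_filter c. 0 \<le> expect (fst p) (snd p) (\<lambda>S. of_bool (K * sqrt (real (fst p)) \<le> real (max_part S)))"
      by (intro always_eventually allI expect_nonneg) simp
    have "filterlim (\<lambda>n. sqrt (real n)) at_top sequentially"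
      by (rule filterlim_compose[OF sqrt_at_top filterlim_real_sequentially])
    then have "(\<lambda>n. exp (- sqrt (real n))) \<longlonglongrightarrow> 0"
      by (intro filterlim_compose[OF exp_at_bot] filterlim_compose[OF filterlim_uminus_at_bot_at_top])
    then show "((\<lambda>p. exp (- sqrt (real (fst p)))) \<longlongrightarrow> 0) (ratio_filter c)"
      by (rule filterlim_compose[OF _ ratio_filter_fst])
    have "eventually (\<lambda>p. sqrt (real (fst p)) / real (snd p) < C) (ratio_filter c)"
      using order_tendstoD(2)[OF ratio_filter_ratio C(2)] .
    then show "\<forall>\<^sub>F p in ratio_filter c. expect (fst p) (snd p) (\<lambda>S. of_bool (K * sqrt (real (fst p)) \<le> real (max_part S))) \<le> exp (- sqrt (real (fst p)))"
      using ratio_filter_pos ratio_filter_eventually[OF eventually_ge_at_top[of 4]]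
    proof eventually_elim
      case (elim p)
      obtain n d where p: "p = (n, d)" by (cases p)
      have d: "0 < d" and n: "4 \<le> n" and nd: "sqrt (real n) / real d < C" using elim p by auto
      define s where "s = sqrt (real n)"
      have s: "2 \<le> s" "s * s = real n" "0 < s" using n by (auto simp: s_def real_le_rsqrt)
      define L where "L = nat \<lceil>s\<rceil>"
      have L: "s \<le> real L" "real L \<le> 2 * s" using s unfolding L_def by linarith+
      have L1: "1 \<le> L" using L s by linarith
      have "2 * s \<le> s * s" using s by (intro mult_right_mono) auto
      then have Ln: "L \<le> n" using L s by linarith
      \<comment> \<open>This makes t at most 1 / 2, gives \<open>n / (t d) = 2 C s\<close>, and
        bounds ((1 + t) / (1 - t)) ^ d by exp (4 t d) = exp (2 s / C).\<close>
      define t where "t = s / (2 * C * real d)"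
      have t: "0 < t" "t \<le> 1 / 2"
      proof -
        show "0 < t" using s C d by (simp add: t_def)
        have "s \<le> C * real d" using nd d by (simp add: s_def divide_less_eq)
        then show "t \<le> 1 / 2" using C d by (simp add: t_def field_simps)
      qed
      define y where "y = K * s"
      have yL: "2 * C * exp 3 * s \<le> y - real L" using L by (simp add: y_def K_def algebra_simps)
      have cs_pos: "0 < 2 * C * exp 3 * s" using C s by simp
      have Ly: "real L \<le> y" using yL cs_pos by linarith
      define P where "P = expect n d (\<lambda>S. of_bool (y \<le> real (max_part S)))"
      have P0: "0 \<le> P" unfolding P_def by (rule expect_nonneg) simp
      have "(2 * C * exp 3 * s) ^ L * P \<le> (y - real L) ^ L * P"
        by (intro mult_right_mono power_mono P0) (use yL cs_pos in auto)
      also have "\<dots> \<le> real n ^ L * (schurP d {L} / real d ^ L)"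
        unfolding P_def by (rule prob_max_le[OF d L1 Ln Ly])
      also have "\<dots> \<le> real n ^ L * (((1 / t) ^ L * ((1 + t) / (1 - t)) ^ d) / real d ^ L)"
        by (intro mult_left_mono divide_right_mono schurP_single_le) (use t L1 in auto)
      also have "\<dots> = (real n / (t * real d)) ^ L * ((1 + t) / (1 - t)) ^ d"
        by (simp add: power_divide power_mult_distrib)
      also have "real n / (t * real d) = 2 * C * s" using s C d unfolding t_def s(2)[symmetric] by (simp add: field_simps)
      also have "(2 * C * exp 3 * s) ^ L = (2 * C * s) ^ L * exp 3 ^ L" by (simp only: power_mult_distrib mult_ac)
      finally have "(2 * C * s) ^ L * (exp 3 ^ L * P) \<le> (2 * C * s) ^ L * ((1 + t) / (1 - t)) ^ d" by (simp only: mult.assoc)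
      then have 1: "exp 3 ^ L * P \<le> ((1 + t) / (1 - t)) ^ d"
        by (rule mult_left_le_imp_le) (use C s in simp)
      have "(1 + t) / (1 - t) \<le> 1 + 4 * t"
      proof -
        have "0 \<le> t * (2 - 4 * t)" by (rule mult_nonneg_nonneg) (use t in auto)
        then show ?thesis using t by (simp add: pos_divide_le_eq algebra_simps)
      qed
      also have "\<dots> \<le> exp (4 * t)" by (rule exp_ge_add_one_self)
      finally have "((1 + t) / (1 - t)) ^ d \<le> exp (4 * t) ^ d" by (rule power_mono) (use t in auto)
      also have "exp (4 * t) ^ d = exp (real d * (4 * t))" by (rule exp_of_nat_mult[symmetric])
      also have "\<dots> \<le> exp (2 * real L)"
      proof -
        have "real d * (4 * t) = 2 * s / C" using C d by (simp add: t_def field_simps)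
        also have "\<dots> \<le> 2 * s" using C s by (simp add: divide_le_eq)
        finally show ?thesis using L by simp
      qed
      finally have "exp 3 ^ L * P \<le> exp (2 * real L)" using 1 by linarith
      also have "exp 3 ^ L = exp (3 * real L)" using exp_of_nat_mult[of L "3::real"] by (simp add: mult.commute)
      finally have "exp (- (3 * real L)) * (exp (3 * real L) * P) \<le> exp (- (3 * real L)) * exp (2 * real L)"
        by (rule mult_left_mono) simp
      then have "P \<le> exp (- real L)" by (simp add: mult.assoc[symmetric] exp_add[symmetric])
      also have "\<dots> \<le> exp (- s)" using L by simp
      finally show ?case by (simp add: P_def p y_def s_def)
    qed
  qed
  then show ?thesis using K by blast
qed

section \<open>From moments to profiles\<close>

text \<open>The integral of \<psi> against the probability measure with mass k / n at k^2 / n, whose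
  moments are the normalized odd power sums.\<close>

definition test_sum :: "(real \<Rightarrow> real) \<Rightarrow> nat \<Rightarrow> nat set \<Rightarrow> real" where
  "test_sum \<psi> n S = (\<Sum>k\<in>S. real k / real n * \<psi> ((real k)\<^sup>2 / real n))"

lemma test_sum_polynomial:
  fixes a :: "nat \<Rightarrow> real"
  shows "\<exists>l. conv_prob c (test_sum (\<lambda>x. \<Sum>i\<le>N. a i * x ^ i)) l"
proof -
  have "\<forall>i. \<exists>m. conv_prob c (\<lambda>n S. power_sum_odd (Suc i) S / real n ^ Suc i) m"
    by (intro allI moment_conv_prob) simp
  then obtain m where m: "\<And>i. conv_prob c (\<lambda>n S. power_sum_odd (Suc i) S / real n ^ Suc i) (m i)" by metis
  have "test_sum (\<lambda>x. \<Sum>i\<le>N. a i * x ^ i) n S = (\<Sum>i\<le>N. a i * (power_sum_odd (Suc i) S / real n ^ Suc i))" for n S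
  proof -
    have "test_sum (\<lambda>x. \<Sum>i\<le>N. a i * x ^ i) n S = (\<Sum>k\<in>S. \<Sum>i\<le>N. a i * (real k ^ (2 * Suc i - 1) / real n ^ Suc i))"
      unfolding test_sum_def sum_distrib_left
    proof (intro sum.cong refl)
      fix k i
      have e: "real k ^ (2 * Suc i - 1) = real k * ((real k)\<^sup>2) ^ i" by (simp add: power_mult)
      show "real k / real n * (a i * ((real k)\<^sup>2 / real n) ^ i) = a i * (real k ^ (2 * Suc i - 1) / real n ^ Suc i)"
        unfolding e power_Suc power_divide by simp
    qed
    also have "\<dots> = (\<Sum>i\<le>N. a i * (power_sum_odd (Suc i) S / real n ^ Suc i))"
      by (subst sum.swap) (simp only: power_sum_odd_def sum_distrib_left sum_divide_distrib)
    finally show ?thesis .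
  qed
  then have "test_sum (\<lambda>x. \<Sum>i\<le>N. a i * x ^ i) = (\<lambda>n S. \<Sum>i\<le>N. a i * (power_sum_odd (Suc i) S / real n ^ Suc i))"
    by (intro ext)
  moreover have "conv_prob c (\<lambda>n S. \<Sum>i\<le>N. a i * (power_sum_odd (Suc i) S / real n ^ Suc i)) (\<Sum>i\<le>N. a i * m i)"
    by (intro conv_prob_sum conv_prob_cmult m)
  ultimately show ?thesis by auto
qed

lemma conv_probD: "conv_prob c X a \<Longrightarrow> 0 < \<epsilon> \<Longrightarrow> small c (\<lambda>n S. \<epsilon> < \<bar>X n S - a\<bar>)"
  by (simp add: conv_prob_def)

text \<open>Off a small set the measure lives on [0, K^2], where a polynomial approximates \<psi>;
  its total mass 1 passes the uniform error on unchanged.\<close>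

lemma test_sum_continuous:
  assumes "continuous_on {0..} \<psi>"
  shows "\<exists>l. conv_prob c (test_sum \<psi>) l"
proof (rule conv_prob_approx)
  fix \<epsilon> :: real assume \<epsilon>: "0 < \<epsilon>"
  obtain K where K: "0 < K" "small c (\<lambda>n S. K * sqrt (real n) \<le> real (max_part S))" using max_small by blast
  have "continuous_on {0..K\<^sup>2} \<psi>" by (rule continuous_on_subset[OF assms]) auto
  then obtain g where g: "real_polynomial_function g" "\<And>x. x \<in> {0..K\<^sup>2} \<Longrightarrow> \<bar>\<psi> x - g x\<bar> < \<epsilon> / 2"
    using Stone_Weierstrass_real_polynomial_function[of "{0..K\<^sup>2}" \<psi> "\<epsilon> / 2"] \<epsilon> by auto
  obtain a N where "g = (\<lambda>x. \<Sum>i\<le>N. a i * x ^ i)" using g(1) unfolding real_polynomial_function_iff_sum by blast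
  then obtain l where l: "conv_prob c (test_sum g) l" using test_sum_polynomial by blast
  have "small c (\<lambda>n S. \<epsilon> < \<bar>test_sum \<psi> n S - l\<bar>)"
  proof (rule small_union[OF K(2)])
    show "small c (\<lambda>n S. \<epsilon> / 2 < \<bar>test_sum g n S - l\<bar>)" by (rule conv_probD[OF l]) (use \<epsilon> in simp)
    show "\<forall>\<^sub>F n in sequentially. \<forall>S\<in>strict_sets n. \<epsilon> < \<bar>test_sum \<psi> n S - l\<bar> \<longrightarrow>
        K * sqrt (real n) \<le> real (max_part S) \<or> \<epsilon> / 2 < \<bar>test_sum g n S - l\<bar>"
      using eventually_gt_at_top[of 0]
    proof eventually_elim
      case (elim n)
      show ?case
      proof (intro ballI impI)
        fix S assume S: "S \<in> strict_sets n" and e: "\<epsilon> < \<bar>test_sum \<psi> n S - l\<bar>"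
        note S' = strict_setsD[OF S]
        show "K * sqrt (real n) \<le> real (max_part S) \<or> \<epsilon> / 2 < \<bar>test_sum g n S - l\<bar>"
        proof (cases "K * sqrt (real n) \<le> real (max_part S)")
          case False
          have "\<bar>test_sum \<psi> n S - test_sum g n S\<bar> \<le> (\<Sum>k\<in>S. real k / real n * (\<epsilon> / 2))"
            unfolding test_sum_def sum_subtractf[symmetric]
          proof (rule order_trans[OF sum_abs sum_mono])
            fix k assume k: "k \<in> S"
            have "real k \<le> K * sqrt (real n)" using max_part_ge[OF S'(1) k] False by linarith
            then have "(real k)\<^sup>2 \<le> (K * sqrt (real n))\<^sup>2" by (rule power_mono) simp
            then have "(real k)\<^sup>2 / real n \<in> {0..K\<^sup>2}" using elim by (simp add: power_mult_distrib pos_divide_le_eq)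
            then have "\<bar>\<psi> ((real k)\<^sup>2 / real n) - g ((real k)\<^sup>2 / real n)\<bar> \<le> \<epsilon> / 2" using g(2) by (simp add: less_imp_le)
            then have "real k / real n * \<bar>\<psi> ((real k)\<^sup>2 / real n) - g ((real k)\<^sup>2 / real n)\<bar> \<le> real k / real n * (\<epsilon> / 2)"
              by (rule mult_left_mono) simp
            then show "\<bar>real k / real n * \<psi> ((real k)\<^sup>2 / real n) - real k / real n * g ((real k)\<^sup>2 / real n)\<bar> \<le> real k / real n * (\<epsilon> / 2)"
              unfolding right_diff_distrib[symmetric] abs_mult by simp
          qed
          also have "\<dots> = real (\<Sum>S) / real n * (\<epsilon> / 2)" by (simp add: sum_distrib_right sum_divide_distrib)
          also have "\<dots> = \<epsilon> / 2" using S'(3) elim by simp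
          finally show ?thesis using e by linarith
        qed simp
      qed
    qed
  qed
  then show "\<exists>a. small c (\<lambda>n S. \<epsilon> < \<bar>test_sum \<psi> n S - a\<bar>)" by blast
qed

lemma card_interval_le:
  fixes A :: "nat set"
  assumes "finite A" "0 \<le> D" "\<And>k. k \<in> A \<Longrightarrow> X \<le> real k \<and> real k < X + D"
  shows "real (card A) \<le> D + 1"
proof (cases "A = {}")
  case False
  have "A \<subseteq> {Min A..Max A}" using assms(1) by auto
  then have "card A \<le> Max A + 1 - Min A" using card_mono[of "{Min A..Max A}" A] by simp
  moreover have "X \<le> real (Min A)" "real (Max A) < X + D" "Min A \<le> Max A"
    using assms(3)[OF Min_in[OF assms(1) False]] assms(3)[OF Max_in[OF assms(1) False]] Max_ge[OF assms(1) Min_in[OF assms(1) False]] by auto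
  ultimately show ?thesis by linarith
qed (use assms in simp)

section \<open>The scaled counting function of the parts\<close>

definition row_count :: "real \<Rightarrow> nat \<Rightarrow> nat set \<Rightarrow> real" where
  "row_count x n S = real (card {k \<in> S. x * sqrt (2 * real n) \<le> real k}) / sqrt (2 * real n)"

lemma row_count_antimono: "finite S \<Longrightarrow> x \<le> y \<Longrightarrow> row_count y n S \<le> row_count x n S"
proof -
  assume S: "finite S" and xy: "x \<le> y"
  have "{k \<in> S. y * sqrt (2 * real n) \<le> real k} \<subseteq> {k \<in> S. x * sqrt (2 * real n) \<le> real k}"
    using xy by (auto intro: order_trans[OF mult_right_mono])
  then have "card {k \<in> S. y * sqrt (2 * real n) \<le> real k} \<le> card {k \<in> S. x * sqrt (2 * real n) \<le> real k}"
    using S by (intro card_mono) auto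
  then show ?thesis unfolding row_count_def by (intro divide_right_mono) auto
qed

lemma row_count_nonneg: "0 \<le> row_count x n S"
  by (simp add: row_count_def)

text \<open>The parts are distinct integers, so an interval contains at most its length plus one of
  them.\<close>

lemma row_count_lipschitz:
  assumes S: "finite S" and n: "0 < n" and \<delta>: "0 \<le> \<delta>"
  shows "row_count x n S \<le> row_count (x + \<delta>) n S + \<delta> + 1 / sqrt (2 * real n)"
proof -
  define s where "s = sqrt (2 * real n)"
  have s: "0 < s" using n by (simp add: s_def)
  have E: "{k \<in> S. x * s \<le> real k} = {k \<in> S. (x + \<delta>) * s \<le> real k} \<union> {k \<in> S. x * s \<le> real k \<and> real k < (x + \<delta>) * s}"
  proof -
    have "x * s \<le> (x + \<delta>) * s" using s \<delta> by (intro mult_right_mono) auto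
    then show ?thesis by force
  qed
  have "card {k \<in> S. x * s \<le> real k} \<le> card {k \<in> S. (x + \<delta>) * s \<le> real k} + card {k \<in> S. x * s \<le> real k \<and> real k < (x + \<delta>) * s}"
    unfolding E by (rule card_Un_le)
  moreover have "real (card {k \<in> S. x * s \<le> real k \<and> real k < (x + \<delta>) * s}) \<le> \<delta> * s + 1"
    by (rule card_interval_le[of _ _ "x * s"]) (use S s \<delta> in \<open>auto simp: distrib_right\<close>)
  ultimately have "real (card {k \<in> S. x * s \<le> real k}) \<le> real (card {k \<in> S. (x + \<delta>) * s \<le> real k}) + \<delta> * s + 1"
    by linarith
  then have "real (card {k \<in> S. x * s \<le> real k}) / s \<le> (real (card {k \<in> S. (x + \<delta>) * s \<le> real k}) + \<delta> * s + 1) / s"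
    by (rule divide_right_mono) (use s in simp)
  then show ?thesis unfolding row_count_def s_def[symmetric] using s by (simp add: add_divide_distrib)
qed

text \<open>Every counted part uses at least \<open>x * s\<close> boxes, and
  \<open>s * s / 2\<close> boxes are available in total.\<close>

lemma row_count_tail_count:
  assumes S: "S \<in> strict_sets n" and n: "0 < n" and x: "0 < x"
  shows "row_count x n S \<le> 1 / (2 * x)"
proof -
  note S' = strict_setsD[OF S]
  define s where "s = sqrt (2 * real n)"
  have s: "0 < s" "s * s = 2 * real n" using n by (auto simp: s_def)
  let ?A = "{k \<in> S. x * s \<le> real k}"
  have "real (card ?A) * (x * s) \<le> (\<Sum>k\<in>?A. real k)"
    using sum_bounded_below[of ?A "x * s" real] by simp
  also have "\<dots> \<le> (\<Sum>k\<in>S. real k)" by (rule sum_mono2) (use S' in auto)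
  also have "\<dots> = real (\<Sum>S)" by simp
  also have "\<dots> = s * s / 2" using S'(3) s(2) by simp
  finally have "real (card ?A) * x * s \<le> s / 2 * s" by (simp add: mult_ac)
  then have "real (card ?A) * x \<le> s / 2" using s(1) by (rule mult_right_le_imp_le)
  then show ?thesis unfolding row_count_def s_def[symmetric] using s x by (simp add: field_simps)
qed

lemma row_count_conv_prob:
  assumes x: "0 \<le> x"
  shows "\<exists>a. conv_prob c (row_count x) a"
proof (rule conv_prob_approx)
  fix \<epsilon> :: real assume \<epsilon>: "0 < \<epsilon>"
  define \<delta> where "\<delta> = \<epsilon> / 8"
  have \<delta>: "0 < \<delta>" using \<epsilon> by (simp add: \<delta>_def)
  \<comment> \<open>The ramp rises between x + \<delta> and x + 2 \<delta>. It starts beyond x so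
    that it vanishes below \<delta>, where the maximum in \<psi> changes the denominator.\<close>
  define ramp where "ramp v = max 0 (min 1 ((v - (x + \<delta>)) / \<delta>))" for v :: real
  \<comment> \<open>At u = k^2 / n the square root is k / sqrt (2 n), so the denominator turns the
    mass k / n into the weight 1 / sqrt (2 n) of \<open>row_count\<close>; the maximum keeps \<psi>
    continuous at 0.\<close>
  define \<psi> where "\<psi> u = ramp (sqrt (u / 2)) / (2 * max (sqrt (u / 2)) \<delta>)" for u
  have ramp: "ramp v = 0" if "v \<le> x + \<delta>" for v using that \<delta> by (simp add: ramp_def divide_nonpos_pos)
  have ramp1: "ramp v = 1" if "x + 2 * \<delta> \<le> v" for v using that \<delta> by (simp add: ramp_def)
  have ramp01: "0 \<le> ramp v" "ramp v \<le> 1" for v by (auto simp: ramp_def)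
  have "continuous_on {0..} \<psi>"
    unfolding \<psi>_def ramp_def by (intro continuous_intros) (use \<delta> in auto)
  then obtain l where l: "conv_prob c (test_sum \<psi>) l" using test_sum_continuous by blast
  have V: "test_sum \<psi> n S = (\<Sum>k\<in>S. ramp (real k / sqrt (2 * real n)) / sqrt (2 * real n))" if n: "0 < n" for n S
    unfolding test_sum_def
  proof (rule sum.cong[OF refl])
    fix k
    define s where "s = sqrt (2 * real n)"
    have s: "0 < s" "s * s = 2 * real n" using n by (auto simp: s_def)
    have w: "sqrt ((real k)\<^sup>2 / real n / 2) = real k / s" by (simp add: s_def real_sqrt_divide mult.commute)
    show "real k / real n * \<psi> ((real k)\<^sup>2 / real n) = ramp (real k / sqrt (2 * real n)) / sqrt (2 * real n)"
    proof (cases "real k / s \<le> x + \<delta>")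
      case True
      then show ?thesis using ramp unfolding \<psi>_def w s_def[symmetric] by simp
    next
      case False
      then have kd: "\<delta> \<le> real k / s" "0 < real k / s" using x \<delta> by linarith+
      have k: "0 < real k" using kd(2) s by (simp add: zero_less_divide_iff)
      have "real k / real n * (ramp (real k / s) / (2 * (real k / s))) = ramp (real k / s) * (s / (2 * real n))"
        using k n s by (simp add: field_simps)
      also have "s / (2 * real n) = 1 / s"
        unfolding s(2)[symmetric] by (rule nonzero_divide_mult_cancel_right) (use s in simp)
      finally show ?thesis unfolding \<psi>_def w s_def[symmetric] using kd by (simp add: max_absorb1)
    qed
  qed
  have close: "\<bar>row_count x n S - test_sum \<psi> n S\<bar> \<le> 2 * \<delta> + 1 / sqrt (2 * real n)" if n: "0 < n" and S: "finite S" for n S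
  proof -
    define s where "s = sqrt (2 * real n)"
    have s: "0 < s" using n by (simp add: s_def)
    have ind: "row_count y n S = (\<Sum>k\<in>S. of_bool (y \<le> real k / s) / s)" for y
    proof -
      have "{k \<in> S. y * s \<le> real k} = S \<inter> {k. y \<le> real k / s}" using s by (auto simp: pos_le_divide_eq)
      then show ?thesis using S by (simp add: row_count_def s_def[symmetric] sum_divide_distrib[symmetric])
    qed
    have "row_count (x + 2 * \<delta>) n S \<le> test_sum \<psi> n S"
      unfolding ind V[OF n] s_def[symmetric]
      by (intro sum_mono divide_right_mono) (use s ramp1 ramp01 in \<open>auto simp: of_bool_def\<close>)
    moreover have "test_sum \<psi> n S \<le> row_count x n S"
      unfolding ind V[OF n] s_def[symmetric]
      by (intro sum_mono divide_right_mono) (use s ramp ramp01 \<delta> in \<open>auto simp: of_bool_def\<close>)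
    moreover have "row_count x n S \<le> row_count (x + 2 * \<delta>) n S + 2 * \<delta> + 1 / sqrt (2 * real n)"
      by (rule row_count_lipschitz[OF S n]) (use \<delta> in simp)
    ultimately show ?thesis by linarith
  qed
  have "(\<lambda>n. 1 / sqrt (2 * real n)) \<longlonglongrightarrow> 0"
    by (rule real_tendsto_divide_at_top[OF tendsto_const])
       (intro filterlim_compose[OF sqrt_at_top] filterlim_tendsto_pos_mult_at_top[OF tendsto_const _ filterlim_real_sequentially], simp)
  then have ev: "eventually (\<lambda>n. 1 / sqrt (2 * real n) < \<epsilon> / 4) sequentially" using \<epsilon> by (intro order_tendstoD(2)) auto
  have "small c (\<lambda>n S. \<epsilon> < \<bar>row_count x n S - l\<bar>)"
  proof (rule small_mono)
    show "small c (\<lambda>n S. \<epsilon> / 2 < \<bar>test_sum \<psi> n S - l\<bar>)" by (rule conv_probD[OF l]) (use \<epsilon> in simp)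
    show "\<forall>\<^sub>F n in sequentially. \<forall>S\<in>strict_sets n. \<epsilon> < \<bar>row_count x n S - l\<bar> \<longrightarrow> \<epsilon> / 2 < \<bar>test_sum \<psi> n S - l\<bar>"
      using ev eventually_gt_at_top[of 0]
    proof eventually_elim
      case (elim n)
      show ?case
      proof (intro ballI impI)
        fix S assume S: "S \<in> strict_sets n" and e: "\<epsilon> < \<bar>row_count x n S - l\<bar>"
        have "\<bar>row_count x n S - test_sum \<psi> n S\<bar> \<le> \<epsilon> / 2"
          using close[OF elim(2) strict_setsD(1)[OF S]] elim(1) unfolding \<delta>_def by linarith
        then show "\<epsilon> / 2 < \<bar>test_sum \<psi> n S - l\<bar>" using e by linarith
      qed
    qed
  qed
  then show "\<exists>a. small c (\<lambda>n S. \<epsilon> < \<bar>row_count x n S - a\<bar>)" by blast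
qed

text \<open>A finite grid suffices because \<open>row_count\<close> and its limit are antitone,
  \<open>row_count\<close> is Lipschitz up to a vanishing error, and beyond the grid both are small.
  A nontrivial filter makes limits unique, so sign and monotonicity pass to F.\<close>

lemma row_count_limit_uniform:
  assumes nb: "ratio_filter c \<noteq> bot"
  shows "\<exists>F. (\<forall>x\<ge>0. 0 \<le> F x) \<and> (\<forall>\<epsilon>>0. small c (\<lambda>n S. \<exists>x\<ge>0. \<epsilon> < \<bar>row_count x n S - F x\<bar>))"
proof -
  have "\<forall>x. \<exists>a. 0 \<le> x \<longrightarrow> conv_prob c (row_count x) a" using row_count_conv_prob by blast
  then obtain F where F: "\<And>x. 0 \<le> x \<Longrightarrow> conv_prob c (row_count x) (F x)" by metis
  have F0: "0 \<le> F x" if x: "0 \<le> x" for x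
  proof (rule ccontr)
    assume neg: "\<not> 0 \<le> F x"
    then have "small c (\<lambda>n S. - F x / 2 < \<bar>row_count x n S - F x\<bar>)" by (intro conv_probD[OF F[OF x]]) simp
    moreover have "- F x / 2 < \<bar>row_count x n S - F x\<bar>" for n S using row_count_nonneg[of x n S] neg by linarith
    ultimately show False using not_small_True[OF nb] by simp
  qed
  have F_anti: "F y \<le> F x" if x: "0 \<le> x" "x \<le> y" for x y
  proof (rule ccontr)
    define g where "g = (F y - F x) / 3"
    assume "\<not> F y \<le> F x"
    then have g: "0 < g" by (simp add: g_def)
    have "small c (\<lambda>_ _. True)"
    proof (rule small_union)
      show "small c (\<lambda>n S. g < \<bar>row_count x n S - F x\<bar>)" "small c (\<lambda>n S. g < \<bar>row_count y n S - F y\<bar>)"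
        using conv_probD[OF F[of x] g] conv_probD[OF F[of y] g] x by auto
      show "\<forall>\<^sub>F n in sequentially. \<forall>S\<in>strict_sets n. True \<longrightarrow> g < \<bar>row_count x n S - F x\<bar> \<or> g < \<bar>row_count y n S - F y\<bar>"
      proof (intro always_eventually allI ballI impI)
        fix n S assume "S \<in> strict_sets n"
        then have "row_count y n S \<le> row_count x n S" using row_count_antimono[OF strict_setsD(1) x(2)] by blast
        moreover have "F y - F x = 3 * g" by (simp add: g_def)
        ultimately show "g < \<bar>row_count x n S - F x\<bar> \<or> g < \<bar>row_count y n S - F y\<bar>" using g by linarith
      qed
    qed
    then show False using not_small_True[OF nb] by blast
  qed
  have "small c (\<lambda>n S. \<exists>x\<ge>0. \<epsilon> < \<bar>row_count x n S - F x\<bar>)" if \<epsilon>: "0 < \<epsilon>" for \<epsilon>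
  proof -
    \<comment> \<open>Inside a grid cell the error stays below 3 \<eta>: one \<eta> each for the
      grid value, the mesh and the term 1 / sqrt (2 n).\<close>
    define \<eta> where "\<eta> = \<epsilon> / 4"
    have \<eta>: "0 < \<eta>" using \<epsilon> by (simp add: \<eta>_def)
    \<comment> \<open>The grid then reaches beyond 1 / \<eta>, where the tail bound 1 / (2 x) is at
      most \<eta>.\<close>
    obtain M :: nat where M: "1 / \<eta>\<^sup>2 < real M" using reals_Archimedean2 by blast
    have M0: "0 < real M" using M \<eta> by (meson divide_pos_pos less_trans zero_less_one zero_less_power)
    have tailM: "1 / (2 * (real M * \<eta>)) \<le> \<eta>"
    proof -
      have "1 < real M * \<eta>\<^sup>2" using M \<eta> by (simp add: pos_divide_less_eq)
      then show ?thesis using M0 \<eta> by (simp add: pos_divide_le_eq power2_eq_square algebra_simps)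
    qed
    have grid: "small c (\<lambda>n S. \<exists>i\<in>{..M}. \<eta> < \<bar>row_count (real i * \<eta>) n S - F (real i * \<eta>)\<bar>)"
    proof (rule small_finite_union)
      fix i show "small c (\<lambda>n S. \<eta> < \<bar>row_count (real i * \<eta>) n S - F (real i * \<eta>)\<bar>)"
        by (intro conv_probD F) (use \<eta> in auto)
    qed simp
    have "(\<lambda>n. 1 / sqrt (2 * real n)) \<longlonglongrightarrow> 0"
      by (rule real_tendsto_divide_at_top[OF tendsto_const])
         (intro filterlim_compose[OF sqrt_at_top] filterlim_tendsto_pos_mult_at_top[OF tendsto_const _ filterlim_real_sequentially], simp)
    then have ev: "eventually (\<lambda>n. 1 / sqrt (2 * real n) < \<eta>) sequentially" using \<eta> by (intro order_tendstoD(2)) auto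
    show ?thesis
    proof (rule small_mono[OF grid])
      show "\<forall>\<^sub>F n in sequentially. \<forall>S\<in>strict_sets n. (\<exists>x\<ge>0. \<epsilon> < \<bar>row_count x n S - F x\<bar>) \<longrightarrow>
          (\<exists>i\<in>{..M}. \<eta> < \<bar>row_count (real i * \<eta>) n S - F (real i * \<eta>)\<bar>)"
        using ev eventually_gt_at_top[of 0]
      proof eventually_elim
        case (elim n)
        show ?case
        proof (intro ballI impI, rule ccontr)
          fix S assume S: "S \<in> strict_sets n" and "\<exists>x\<ge>0. \<epsilon> < \<bar>row_count x n S - F x\<bar>"
            and no: "\<not> (\<exists>i\<in>{..M}. \<eta> < \<bar>row_count (real i * \<eta>) n S - F (real i * \<eta>)\<bar>)"
          then obtain x where x: "0 \<le> x" "\<epsilon> < \<bar>row_count x n S - F x\<bar>" by blast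
          note fS = strict_setsD(1)[OF S]
          have cl: "\<bar>row_count (real i * \<eta>) n S - F (real i * \<eta>)\<bar> \<le> \<eta>" if "i \<le> M" for i
            using no that by (meson atMost_iff linorder_not_less)
          show False
          proof (cases "real M * \<eta> \<le> x")
            case True
            have "row_count (real M * \<eta>) n S \<le> 1 / (2 * (real M * \<eta>))" by (rule row_count_tail_count[OF S elim(2)]) (use M0 \<eta> in simp)
            moreover have "row_count x n S \<le> row_count (real M * \<eta>) n S" by (rule row_count_antimono[OF fS True])
            moreover have "F x \<le> F (real M * \<eta>)" by (rule F_anti[OF _ True]) (use \<eta> in simp)
            ultimately show False
              using x row_count_nonneg[of x n S] F0[OF x(1)] cl[of M] tailM unfolding \<eta>_def by linarith
          next
            case False
            define i where "i = nat \<lfloor>x / \<eta>\<rfloor>"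
            have i: "real i \<le> x / \<eta>" "x / \<eta> < real i + 1"
              using x \<eta> by (auto simp: i_def)
            have i1: "real i * \<eta> \<le> x" "x \<le> real (Suc i) * \<eta>"
              using i \<eta> by (simp_all add: pos_le_divide_eq pos_divide_less_eq add.commute less_imp_le)
            have "real i * \<eta> < real M * \<eta>" using i1(1) False by linarith
            then have iM: "Suc i \<le> M" using \<eta> by simp
            have e: "real (Suc i) * \<eta> = real i * \<eta> + \<eta>" by (simp add: distrib_right)
            have "row_count (real i * \<eta>) n S \<le> row_count (real (Suc i) * \<eta>) n S + \<eta> + 1 / sqrt (2 * real n)"
              unfolding e by (rule row_count_lipschitz[OF fS elim(2)]) (use \<eta> in simp)
            moreover have "row_count x n S \<le> row_count (real i * \<eta>) n S" "row_count (real (Suc i) * \<eta>) n S \<le> row_count x n S"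
              by (rule row_count_antimono[OF fS i1(1)], rule row_count_antimono[OF fS i1(2)])
            moreover have "F x \<le> F (real i * \<eta>)" "F (real (Suc i) * \<eta>) \<le> F x"
              using F_anti[OF _ i1(1)] F_anti[OF x(1) i1(2)] \<eta> by auto
            ultimately show False
              using x(2) cl[of i] cl[OF iM] iM elim(1) unfolding \<eta>_def by linarith
          qed
        qed
      qed
    qed
  qed
  then show ?thesis using F0 by blast
qed

text \<open>For fixed z the height is t = z + 2 b, so the supremum asks for the largest admissible
  b, which is the number of parts beyond z up to an error of one.\<close>

lemma profile_approx:
  assumes xi: "\<xi> \<in> strict_partitions n" and z: "0 \<le> z"
  shows "\<bar>profile \<xi> z - (z + 2 * real (card {k \<in> set \<xi>. z \<le> real k}))\<bar> \<le> 2"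
proof -
  note X = strict_partitionsD[OF xi]
  define S where "S = set \<xi>"
  have fS: "finite S" by (simp add: S_def)
  define T where "T = {t. \<exists>a b. z = a - b - 1/2 \<and> t = a + b - 1/2 \<and>
      ((\<exists>(x, y) \<in> shifted_diagram \<xi>. a \<in> {real x - 1..real x} \<and> b \<in> {real y - 1..real y})
        \<or> (0 \<le> a \<and> b = 0))}"
  have pT: "profile \<xi> z = Sup T" by (simp add: profile_def T_def)
  \<comment> \<open>A point of a box in row y has a - b at most \<open>part \<xi> y + 1\<close>,
    which with a - b = z + 1/2 gives the threshold z - 1/2. The threshold z + 1/2 guarantees a box
    at height l. A half-open window of length 1 holds one integer, so u and l differ by at most
    1.\<close>
  define u where "u = card {k \<in> S. z - 1/2 \<le> real k}"
  define l where "l = card {k \<in> S. z + 1/2 \<le> real k}"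
  define m where "m = card {k \<in> S. z \<le> real k}"
  have lm: "l \<le> m" unfolding l_def m_def by (rule card_mono) (use fS in auto)
  have mu: "m \<le> u" unfolding m_def u_def by (rule card_mono) (use fS in auto)
  have ul: "u \<le> l + 1"
  proof -
    have E: "{k \<in> S. z - 1/2 \<le> real k} = {k \<in> S. z + 1/2 \<le> real k} \<union> {k \<in> S. z - 1/2 \<le> real k \<and> real k < z + 1/2}" by auto
    have "u \<le> l + card {k \<in> S. z - 1/2 \<le> real k \<and> real k < z + 1/2}" unfolding u_def l_def E by (rule card_Un_le)
    moreover have "card {k \<in> S. z - 1/2 \<le> real k \<and> real k < z + 1/2} \<le> Suc 0"
    proof (subst card_le_Suc0_iff_eq)
      show "\<forall>a\<in>{k \<in> S. z - 1/2 \<le> real k \<and> real k < z + 1/2}. \<forall>b\<in>{k \<in> S. z - 1/2 \<le> real k \<and> real k < z + 1/2}. a = b"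
      proof (intro ballI)
        fix a b assume "a \<in> {k \<in> S. z - 1/2 \<le> real k \<and> real k < z + 1/2}" "b \<in> {k \<in> S. z - 1/2 \<le> real k \<and> real k < z + 1/2}"
        then have "real a < real b + 1" "real b < real a + 1" by auto
        then show "a = b" by linarith
      qed
    qed (use fS in simp)
    ultimately show ?thesis by linarith
  qed
  have upper: "t \<le> z + 2 * real u" if "t \<in> T" for t
  proof -
    obtain a b where ab: "z = a - b - 1/2" "t = a + b - 1/2"
      "(\<exists>(x, y) \<in> shifted_diagram \<xi>. a \<in> {real x - 1..real x} \<and> b \<in> {real y - 1..real y}) \<or> (0 \<le> a \<and> b = 0)"
      using \<open>t \<in> T\<close> unfolding T_def by blast
    have t: "t = z + 2 * b" using ab by simp
    have "b \<le> real u"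
    proof (cases "b = 0")
      case False
      then obtain x y where xy: "(x, y) \<in> shifted_diagram \<xi>" "a \<le> real x" "real y - 1 \<le> b" "b \<le> real y" using ab(3) by auto
      then have p: "1 \<le> y" "y < x" "x \<le> y + part \<xi> y" by (auto simp: shifted_diagram_def)
      have pz: "z - 1/2 \<le> real (part \<xi> y)" using xy p(3) ab(1) by linarith
      have "y \<le> tail_count (set \<xi>) (part \<xi> y)" using le_part_iff[OF X(1), of "part \<xi> y" y] p by simp
      also have "\<dots> \<le> u" unfolding tail_count_def u_def S_def by (rule card_mono) (use pz in auto)
      finally show ?thesis using xy by linarith
    qed simp
    then show ?thesis using t by simp
  qed
  have zT: "z \<in> T"
    unfolding T_def by (rule CollectI, rule exI[of _ "z + 1/2"], rule exI[of _ 0]) (use z in simp)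
  have lower: "z + 2 * real l \<in> T"
  proof (cases "l = 0")
    case True
    then show ?thesis using zT by simp
  next
    case False
    define j where "j = nat \<lceil>z + 1/2\<rceil>"
    have j: "z + 1/2 \<le> real j" "real j < z + 3/2" "1 \<le> j" using z unfolding j_def by linarith+
    have "{k \<in> S. z + 1/2 \<le> real k} = {k \<in> S. j \<le> k}"
      unfolding j_def by (auto simp: nat_le_iff ceiling_le_iff)
    then have "l = tail_count (set \<xi>) j" by (simp add: l_def tail_count_def S_def)
    then have p: "j \<le> part \<xi> l" using le_part_iff[OF X(1) j(3), of l] False by simp
    have cell: "(l + j, l) \<in> shifted_diagram \<xi>" using p False j(3) by (simp add: shifted_diagram_def)
    show ?thesis
      unfolding T_def
    proof (rule CollectI, rule exI[of _ "real l + z + 1/2"], rule exI[of _ "real l"], intro conjI disjI1)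
      show "\<exists>(x, y)\<in>shifted_diagram \<xi>. real l + z + 1/2 \<in> {real x - 1..real x} \<and> real l \<in> {real y - 1..real y}"
        by (rule bexI[OF _ cell]) (use j in auto)
    qed auto
  qed
  have "bdd_above T" using upper by (rule bdd_aboveI)
  then have "z + 2 * real l \<le> Sup T" by (rule cSup_upper[OF lower])
  moreover have "Sup T \<le> z + 2 * real u" by (rule cSup_least) (use zT upper in auto)
  ultimately show ?thesis using lm mu ul unfolding pT m_def S_def by linarith
qed

lemma dilated_profile_approx:
  assumes xi: "\<xi> \<in> strict_partitions n" and n: "0 < n" and x: "0 \<le> x"
  shows "\<bar>dilated_profile (1 / sqrt (2 * real n)) \<xi> x - (x + 2 * row_count x n (set \<xi>))\<bar> \<le> 2 / sqrt (2 * real n)"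
proof -
  define s where "s = sqrt (2 * real n)"
  have s: "0 < s" using n by (simp add: s_def)
  have "\<bar>profile \<xi> (x * s) - (x * s + 2 * real (card {k \<in> set \<xi>. x * s \<le> real k}))\<bar> \<le> 2"
    by (rule profile_approx[OF xi]) (use x s in simp)
  then have "\<bar>profile \<xi> (x * s) - (x * s + 2 * real (card {k \<in> set \<xi>. x * s \<le> real k}))\<bar> / s \<le> 2 / s"
    by (rule divide_right_mono) (use s in simp)
  moreover have "dilated_profile (1 / s) \<xi> x - (x + 2 * row_count x n (set \<xi>))
      = (profile \<xi> (x * s) - (x * s + 2 * real (card {k \<in> set \<xi>. x * s \<le> real k}))) / s"
    unfolding dilated_profile_def row_count_def s_def[symmetric] using s by (simp add: field_simps)
  ultimately show ?thesis unfolding s_def[symmetric] using s by simp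
qed

lemma measure_shifted_schur_weyl_le:
  assumes B: "\<And>\<xi>. \<xi> \<in> strict_partitions n \<Longrightarrow> A \<xi> \<Longrightarrow> B (set \<xi>)"
  shows "measure (shifted_schur_weyl n d) {\<xi> \<in> strict_partitions n. A \<xi>} \<le> expect n d (\<lambda>S. of_bool (B S))"
proof -
  let ?E = "{\<xi> \<in> strict_partitions n. A \<xi>}"
  have nn: "0 \<le> shifted_schur_weyl_mass n d \<xi>" if "\<xi> \<in> strict_partitions n" for \<xi>
    using shifted_schur_weyl_mass_eq[OF that] weight_nonneg by simp
  have "emeasure (shifted_schur_weyl n d) ?E = (\<Sum>\<xi>\<in>?E. ennreal (shifted_schur_weyl_mass n d \<xi>))"
    unfolding shifted_schur_weyl_def by (rule emeasure_point_measure_finite[OF finite_strict_partitions]) auto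
  also have "\<dots> = ennreal (\<Sum>\<xi>\<in>?E. shifted_schur_weyl_mass n d \<xi>)"
    by (rule sum_ennreal) (use nn in auto)
  finally have "measure (shifted_schur_weyl n d) ?E = (\<Sum>\<xi>\<in>?E. shifted_schur_weyl_mass n d \<xi>)"
    unfolding measure_def by (simp only:) (rule enn2real_ennreal, rule sum_nonneg, use nn in auto)
  also have "\<dots> = (\<Sum>\<xi>\<in>strict_partitions n. if A \<xi> then weight n d (set \<xi>) else 0)"
    by (subst sum.inter_filter[OF finite_strict_partitions, symmetric]) (simp add: shifted_schur_weyl_mass_eq)
  also have "\<dots> \<le> (\<Sum>\<xi>\<in>strict_partitions n. weight n d (set \<xi>) * of_bool (B (set \<xi>)))"
    by (rule sum_mono) (use B weight_nonneg in auto)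
  also have "\<dots> = expect n d (\<lambda>S. of_bool (B S))"
    unfolding expect_def by (rule sum.reindex_bij_betw[OF bij_betw_strict_partitions])
  finally show ?thesis .
qed

theorem theorem1p3:
  fixes c :: real
  shows "\<exists>\<Omega> :: real \<Rightarrow> real. (\<forall>x\<ge>0. 0 \<le> \<Omega> x) \<and>
    (\<forall>d :: nat \<Rightarrow> nat. (\<forall>n. 0 < d n) \<longrightarrow> (\<lambda>n. sqrt (real n) / real (d n)) \<longlonglongrightarrow> c \<longrightarrow>
      (\<forall>\<epsilon>>0. (\<lambda>n. measure (shifted_schur_weyl n (d n))
          {\<xi> \<in> strict_partitions n.
             (SUP x\<in>{0..}. ereal \<bar>dilated_profile (1 / sqrt (2 * real n)) \<xi> x - \<Omega> x\<bar>) > ereal \<epsilon>})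
        \<longlonglongrightarrow> 0))"
proof (cases "ratio_filter c = bot")
  \<comment> \<open>The filter is trivial if no pairs (n, d) approach c, for instance for negative
    c. Then no admissible sequence exists and any nonnegative function serves.\<close>
  case True
  have False if "\<forall>n. 0 < d n" "(\<lambda>n. sqrt (real n) / real (d n)) \<longlonglongrightarrow> c" for d :: "nat \<Rightarrow> nat"
  proof -
    have "filterlim (\<lambda>n. (n, d n)) bot sequentially" using ratio_filter_seq[of d c] that unfolding True by blast
    then have "eventually (\<lambda>n. False) sequentially"
      unfolding filterlim_iff by (elim allE[of _ "\<lambda>_. False"]) simp
    then show False by simp
  qed
  then show ?thesis by (intro exI[of _ "\<lambda>_. 0"]) blast
next
  case False
  then obtain F where F: "\<And>x. 0 \<le> x \<Longrightarrow> 0 \<le> F x"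
      "\<And>\<epsilon>. 0 < \<epsilon> \<Longrightarrow> small c (\<lambda>n S. \<exists>x\<ge>0. \<epsilon> < \<bar>row_count x n S - F x\<bar>)"
    using row_count_limit_uniform by blast
  show ?thesis
  proof (intro exI[of _ "\<lambda>x. x + 2 * F x"] conjI allI impI)
    show "0 \<le> x + 2 * F x" if "0 \<le> x" for x using F(1) that by simp
    fix d :: "nat \<Rightarrow> nat" and \<epsilon> :: real
    assume d: "\<forall>n. 0 < d n" "(\<lambda>n. sqrt (real n) / real (d n)) \<longlonglongrightarrow> c" and \<epsilon>: "0 < \<epsilon>"
    let ?A = "\<lambda>n \<xi>. (SUP x\<in>{0..}. ereal \<bar>dilated_profile (1 / sqrt (2 * real n)) \<xi> x - (x + 2 * F x)\<bar>) > ereal \<epsilon>"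
    \<comment> \<open>Half of \<epsilon> absorbs the rescaled profile error 2 / sqrt (2 n), and the
      factor 2 in front of the counting function halves the remainder.\<close>
    let ?B = "\<lambda>n S. \<exists>x\<ge>0. \<epsilon> / 4 < \<bar>row_count x n S - F x\<bar>"
    have lim: "filterlim (\<lambda>n. (n, d n)) (ratio_filter c) sequentially" using ratio_filter_seq d by blast
    have "small c ?B" using F(2)[of "\<epsilon> / 4"] \<epsilon> by simp
    then have lim0: "(\<lambda>n. expect n (d n) (\<lambda>S. of_bool (?B n S))) \<longlonglongrightarrow> 0"
      using filterlim_compose[OF _ lim] unfolding small_def by fastforce
    have "(\<lambda>n. 2 / sqrt (2 * real n)) \<longlonglongrightarrow> 0"
      by (rule real_tendsto_divide_at_top[OF tendsto_const])
         (intro filterlim_compose[OF sqrt_at_top] filterlim_tendsto_pos_mult_at_top[OF tendsto_const _ filterlim_real_sequentially], simp)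
    then have "eventually (\<lambda>n. 2 / sqrt (2 * real n) < \<epsilon> / 2) sequentially" using \<epsilon> by (intro order_tendstoD(2)) auto
    then have le: "eventually (\<lambda>n. measure (shifted_schur_weyl n (d n)) {\<xi> \<in> strict_partitions n. ?A n \<xi>}
        \<le> expect n (d n) (\<lambda>S. of_bool (?B n S))) sequentially"
      using eventually_gt_at_top[of 0]
    proof eventually_elim
      case (elim n)
      show ?case
      proof (rule measure_shifted_schur_weyl_le)
        fix \<xi> assume xi: "\<xi> \<in> strict_partitions n" and "?A n \<xi>"
        then obtain x where x: "0 \<le> x" "\<epsilon> < \<bar>dilated_profile (1 / sqrt (2 * real n)) \<xi> x - (x + 2 * F x)\<bar>"
          by (auto simp: less_SUP_iff)
        have "\<epsilon> / 4 < \<bar>row_count x n (set \<xi>) - F x\<bar>"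
          using dilated_profile_approx[OF xi elim(2) x(1)] x(2) elim(1) by linarith
        then show "?B n (set \<xi>)" using x(1) by blast
      qed
    qed
    show "(\<lambda>n. measure (shifted_schur_weyl n (d n)) {\<xi> \<in> strict_partitions n. ?A n \<xi>}) \<longlonglongrightarrow> 0"
      by (rule tendsto_sandwich[OF always_eventually le tendsto_const lim0]) simp
  qed
qed

end
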